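(* The isometry group of $\widetilde{PSL_2(\mathbb{R})}$ is generated by the lifts of the isometries of $\mathbb{H}^2$ together with the vertical translations along the fibers.
   Context: $U\mathbb{H}^2$ is the unit tangent bundle of the hyperbolic plane (curvature $-1$), with the metric induced from the natural metric of $T\mathbb{H}^2$: for a tangent vector $V=\alpha'(0)$ with $\alpha(t)=(p(t),v(t))$, $\|V\|^2=\|p'(0)\|^2+\|\frac{Dv}{dt}(0)\|^2$. The group $PSL_2(\mathbb{R})$ of orientation-preserving isometries of $\mathbb{H}^2$ acts simply transitively on $U\mathbb{H}^2$, which identifies $PSL_2(\mathbb{R})$ with $U\mathbb{H}^2$, and $\widetilde{PSL_2(\mathbb{R})}$ is the universal covering of $U\mathbb{H}^2$ with the lifted metric. If $(x,y)$ are global conformal coordinates of $\mathbb{H}^2$ with metric $\lambda^2(dx^2+dy^2)$, then $\widetilde{PSL_2(\mathbb{R})}$ is $\mathbb{H}^2\times\mathbb{R}$ with metric $$ds^2=\lambda^2(dx^2+dy^2)+\Big(-\frac{\lambda_y}{\lambda}dx+\frac{\lambda_x}{\lambda}dy+dz\Big)^2,$$ where $z$ is the (lifted) angle that the unit vector makes with $\partial_x$. The fibers are the vertical lines $\{(x,y)\}\times\mathbb{R}$, and the vertical translations are $(x,y,z)\mapsto(x,y,z+a)$, $a\in\mathbb{R}$. The lift of an isometry $f$ of $\mathbb{H}^2$ is a lift to the universal covering of the map $df:U\mathbb{H}^2\to U\mathbb{H}^2$, $(p,v)\mapsto(f(p),d_pf(v))$. *)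

theory Defs
  imports "HOL-Analysis.Analysis" "HOL-Algebra.Bij" "HOL-Algebra.Generated_Groups"
begin

section \<open>Smooth maps and Riemannian isometries between open subsets of Euclidean spaces\<close>

text \<open>\<open>Ck_on k S f\<close>: the map \<open>f\<close> is of class \<open>C\<^sup>k\<close> on the open set \<open>S\<close>; \<open>C\<^sup>k\<^sup>+\<^sup>1\<close> means
  differentiable with all directional derivatives of class \<open>C\<^sup>k\<close>.\<close>

primrec Ck_on ::
  "nat \<Rightarrow> 'a::real_normed_vector set \<Rightarrow> ('a \<Rightarrow> 'b::real_normed_vector) \<Rightarrow> bool" where
  "Ck_on 0 S f \<longleftrightarrow> continuous_on S f"
| "Ck_on (Suc k) S f \<longleftrightarrow>
     (\<forall>x\<in>S. f differentiable (at x)) \<and> (\<forall>v. Ck_on k S (\<lambda>x. frechet_derivative f (at x) v))"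

definition smooth_on ::
  "'a::real_normed_vector set \<Rightarrow> ('a \<Rightarrow> 'b::real_normed_vector) \<Rightarrow> bool" where
  "smooth_on S f \<longleftrightarrow> (\<forall>k. Ck_on k S f)"

text \<open>A Riemannian metric on an open set is given by its quadratic form: \<open>g p v\<close> is the squared
  length of the tangent vector \<open>v\<close> at \<open>p\<close>.\<close>

definition riemannian_isometry ::
  "'a::real_normed_vector set \<Rightarrow> ('a \<Rightarrow> 'a \<Rightarrow> real) \<Rightarrow> ('a \<Rightarrow> 'a) \<Rightarrow> bool" where
  "riemannian_isometry S g f \<longleftrightarrow>
     bij_betw f S S \<and> smooth_on S f \<and> smooth_on S (inv_into S f) \<and>
     (\<forall>p\<in>S. \<forall>v. g (f p) (frechet_derivative f (at p) v) = g p v)"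


section \<open>The hyperbolic plane\<close>

text \<open>The upper half-plane, with the metric \<open>\<lambda>\<^sup>2 (dx\<^sup>2 + dy\<^sup>2)\<close>, \<open>\<lambda> = 1/y\<close>.\<close>

definition hyp_plane :: "(real \<times> real) set" where
  "hyp_plane = {(x, y). y > 0}"

definition lam :: "real \<times> real \<Rightarrow> real" where
  "lam = (\<lambda>(x, y). 1 / y)"

definition lam_x :: "real \<times> real \<Rightarrow> real" where
  "lam_x = (\<lambda>(x, y). deriv (\<lambda>t. lam (t, y)) x)"

definition lam_y :: "real \<times> real \<Rightarrow> real" where
  "lam_y = (\<lambda>(x, y). deriv (\<lambda>t. lam (x, t)) y)"

definition hyp_metric :: "real \<times> real \<Rightarrow> real \<times> real \<Rightarrow> real" where
  "hyp_metric p = (\<lambda>(a, b). (lam p)\<^sup>2 * (a\<^sup>2 + b\<^sup>2))"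

definition hyp_isometry :: "(real \<times> real \<Rightarrow> real \<times> real) \<Rightarrow> bool" where
  "hyp_isometry f \<longleftrightarrow> riemannian_isometry hyp_plane hyp_metric f"


section \<open>The unit tangent bundle\<close>

definition unit_tangent_bundle :: "((real \<times> real) \<times> (real \<times> real)) set" where
  "unit_tangent_bundle = {(p, v). p \<in> hyp_plane \<and> hyp_metric p v = 1}"

definition tangent_map ::
  "(real \<times> real \<Rightarrow> real \<times> real) \<Rightarrow> (real \<times> real) \<times> (real \<times> real) \<Rightarrow> (real \<times> real) \<times> (real \<times> real)"
  where "tangent_map f = (\<lambda>(p, v). (f p, frechet_derivative f (at p) v))"

text \<open>The covariant derivative \<open>Dv/dt\<close> at \<open>t = 0\<close> of a vector field \<open>v\<close> along a curve \<open>p\<close>, in terms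
  of \<open>p(0)\<close>, \<open>p'(0) = (a, b)\<close>, \<open>v(0) = (v1, v2)\<close> and \<open>v'(0) = (w1, w2)\<close>, with the Christoffel
  symbols of a conformal metric.  Here \<open>s = \<lambda>\<^sub>x / \<lambda>\<close> and \<open>t = \<lambda>\<^sub>y / \<lambda>\<close>.\<close>

definition covariant_deriv ::
  "real \<times> real \<Rightarrow> real \<times> real \<Rightarrow> real \<times> real \<Rightarrow> real \<times> real \<Rightarrow> real \<times> real" where
  "covariant_deriv p = (\<lambda>(a, b) (v1, v2) (w1, w2).
     let s = lam_x p / lam p; t = lam_y p / lam p in
     (w1 + s * (a * v1 - b * v2) + t * (a * v2 + b * v1),
      w2 + s * (a * v2 + b * v1) + t * (b * v2 - a * v1)))"

text \<open>The natural metric \<open>\<parallel>p'(0)\<parallel>\<^sup>2 + \<parallel>Dv/dt(0)\<parallel>\<^sup>2\<close> of the tangent bundle.\<close>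

definition tangent_metric ::
  "(real \<times> real) \<times> (real \<times> real) \<Rightarrow> (real \<times> real) \<times> (real \<times> real) \<Rightarrow> real" where
  "tangent_metric = (\<lambda>(p, v) (p', v').
     hyp_metric p p' + hyp_metric p (covariant_deriv p p' v v'))"


section \<open>The universal covering of the unit tangent bundle\<close>

definition psl_space :: "(real \<times> real \<times> real) set" where
  "psl_space = {(x, y, z). (x, y) \<in> hyp_plane}"

definition psl_metric :: "real \<times> real \<times> real \<Rightarrow> real \<times> real \<times> real \<Rightarrow> real" where
  "psl_metric = (\<lambda>(x, y, z) (dx, dy, dz).
     (lam (x, y))\<^sup>2 * (dx\<^sup>2 + dy\<^sup>2) +
     (- (lam_y (x, y) / lam (x, y)) * dx + (lam_x (x, y) / lam (x, y)) * dy + dz)\<^sup>2)"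

text \<open>The covering projection: \<open>(x, y, z)\<close> goes to the unit vector at \<open>(x, y)\<close> that makes the
  angle \<open>z\<close> with \<open>\<partial>\<^sub>x\<close>.\<close>

definition psl_proj :: "real \<times> real \<times> real \<Rightarrow> (real \<times> real) \<times> (real \<times> real)" where
  "psl_proj = (\<lambda>(x, y, z). ((x, y), (cos z / lam (x, y), sin z / lam (x, y))))"

definition lift_of ::
  "(real \<times> real \<Rightarrow> real \<times> real) \<Rightarrow> (real \<times> real \<times> real \<Rightarrow> real \<times> real \<times> real) \<Rightarrow> bool" where
  "lift_of f F \<longleftrightarrow>
     F \<in> extensional psl_space \<and> F \<in> psl_space \<rightarrow> psl_space \<and> continuous_on psl_space F \<and>
     (\<forall>P\<in>psl_space. psl_proj (F P) = tangent_map f (psl_proj P))"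

definition isometry_lifts :: "(real \<times> real \<times> real \<Rightarrow> real \<times> real \<times> real) set" where
  "isometry_lifts = {F. \<exists>f. hyp_isometry f \<and> lift_of f F}"

definition vertical_translation ::
  "real \<Rightarrow> real \<times> real \<times> real \<Rightarrow> real \<times> real \<times> real" where
  "vertical_translation a = (\<lambda>(x, y, z)\<in>psl_space. (x, y, z + a))"

definition vertical_translations :: "(real \<times> real \<times> real \<Rightarrow> real \<times> real \<times> real) set" where
  "vertical_translations = range vertical_translation"

text \<open>\<open>BijGroup S\<close> consists of the bijections of \<open>S\<close> that are extensional, i.e. \<open>undefined\<close>
  outside \<open>S\<close>; hence the extensionality in the definitions above.\<close>

definition psl_isometry_group :: "(real \<times> real \<times> real \<Rightarrow> real \<times> real \<times> real) monoid" where
  "psl_isometry_group = (BijGroup psl_space)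
     \<lparr>carrier := {F \<in> Bij psl_space. riemannian_isometry psl_space psl_metric F}\<rparr>"


section \<open>The model agrees with the intrinsic description\<close>

lemma lam_x_eq: "lam_x (x, y) = 0"
  by (simp add: lam_x_def lam_def)

lemma lam_y_eq:
  assumes "y > 0"
  shows "lam_y (x, y) = - 1 / y\<^sup>2"
proof -
  have "((\<lambda>t. 1 / t) has_field_derivative (- 1 / y\<^sup>2)) (at y)"
    using assms by (auto intro!: derivative_eq_intros simp: power2_eq_square)
  then show ?thesis
    by (simp add: lam_y_def lam_def DERIV_imp_deriv)
qed

lemma psl_metric_eq:
  assumes "y > 0"
  shows "psl_metric (x, y, z) (dx, dy, dz) = (dx\<^sup>2 + dy\<^sup>2) / y\<^sup>2 + (dx / y + dz)\<^sup>2"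
  using assms by (simp add: psl_metric_def lam_x_eq lam_y_eq lam_def power_divide power2_eq_square add.commute)

lemma psl_proj_has_derivative:
  assumes "y > 0"
  shows "(psl_proj has_derivative
    (\<lambda>(dx, dy, dz). ((dx, dy), (dy * cos z - y * sin z * dz, dy * sin z + y * cos z * dz))))
    (at (x, y, z))"
proof -
  have eq: "psl_proj = (\<lambda>P. ((fst P, fst (snd P)),
      (fst (snd P) * cos (snd (snd P)), fst (snd P) * sin (snd (snd P)))))"
    by (auto simp: psl_proj_def lam_def fun_eq_iff)
  show ?thesis
    unfolding eq by (auto intro!: derivative_eq_intros simp: fun_eq_iff algebra_simps)
qed

text \<open>\<open>psl_metric\<close> is the lift of the metric of the unit tangent bundle.\<close>

lemma psl_metric_lifted:
  assumes "P \<in> psl_space"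
  shows "psl_metric P V = tangent_metric (psl_proj P) (frechet_derivative psl_proj (at P) V)"
proof -
  obtain x y z where P: "P = (x, y, z)" by (cases P)
  obtain a b c where V: "V = (a, b, c)" by (cases V)
  have y: "y > 0" using assms by (simp add: P psl_space_def hyp_plane_def)
  have D: "frechet_derivative psl_proj (at P) V =
      ((a, b), (b * cos z - y * sin z * c, b * sin z + y * cos z * c))"
    using frechet_derivative_at[OF psl_proj_has_derivative[OF y, of z x]]
    by (simp add: P V fun_eq_iff split: prod.splits)
  have *: "lam_y (x, y) / lam (x, y) = - (1 / y)"
    using y by (simp add: lam_y_eq lam_def power2_eq_square)
  have C: "covariant_deriv (x, y) (a, b) (cos z * y, sin z * y)
      (b * cos z - y * sin z * c, b * sin z + y * cos z * c) =
      (- sin z * (a + y * c), cos z * (a + y * c))"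
    using y by (simp add: covariant_deriv_def Let_def lam_x_eq *) (simp add: field_simps)
  have "(sin z * (a + y * c))\<^sup>2 + (cos z * (a + y * c))\<^sup>2 =
      ((sin z)\<^sup>2 + (cos z)\<^sup>2) * (a + y * c)\<^sup>2"
    by (simp only: power_mult_distrib distrib_right)
  then have S: "(sin z * (a + y * c))\<^sup>2 + (cos z * (a + y * c))\<^sup>2 = (a + y * c)\<^sup>2"
    by simp
  have "tangent_metric (psl_proj P) (frechet_derivative psl_proj (at P) V) =
      (a\<^sup>2 + b\<^sup>2) / y\<^sup>2 + (a + y * c)\<^sup>2 / y\<^sup>2"
  proof -
    have "psl_proj P = ((x, y), (cos z * y, sin z * y))"
      by (simp add: P psl_proj_def lam_def)
    moreover have "hyp_metric (x, y) (- sin z * (a + y * c), cos z * (a + y * c)) =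
        (a + y * c)\<^sup>2 / y\<^sup>2"
      using S by (simp add: hyp_metric_def lam_def power_divide)
    moreover have "hyp_metric (x, y) (a, b) = (a\<^sup>2 + b\<^sup>2) / y\<^sup>2"
      by (simp add: hyp_metric_def lam_def power_divide)
    ultimately show ?thesis
      unfolding D by (simp only: tangent_metric_def prod.case C)
  qed
  also have "(a + y * c)\<^sup>2 / y\<^sup>2 = (a / y + c)\<^sup>2"
    using y by (simp add: power_divide[symmetric] add_divide_distrib)
  finally show ?thesis
    using y by (simp add: P V psl_metric_eq)
qed

lemma unit_tangent_bundle_eq:
  "unit_tangent_bundle = {((x, y), (u, v)). y > 0 \<and> u\<^sup>2 + v\<^sup>2 = y\<^sup>2}"
  by (auto simp: unit_tangent_bundle_def hyp_plane_def hyp_metric_def lam_def field_simps)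

lemma psl_space_eq: "psl_space = UNIV \<times> {0<..} \<times> UNIV"
  by (auto simp: psl_space_def hyp_plane_def)

text \<open>\<open>psl_proj\<close> is a universal covering of the unit tangent bundle.\<close>

lemma simply_connected_psl_space: "simply_connected psl_space"
  unfolding psl_space_eq by (intro convex_imp_simply_connected convex_Times) auto

lemma open_psl_space: "open psl_space"
  unfolding psl_space_eq by (intro open_Times) auto

lemma psl_proj_eq: "psl_proj (x, y, z) = ((x, y), (y * cos z, y * sin z))"
  by (simp add: psl_proj_def lam_def mult.commute)

lemma continuous_on_psl_proj: "continuous_on A psl_proj"
proof -
  have "psl_proj = (\<lambda>P. ((fst P, fst (snd P)),
      (fst (snd P) * cos (snd (snd P)), fst (snd P) * sin (snd (snd P)))))"
    by (auto simp: psl_proj_eq fun_eq_iff)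
  then show ?thesis
    by (elim ssubst) (intro continuous_intros)
qed

lemma psl_proj_image: "psl_proj ` psl_space = unit_tangent_bundle"
proof (intro equalityI subsetI)
  fix q assume "q \<in> psl_proj ` psl_space"
  then show "q \<in> unit_tangent_bundle"
    by (auto simp: psl_space_eq psl_proj_eq unit_tangent_bundle_eq power_mult_distrib
        simp flip: distrib_left)
next
  fix q assume q: "q \<in> unit_tangent_bundle"
  obtain x y u v where q': "q = ((x, y), (u, v))" by (metis surj_pair)
  have y: "y > 0" and uv: "u\<^sup>2 + v\<^sup>2 = y\<^sup>2" using q by (auto simp: q' unit_tangent_bundle_eq)
  have "(u / y)\<^sup>2 + (v / y)\<^sup>2 = 1"
    using y uv by (simp add: power_divide flip: add_divide_distrib)
  then obtain t where "u / y = cos t" "v / y = sin t"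
    using sincos_total_2pi by metis
  then have "q = psl_proj (x, y, t)" using y by (auto simp: psl_proj_eq q' field_simps)
  then show "q \<in> psl_proj ` psl_space" using y by (auto simp: psl_space_eq)
qed

lemma cos_sin_int_2pi: "cos (of_int n * (2 * pi)) = 1" "sin (of_int n * (2 * pi)) = 0"
  using cos_int_2pin[of n] sin_int_2pin[of n] by (simp_all add: mult.commute)

lemma psl_proj_covering_space: "covering_space psl_space psl_proj unit_tangent_bundle"
proof (intro covering_spaceI continuous_on_psl_proj psl_proj_image)
  fix q assume "q \<in> unit_tangent_bundle"
  then obtain x0 y0 z0 where q: "q = psl_proj (x0, y0, z0)" and y0: "y0 > 0"
    by (force simp: psl_space_eq simp flip: psl_proj_image)
  define h :: "(real \<times> real) \<times> (real \<times> real) \<Rightarrow> real"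
    where "h = (\<lambda>((x, y), (u, v)). u * cos z0 + v * sin z0)"
  define k :: "(real \<times> real) \<times> (real \<times> real) \<Rightarrow> real"
    where "k = (\<lambda>((x, y), (u, v)). (v * cos z0 - u * sin z0) / y)"
  have h: "h (psl_proj (x, y, z)) = y * cos (z - z0)" for x y z
    by (simp add: h_def psl_proj_eq cos_diff algebra_simps)
  have k: "k (psl_proj (x, y, z)) = sin (z - z0)" if "y > 0" for x y z
    using that by (simp add: k_def psl_proj_eq sin_diff field_simps)
  have cont_h: "continuous_on UNIV h"
    by (auto simp: h_def case_prod_unfold intro!: continuous_intros)
  define T where "T = unit_tangent_bundle \<inter> h -` {0<..}"
  define U where "U n = psl_space \<inter> {(x, y, z). \<bar>z - z0 - of_int n * (2 * pi)\<bar> < pi / 2}"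
    for n :: int
  have cont_k: "continuous_on T k"
    unfolding k_def case_prod_unfold
    by (intro continuous_intros) (auto simp: T_def unit_tangent_bundle_eq)
  have cos_pos: "0 < cos (z - z0)" "sin (z - z0 - of_int n * (2 * pi)) = sin (z - z0)"
    if "\<bar>z - z0 - of_int n * (2 * pi)\<bar> < pi / 2" for z and n :: int
  proof -
    have "cos (z - z0 - of_int n * (2 * pi)) = cos (z - z0)"
      "sin (z - z0 - of_int n * (2 * pi)) = sin (z - z0)"
      unfolding cos_diff[of "z - z0"] sin_diff[of "z - z0"] cos_sin_int_2pi by simp_all
    moreover have "0 < cos (z - z0 - of_int n * (2 * pi))"
      using that unfolding abs_less_iff by (intro cos_gt_zero_pi) linarith+
    ultimately show "0 < cos (z - z0)" "sin (z - z0 - of_int n * (2 * pi)) = sin (z - z0)"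
      by auto
  qed
  have U_T: "P \<in> psl_space \<and> psl_proj P \<in> T" if "P \<in> U n" for P n
  proof -
    obtain x y z where P: "P = (x, y, z)" by (cases P)
    have "P \<in> psl_space" and z: "\<bar>z - z0 - of_int n * (2 * pi)\<bar> < pi / 2"
      using that by (auto simp: U_def P)
    moreover have "y > 0" using \<open>P \<in> psl_space\<close> by (simp add: P psl_space_eq)
    then have "h (psl_proj P) > 0" unfolding P h using cos_pos(1)[OF z] by (rule mult_pos_pos)
    ultimately show ?thesis using psl_proj_image by (auto simp: T_def)
  qed
  have T_sub: "T \<subseteq> psl_proj ` psl_space"
    unfolding T_def psl_proj_image by (rule Int_lower1)
  have T_k: "k p \<in> {-1..1}" if p: "p \<in> T" for p
  proof -
    obtain P where "p = psl_proj P" "P \<in> psl_space"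
      using p T_sub by blast
    then show ?thesis by (cases P) (simp add: psl_space_eq k)
  qed
  show "\<exists>T. q \<in> T \<and> openin (top_of_set unit_tangent_bundle) T \<and>
         (\<exists>v. \<Union> v = psl_space \<inter> psl_proj -` T \<and>
              (\<forall>u\<in>v. openin (top_of_set psl_space) u) \<and>
              pairwise disjnt v \<and> (\<forall>u\<in>v. \<exists>q. homeomorphism u T psl_proj q))"
  proof (intro exI conjI)
    show "q \<in> T"
      using \<open>q \<in> unit_tangent_bundle\<close> y0 by (simp add: T_def q h)
    show "openin (top_of_set unit_tangent_bundle) T"
      unfolding T_def using continuous_on_subset[OF cont_h]
      by (intro continuous_openin_preimage_gen) auto
    show "\<Union> (range U) = psl_space \<inter> psl_proj -` T"
    proof (intro equalityI subsetI)
      fix P assume "P \<in> \<Union> (range U)"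
      then show "P \<in> psl_space \<inter> psl_proj -` T"
        using U_T by blast
    next
      fix P assume P: "P \<in> psl_space \<inter> psl_proj -` T"
      obtain x y z where xyz: "P = (x, y, z)" by (cases P)
      have y: "y > 0" and c: "cos (z - z0) > 0"
        using P by (auto simp: xyz psl_space_eq T_def h zero_less_mult_iff)
      define n where "n = round ((z - z0) / (2 * pi))"
      define w where "w = z - z0 - of_int n * (2 * pi)"
      have "\<bar>of_int n - (z - z0) / (2 * pi)\<bar> \<le> 1 / 2"
        unfolding n_def by (rule of_int_round_abs_le)
      then have "\<bar>(of_int n - (z - z0) / (2 * pi)) * (2 * pi)\<bar> \<le> 1 / 2 * (2 * pi)"
        unfolding abs_mult by (intro mult_mono) auto
      moreover have "(of_int n - (z - z0) / (2 * pi)) * (2 * pi) = - w"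
        by (simp add: w_def field_simps)
      ultimately have w: "\<bar>w\<bar> \<le> pi" by simp
      have "cos w = cos (z - z0)"
        unfolding w_def cos_diff[of "z - z0"] cos_sin_int_2pi by simp
      then have cw: "cos \<bar>w\<bar> > 0" using c by simp
      have "\<bar>w\<bar> < pi / 2"
      proof (rule ccontr)
        assume "\<not> ?thesis"
        then have "cos \<bar>w\<bar> \<le> cos (pi / 2)"
          using w by (intro cos_monotone_0_pi_le) auto
        then show False using cw by simp
      qed
      then have "P \<in> U n" using P by (simp add: U_def xyz w_def)
      then show "P \<in> \<Union> (range U)" by blast
    qed
    show "\<forall>u\<in>range U. openin (top_of_set psl_space) u"
    proof
      fix u assume "u \<in> range U"
      then obtain n where u: "u = U n" by blast
      have "open {P :: real \<times> real \<times> real. \<bar>snd (snd P) - z0 - of_int n * (2 * pi)\<bar> < pi / 2}"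
        by (intro open_Collect_less continuous_intros)
      then show "openin (top_of_set psl_space) u"
        unfolding u U_def by (auto simp: case_prod_unfold intro: openin_open_Int)
    qed
    show "pairwise disjnt (range U)"
    proof (rule pairwiseI)
      fix u u' assume "u \<in> range U" "u' \<in> range U" "u \<noteq> u'"
      then obtain m n where u: "u = U m" "u' = U n" "m \<noteq> n" by blast
      have False if "P \<in> U m" "P \<in> U n" for P
      proof -
        obtain x y z where "P = (x, y, z)" by (cases P)
        then have "\<bar>z - z0 - of_int m * (2 * pi)\<bar> < pi / 2" "\<bar>z - z0 - of_int n * (2 * pi)\<bar> < pi / 2"
          using that by (auto simp: U_def)
        then have "\<bar>of_int m * (2 * pi) - of_int n * (2 * pi)\<bar> < pi" by linarith
        then have "\<bar>of_int (m - n)\<bar> * (2 * pi) < 1 * pi"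
          by (simp add: abs_mult flip: left_diff_distrib)
        moreover have "1 \<le> \<bar>m - n\<bar>" using u by linarith
        then have "(1::real) \<le> \<bar>of_int (m - n)\<bar>" by linarith
        then have "1 * (2 * pi) \<le> \<bar>of_int (m - n)\<bar> * (2 * pi)" by (intro mult_right_mono) auto
        ultimately show False using pi_gt_zero by linarith
      qed
      then show "disjnt u u'" unfolding u disjnt_def by blast
    qed
    show "\<forall>u\<in>range U. \<exists>q. homeomorphism u T psl_proj q"
    proof
      fix u assume "u \<in> range U"
      then obtain n where u: "u = U n" by blast
      define g where "g p = (fst (fst p), snd (fst p), z0 + of_int n * (2 * pi) + arcsin (k p))"
        for p :: "(real \<times> real) \<times> (real \<times> real)"
      have g_proj: "g (psl_proj P) = P" if "P \<in> U n" for P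
      proof -
        obtain x y z where P: "P = (x, y, z)" by (cases P)
        have y: "y > 0" and z: "\<bar>z - z0 - of_int n * (2 * pi)\<bar> < pi / 2"
          using that by (auto simp: U_def P psl_space_eq)
        have "arcsin (sin (z - z0 - of_int n * (2 * pi))) = z - z0 - of_int n * (2 * pi)"
          using z unfolding abs_less_iff by (intro arcsin_sin) linarith+
        then show ?thesis
          using y cos_pos(2)[OF z] by (simp add: P g_def k) (simp add: psl_proj_eq)
      qed
      have lift: "\<exists>P\<in>U n. psl_proj P = p" if p: "p \<in> T" for p
      proof -
        obtain x y z where pz: "p = psl_proj (x, y, z)" and y: "y > 0"
        proof -
          obtain P where "p = psl_proj P" "P \<in> psl_space"
            using p T_sub by blast
          then show ?thesis using that by (cases P) (auto simp: psl_space_eq)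
        qed
        have c: "cos (z - z0) > 0"
          using p y by (auto simp: T_def pz h zero_less_mult_iff)
        define a where "a = arcsin (sin (z - z0))"
        have sa: "sin a = sin (z - z0)" unfolding a_def by (intro sin_arcsin) auto
        have ca: "cos a = cos (z - z0)"
        proof -
          have "cos a = sqrt (1 - (sin (z - z0))\<^sup>2)"
            unfolding a_def by (intro cos_arcsin) auto
          also have "1 - (sin (z - z0))\<^sup>2 = (cos (z - z0))\<^sup>2"
            by (rule cos_squared_eq[symmetric])
          finally show ?thesis using c by simp
        qed
        have "cos a \<noteq> 0" using ca c by linarith
        then have "a \<noteq> pi / 2" "a \<noteq> - (pi / 2)"
          using cos_pi_half cos_minus[of "pi / 2"] by metis+
        moreover have "- (pi / 2) \<le> a" "a \<le> pi / 2"
          unfolding a_def using arcsin_lbound arcsin_ubound sin_ge_minus_one sin_le_one by blast+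
        ultimately have "\<bar>a\<bar> < pi / 2" by linarith
        then have 1: "(x, y, z0 + of_int n * (2 * pi) + a) \<in> U n"
          using y by (simp add: U_def psl_space_eq)
        have "cos (z0 + of_int n * (2 * pi) + a) = cos (z0 + a)"
          "sin (z0 + of_int n * (2 * pi) + a) = sin (z0 + a)"
          unfolding cos_add sin_add cos_sin_int_2pi by simp_all
        moreover have "cos (z0 + a) = cos (z0 + (z - z0))" "sin (z0 + a) = sin (z0 + (z - z0))"
          unfolding cos_add sin_add sa ca by auto
        ultimately have "psl_proj (x, y, z0 + of_int n * (2 * pi) + a) = p"
          by (simp add: pz psl_proj_eq)
        with 1 show ?thesis by blast
      qed
      have "homeomorphism (U n) T psl_proj g"
      proof (rule homeomorphismI)
        show "continuous_on (U n) psl_proj" by (rule continuous_on_psl_proj)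
        show "continuous_on T g"
          unfolding g_def using T_k by (intro continuous_intros cont_k) auto
        show "psl_proj ` U n \<subseteq> T" using U_T by blast
        show "g ` T \<subseteq> U n" using lift g_proj by (metis image_subsetI)
        show "g (psl_proj P) = P" if "P \<in> U n" for P using that by (rule g_proj)
        show "psl_proj (g p) = p" if "p \<in> T" for p using lift[OF that] g_proj by metis
      qed
      then show "\<exists>q. homeomorphism u T psl_proj q" unfolding u by blast
    qed
  qed
qed

end

theory Submission
  imports Defs
begin

text \<open>Let \<open>F = (u, v, w)\<close> be a lift of an isometry \<open>f = (u, v)\<close> of the hyperbolic plane. Since \<open>f\<close> is
  conformal or anticonformal, \<open>dw + du/v = \<plusminus>(dx/y + dz)\<close>, so \<open>F\<close> is an isometry. Conversely, the Ricci
  tensor has the eigenvalues \<open>-3/2, -3/2, 1/2\<close>, the last one in the direction of the fibers, so every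
  isometry \<open>F\<close> maps fibers to fibers. The invariance of the Ricci tensor is read off from Bochner's
  formula, all other terms of which can be expressed by the product \<open>\<langle>\<nabla>u, \<nabla>v\<rangle>\<close> of functions. Thus
  \<open>F\<close> induces an isometry \<open>\<phi>\<close> of the hyperbolic plane, and the composition of \<open>F\<close> with a lift of
  \<open>\<phi>\<^sup>-\<^sup>1\<close> is an isometry over the identity, hence a vertical translation.\<close>


section \<open>Calculus of smooth maps\<close>

text \<open>The definitions supply no connection and no curvature, only a quadratic form and
  derivatives of maps. So the argument tests tensors on gradients of functions, for which invariance
  is a matter of the chain rule. Bochner's formula leaves \<open>(E3 u)^2\<close> as an invariant of
  every smooth \<open>u\<close>; inserting the three coordinates for \<open>u\<close> shows that the
  differential of an isometry sends the vertical vector \<open>(0, 0, 1)\<close> to plus or minus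
  itself. The form dx/y + dz ties the fibers to the base: its exterior derivative is the area form
  dx dy / y^2. Hence the sign with which an isometry acts on this form is the sign with which it
  acts on the orientation of the base. Lifts of orientation-reversing isometries must reverse the
  fibers, and an isometry over the identity cannot; this is why only translations remain once the
  base map has been undone. The angle component of a lift is known only through its cosine, its sine
  and its continuity, so its smoothness has to be recovered from these.\<close>

lemma frechet_derivative_eq:
  "(f has_derivative f') (at x) \<Longrightarrow> frechet_derivative f (at x) = f'"
  using frechet_derivative_at by metis

lemma differentiable_eq_on_open:
  assumes "open S" "x \<in> S" "\<And>y. y \<in> S \<Longrightarrow> f y = g y" "f differentiable (at x)"
  shows "g differentiable (at x)"
    and "frechet_derivative g (at x) = frechet_derivative f (at x)"
proof -
  have "(f has_derivative frechet_derivative f (at x)) (at x)"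
    using assms(4) frechet_derivative_works by blast
  then have "(g has_derivative frechet_derivative f (at x)) (at x)"
    using has_derivative_transform_within_open[OF _ assms(1,2)] assms(3) by blast
  then show "g differentiable (at x)"
    "frechet_derivative g (at x) = frechet_derivative f (at x)"
    by (auto simp: differentiable_def frechet_derivative_eq)
qed

text \<open>Differentiability on an open set depends only on the values there. Lifts and
  translations are \<open>undefined\<close> outside \<open>psl_space\<close>, so formulas for them
  hold on that set only.\<close>

lemma Ck_on_cong:
  assumes "open S" "\<And>y. y \<in> S \<Longrightarrow> f y = g y" "Ck_on k S f"
  shows "Ck_on k S g"
  using assms(2,3)
proof (induction k arbitrary: f g)
  case 0
  then show ?case by (simp cong: continuous_on_cong)
next
  case (Suc k)
  have "g differentiable (at x)" "frechet_derivative g (at x) = frechet_derivative f (at x)"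
    if "x \<in> S" for x
    using differentiable_eq_on_open[OF \<open>open S\<close> that, of f g] Suc.prems that by auto
  moreover have "Ck_on k S (\<lambda>x. frechet_derivative g (at x) v)" for v
    using Suc.IH[of "\<lambda>x. frechet_derivative f (at x) v" "\<lambda>x. frechet_derivative g (at x) v"]
      calculation(2) Suc.prems by simp
  ultimately show ?case by simp
qed

text \<open>The successor clause speaks of the derivatives only, so the nesting of the classes needs
  an induction; at the bottom, differentiability gives continuity.\<close>

lemma Ck_on_Suc_imp: "Ck_on (Suc k) S f \<Longrightarrow> Ck_on k S f"
proof (induction k arbitrary: f)
  case 0
  then show ?case
    by (auto intro!: continuous_at_imp_continuous_on differentiable_imp_continuous_within)
next
  case (Suc k)
  then show ?case by auto
qed

lemma Ck_on_SucI:
  assumes "open S"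
    and "\<And>x. x \<in> S \<Longrightarrow> (f has_derivative f' x) (at x)"
    and "\<And>v. Ck_on k S (\<lambda>x. f' x v)"
  shows "Ck_on (Suc k) S f"
proof -
  have "frechet_derivative f (at x) = f' x" if "x \<in> S" for x
    using assms(2)[OF that] by (rule frechet_derivative_eq)
  then have "Ck_on k S (\<lambda>x. frechet_derivative f (at x) v)" for v
    using Ck_on_cong[OF assms(1) _ assms(3)[of v]] by simp
  then show ?thesis
    using assms(2) by (auto simp: differentiable_def)
qed

lemma Ck_on_SucD:
  assumes "Ck_on (Suc k) S f" "x \<in> S"
  shows "(f has_derivative frechet_derivative f (at x)) (at x)"
  using assms frechet_derivative_works by auto

lemma Ck_on_const: "open S \<Longrightarrow> Ck_on k S (\<lambda>x. c)"
proof (induction k arbitrary: c)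
  case (Suc k)
  then show ?case by (intro Ck_on_SucI[where f' = "\<lambda>x v. 0"]) auto
qed simp

lemma Ck_on_bounded_linear:
  assumes "open S" "bounded_linear L"
  shows "Ck_on k S f \<Longrightarrow> Ck_on k S (\<lambda>x. L (f x))"
proof (induction k arbitrary: f)
  case 0
  then show ?case
    using bounded_linear.continuous_on[OF assms(2)] by simp
next
  case (Suc k)
  show ?case
  proof (rule Ck_on_SucI[where f' = "\<lambda>x v. L (frechet_derivative f (at x) v)"])
    show "((\<lambda>x. L (f x)) has_derivative (\<lambda>v. L (frechet_derivative f (at x) v))) (at x)"
      if "x \<in> S" for x
      using Ck_on_SucD[OF Suc.prems that] bounded_linear.has_derivative[OF assms(2)] by blast
  qed (use Suc assms in auto)
qed

lemma Ck_on_id: "open S \<Longrightarrow> Ck_on k S (\<lambda>x. x)"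
proof (cases k)
  case (Suc j)
  assume "open S"
  then show ?thesis
    unfolding Suc by (intro Ck_on_SucI[where f' = "\<lambda>x v. v"] Ck_on_const) auto
qed simp

lemma Ck_on_add:
  assumes "open S"
  shows "Ck_on k S f \<Longrightarrow> Ck_on k S g \<Longrightarrow> Ck_on k S (\<lambda>x. f x + g x)"
proof (induction k arbitrary: f g)
  case 0
  then show ?case by (auto intro: continuous_intros)
next
  case (Suc k)
  show ?case
  proof (rule Ck_on_SucI[where
        f' = "\<lambda>x v. frechet_derivative f (at x) v + frechet_derivative g (at x) v"])
    show "((\<lambda>x. f x + g x) has_derivative
        (\<lambda>v. frechet_derivative f (at x) v + frechet_derivative g (at x) v)) (at x)"
      if "x \<in> S" for x
      using Ck_on_SucD[OF Suc.prems(1) that] Ck_on_SucD[OF Suc.prems(2) that]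
      by (rule has_derivative_add)
  qed (use Suc assms in auto)
qed

text \<open>The product rule yields two terms of the same shape \<open>B _ _\<close>, so the
  induction closes; products of reals and scalar multiples are both instances.\<close>

lemma Ck_on_bounded_bilinear:
  assumes "open S" "bounded_bilinear B"
  shows "Ck_on k S f \<Longrightarrow> Ck_on k S g \<Longrightarrow> Ck_on k S (\<lambda>x. B (f x) (g x))"
proof (induction k arbitrary: f g)
  case 0
  then show ?case
    using bounded_bilinear.continuous_on[OF assms(2)] by simp
next
  case (Suc k)
  show ?case
  proof (rule Ck_on_SucI[where
        f' = "\<lambda>x v. B (f x) (frechet_derivative g (at x) v) + B (frechet_derivative f (at x) v) (g x)"])
    show "((\<lambda>x. B (f x) (g x)) has_derivative
        (\<lambda>v. B (f x) (frechet_derivative g (at x) v) + B (frechet_derivative f (at x) v) (g x))) (at x)"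
      if "x \<in> S" for x
      using bounded_bilinear.FDERIV[OF assms(2) Ck_on_SucD[OF Suc.prems(1) that]
          Ck_on_SucD[OF Suc.prems(2) that]] .
    show "Ck_on k S (\<lambda>x. B (f x) (frechet_derivative g (at x) v)
        + B (frechet_derivative f (at x) v) (g x))" for v
      using Suc.prems Ck_on_Suc_imp[OF Suc.prems(1)] Ck_on_Suc_imp[OF Suc.prems(2)]
      by (intro Ck_on_add[OF assms(1)] Suc.IH) auto
  qed fact
qed

lemma Ck_on_sum:
  assumes "open S"
  shows "(\<And>i. i \<in> I \<Longrightarrow> Ck_on k S (f i)) \<Longrightarrow> Ck_on k S (\<lambda>x. \<Sum>i\<in>I. f i x)"
  by (induction I rule: infinite_finite_induct) (auto intro: assms Ck_on_const Ck_on_add)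

lemma frechet_derivative_Basis:
  fixes g :: "'b::euclidean_space \<Rightarrow> 'c::real_normed_vector"
  assumes "g differentiable (at y)"
  shows "frechet_derivative g (at y) w = (\<Sum>b\<in>Basis. (w \<bullet> b) *\<^sub>R frechet_derivative g (at y) b)"
proof -
  have "frechet_derivative g (at y) (\<Sum>b\<in>Basis. (w \<bullet> b) *\<^sub>R b) =
      (\<Sum>b\<in>Basis. (w \<bullet> b) *\<^sub>R frechet_derivative g (at y) b)"
    using linear_frechet_derivative[OF assms] by (simp add: linear_sum linear_scale)
  then show ?thesis by (simp add: euclidean_representation)
qed

text \<open>Once the inner derivative is expanded in a basis, the chain rule becomes a finite sum of
  products of a component of the derivative of \<open>f\<close> and a partial derivative of
  \<open>g\<close> composed with \<open>f\<close>. The latter falls under the induction hypothesis,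
  which is therefore kept general in \<open>g\<close>.\<close>

lemma Ck_on_compose:
  fixes f :: "'a::real_normed_vector \<Rightarrow> 'b::euclidean_space"
    and g :: "'b \<Rightarrow> 'c::real_normed_vector"
  assumes "open S" "open T" "f ` S \<subseteq> T"
  shows "Ck_on k S f \<Longrightarrow> Ck_on k T g \<Longrightarrow> Ck_on k S (\<lambda>x. g (f x))"
proof (induction k arbitrary: g)
  case 0
  then show ?case using continuous_on_compose2[of T g S f] assms(3) by simp
next
  case (Suc k)
  have fx: "f x \<in> T" if "x \<in> S" for x using that assms(3) by blast
  show ?case
  proof (rule Ck_on_SucI[where f' = "\<lambda>x v. \<Sum>b\<in>Basis.
        (frechet_derivative f (at x) v \<bullet> b) *\<^sub>R frechet_derivative g (at (f x)) b"])
    fix x assume x: "x \<in> S"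
    have "((\<lambda>x. g (f x)) has_derivative
        (\<lambda>v. frechet_derivative g (at (f x)) (frechet_derivative f (at x) v))) (at x)"
      using has_derivative_compose[OF Ck_on_SucD[OF Suc.prems(1) x]
          Ck_on_SucD[OF Suc.prems(2) fx[OF x]]] .
    moreover have "g differentiable (at (f x))"
      using Suc.prems(2) fx[OF x] by simp
    ultimately show "((\<lambda>x. g (f x)) has_derivative (\<lambda>v. \<Sum>b\<in>Basis.
        (frechet_derivative f (at x) v \<bullet> b) *\<^sub>R frechet_derivative g (at (f x)) b)) (at x)"
      by (subst frechet_derivative_Basis[symmetric])
  next
    fix v
    have "Ck_on k S (\<lambda>x. frechet_derivative f (at x) v \<bullet> b)" for b
      using Suc.prems(1) by (intro Ck_on_bounded_linear[OF assms(1) bounded_linear_inner_left]) simp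
    moreover have "Ck_on k S (\<lambda>x. frechet_derivative g (at (f x)) b)" for b
      using Suc.IH[of "\<lambda>y. frechet_derivative g (at y) b"] Suc.prems(2)
        Ck_on_Suc_imp[OF Suc.prems(1)] by simp
    ultimately show "Ck_on k S (\<lambda>x. \<Sum>b\<in>Basis. (frechet_derivative f (at x) v \<bullet> b) *\<^sub>R
        frechet_derivative g (at (f x)) b)"
      by (intro Ck_on_sum Ck_on_bounded_bilinear[OF assms(1) bounded_bilinear_scaleR] assms(1))
  qed fact
qed

text \<open>The derivative is a product of \<open>inverse (f x)\<close>, twice, and the derivative
  of \<open>f\<close>, so the induction can run with \<open>f\<close> fixed.\<close>

lemma Ck_on_inverse:
  fixes f :: "'a::real_normed_vector \<Rightarrow> real"
  assumes "open S" "\<And>x. x \<in> S \<Longrightarrow> f x \<noteq> 0"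
  shows "Ck_on k S f \<Longrightarrow> Ck_on k S (\<lambda>x. inverse (f x))"
proof (induction k)
  case 0
  then show ?case using assms by (auto intro: continuous_intros)
next
  case (Suc k)
  show ?case
  proof (rule Ck_on_SucI[where
        f' = "\<lambda>x v. - (inverse (f x) * frechet_derivative f (at x) v * inverse (f x))"])
    show "((\<lambda>x. inverse (f x)) has_derivative
        (\<lambda>v. - (inverse (f x) * frechet_derivative f (at x) v * inverse (f x)))) (at x)"
      if "x \<in> S" for x
      using Deriv.has_derivative_inverse[OF assms(2)[OF that] Ck_on_SucD[OF Suc.prems that]] .
    show "Ck_on k S (\<lambda>x. - (inverse (f x) * frechet_derivative f (at x) v * inverse (f x)))" for v
      using Suc Ck_on_Suc_imp[OF Suc.prems] assms(1)
      by (intro Ck_on_bounded_linear[OF _ bounded_linear_minus[OF bounded_linear_ident]]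
          Ck_on_bounded_bilinear[OF _ bounded_bilinear_mult]) auto
  qed fact
qed

text \<open>The derivative of each function involves the other, so one induction has to carry
  both.\<close>

lemma Ck_on_sin_cos:
  fixes f :: "'a::real_normed_vector \<Rightarrow> real"
  assumes "open S"
  shows "Ck_on k S f \<Longrightarrow> Ck_on k S (\<lambda>x. sin (f x)) \<and> Ck_on k S (\<lambda>x. cos (f x))"
proof (induction k)
  case 0
  then show ?case by (auto intro: continuous_intros)
next
  case (Suc k)
  note * = Ck_on_bounded_linear[OF assms bounded_linear_minus[OF bounded_linear_ident]]
    Ck_on_bounded_bilinear[OF assms bounded_bilinear_mult]
  note IH = Suc.IH[OF Ck_on_Suc_imp[OF Suc.prems]]
  have "Ck_on (Suc k) S (\<lambda>x. sin (f x))"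
  proof (rule Ck_on_SucI[where f' = "\<lambda>x v. cos (f x) * frechet_derivative f (at x) v"])
    show "((\<lambda>x. sin (f x)) has_derivative (\<lambda>v. cos (f x) * frechet_derivative f (at x) v)) (at x)"
      if "x \<in> S" for x
      using Ck_on_SucD[OF Suc.prems that]
      by (auto intro!: derivative_eq_intros simp: mult.commute)
  qed (use IH Suc.prems assms in \<open>auto intro!: *\<close>)
  moreover have "Ck_on (Suc k) S (\<lambda>x. cos (f x))"
  proof (rule Ck_on_SucI[where f' = "\<lambda>x v. - (sin (f x) * frechet_derivative f (at x) v)"])
    show "((\<lambda>x. cos (f x)) has_derivative (\<lambda>v. - (sin (f x) * frechet_derivative f (at x) v))) (at x)"
      if "x \<in> S" for x
      using Ck_on_SucD[OF Suc.prems that]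
      by (auto intro!: derivative_eq_intros simp: mult.commute)
  qed (use IH Suc.prems assms in \<open>auto intro!: *\<close>)
  ultimately show ?case ..
qed

lemma smooth_on_cong:
  assumes "open S" "\<And>y. y \<in> S \<Longrightarrow> f y = g y" "smooth_on S f"
  shows "smooth_on S g"
  using assms Ck_on_cong unfolding smooth_on_def by blast

lemma smooth_on_has_derivative:
  assumes "smooth_on S f" "x \<in> S"
  shows "(f has_derivative frechet_derivative f (at x)) (at x)"
  using assms Ck_on_SucD unfolding smooth_on_def by blast

lemma smooth_on_imp_differentiable: "smooth_on S f \<Longrightarrow> x \<in> S \<Longrightarrow> f differentiable (at x)"
  using smooth_on_has_derivative by (auto simp: differentiable_def)

lemma smooth_on_imp_continuous_on: "smooth_on S f \<Longrightarrow> continuous_on S f"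
  using Ck_on.simps(1) unfolding smooth_on_def by blast

lemma smooth_on_frechet_derivative:
  "smooth_on S f \<Longrightarrow> smooth_on S (\<lambda>x. frechet_derivative f (at x) v)"
  unfolding smooth_on_def using Ck_on.simps(2) by blast

lemma smooth_on_const: "open S \<Longrightarrow> smooth_on S (\<lambda>x. c)"
  by (simp add: smooth_on_def Ck_on_const)

lemma smooth_on_id: "open S \<Longrightarrow> smooth_on S (\<lambda>x. x)"
  by (simp add: smooth_on_def Ck_on_id)

lemma smooth_on_bounded_linear:
  "open S \<Longrightarrow> bounded_linear L \<Longrightarrow> smooth_on S f \<Longrightarrow> smooth_on S (\<lambda>x. L (f x))"
  by (simp add: smooth_on_def Ck_on_bounded_linear)

lemma smooth_on_linear: "open S \<Longrightarrow> bounded_linear L \<Longrightarrow> smooth_on S L"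
  using smooth_on_bounded_linear[OF _ _ smooth_on_id] by blast

lemma smooth_on_add:
  "open S \<Longrightarrow> smooth_on S f \<Longrightarrow> smooth_on S g \<Longrightarrow> smooth_on S (\<lambda>x. f x + g x)"
  by (simp add: smooth_on_def Ck_on_add)

lemma smooth_on_minus: "open S \<Longrightarrow> smooth_on S f \<Longrightarrow> smooth_on S (\<lambda>x. - f x)"
  by (rule smooth_on_bounded_linear[OF _ bounded_linear_minus[OF bounded_linear_ident]])

lemma smooth_on_diff:
  "open S \<Longrightarrow> smooth_on S f \<Longrightarrow> smooth_on S g \<Longrightarrow> smooth_on S (\<lambda>x. f x - g x)"
  using smooth_on_add[OF _ _ smooth_on_minus, of S f g] by simp

lemma smooth_on_mult:
  fixes f g :: "'a::real_normed_vector \<Rightarrow> real"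
  shows "open S \<Longrightarrow> smooth_on S f \<Longrightarrow> smooth_on S g \<Longrightarrow> smooth_on S (\<lambda>x. f x * g x)"
  by (simp add: smooth_on_def Ck_on_bounded_bilinear[OF _ bounded_bilinear_mult])

lemma smooth_on_divide:
  fixes f g :: "'a::real_normed_vector \<Rightarrow> real"
  assumes "open S" "smooth_on S f" "smooth_on S g" "\<And>x. x \<in> S \<Longrightarrow> g x \<noteq> 0"
  shows "smooth_on S (\<lambda>x. f x / g x)"
proof -
  have "smooth_on S (\<lambda>x. inverse (g x))"
    using assms Ck_on_inverse unfolding smooth_on_def by blast
  then show ?thesis
    unfolding divide_inverse using assms by (intro smooth_on_mult)
qed

lemma smooth_on_sin:
  fixes f :: "'a::real_normed_vector \<Rightarrow> real"
  shows "open S \<Longrightarrow> smooth_on S f \<Longrightarrow> smooth_on S (\<lambda>x. sin (f x))"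
  by (simp add: smooth_on_def Ck_on_sin_cos)

lemma smooth_on_cos:
  fixes f :: "'a::real_normed_vector \<Rightarrow> real"
  shows "open S \<Longrightarrow> smooth_on S f \<Longrightarrow> smooth_on S (\<lambda>x. cos (f x))"
  by (simp add: smooth_on_def Ck_on_sin_cos)

lemma smooth_on_compose:
  fixes f :: "'a::real_normed_vector \<Rightarrow> 'b::euclidean_space"
  assumes "open S" "open T" "f ` S \<subseteq> T" "smooth_on S f" "smooth_on T g"
  shows "smooth_on S (\<lambda>x. g (f x))"
  using assms(4,5) by (simp add: smooth_on_def Ck_on_compose[OF assms(1-3)])

lemma smooth_on_Pair:
  assumes "open S" "smooth_on S f" "smooth_on S g"
  shows "smooth_on S (\<lambda>x. (f x, g x))"
proof -
  have "smooth_on S (\<lambda>x. (f x, 0) + (0, g x))"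
    using assms by (intro smooth_on_add smooth_on_bounded_linear[of S "\<lambda>a. (a, 0)" f]
        smooth_on_bounded_linear[of S "\<lambda>a. (0, a)" g] bounded_linear_Pair
        bounded_linear_ident bounded_linear_zero)
  then show ?thesis by simp
qed

lemma smooth_on_fst: "open S \<Longrightarrow> smooth_on S f \<Longrightarrow> smooth_on S (\<lambda>x. fst (f x))"
  by (rule smooth_on_bounded_linear[OF _ bounded_linear_fst])

lemma smooth_on_snd: "open S \<Longrightarrow> smooth_on S f \<Longrightarrow> smooth_on S (\<lambda>x. snd (f x))"
  by (rule smooth_on_bounded_linear[OF _ bounded_linear_snd])

lemmas smooth_intros = smooth_on_const smooth_on_id smooth_on_add smooth_on_diff smooth_on_minus
  smooth_on_mult smooth_on_divide smooth_on_sin smooth_on_cos smooth_on_Pair smooth_on_fst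
  smooth_on_snd smooth_on_frechet_derivative

lemma smooth_onI_derivative:
  assumes "open S"
    and "\<And>x. x \<in> S \<Longrightarrow> (f has_derivative f' x) (at x)"
    and "\<And>v. smooth_on S (\<lambda>x. f' x v)"
  shows "smooth_on S f"
proof -
  have "Ck_on (Suc k) S f" for k
    using assms by (intro Ck_on_SucI) (auto simp: smooth_on_def)
  then show ?thesis
    unfolding smooth_on_def using Ck_on_Suc_imp by blast
qed

section \<open>Symmetry of second derivatives\<close>

lemma has_real_derivative_along_line:
  fixes f :: "'a::real_normed_vector \<Rightarrow> real"
  assumes "f differentiable (at (x + s *\<^sub>R v))"
  shows "((\<lambda>t. f (x + t *\<^sub>R v)) has_real_derivative
    frechet_derivative f (at (x + s *\<^sub>R v)) v) (at s)"
proof -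
  have "((\<lambda>t. x + t *\<^sub>R v) has_derivative (\<lambda>t. t *\<^sub>R v)) (at s)"
    by (auto intro!: derivative_eq_intros)
  from has_derivative_compose[OF this assms[unfolded frechet_derivative_works]]
  have "((\<lambda>t. f (x + t *\<^sub>R v)) has_derivative
      (\<lambda>t. frechet_derivative f (at (x + s *\<^sub>R v)) (t *\<^sub>R v))) (at s)" .
  moreover have "(\<lambda>t. frechet_derivative f (at (x + s *\<^sub>R v)) (t *\<^sub>R v)) =
      (*) (frechet_derivative f (at (x + s *\<^sub>R v)) v)"
    using linear_scale[OF linear_frechet_derivative[OF assms]] by (auto simp: mult.commute)
  ultimately show ?thesis by (simp add: has_field_derivative_def)
qed

text \<open>The double difference quotient in the directions \<open>v\<close>, \<open>w\<close> is a value of the iterated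
  derivative near \<open>x\<close>; it is symmetric in \<open>v\<close> and \<open>w\<close>.\<close>

lemma double_difference:
  fixes f :: "'a::real_normed_vector \<Rightarrow> real"
  assumes S: "smooth_on S f" and h: "h > 0"
    and sub: "\<And>s t. 0 \<le> s \<Longrightarrow> s \<le> h \<Longrightarrow> 0 \<le> t \<Longrightarrow> t \<le> h \<Longrightarrow> x + s *\<^sub>R v + t *\<^sub>R w \<in> S"
  obtains s t where "0 < s" "s < h" "0 < t" "t < h"
    "f (x + h *\<^sub>R v + h *\<^sub>R w) - f (x + h *\<^sub>R v) - f (x + h *\<^sub>R w) + f x =
      h * h * frechet_derivative (\<lambda>y. frechet_derivative f (at y) v) (at (x + s *\<^sub>R v + t *\<^sub>R w)) w"
proof -
  \<comment> \<open>\<open>g\<close> is the increment of \<open>f\<close> by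
    \<open>h *\<^sub>R w\<close>, as a function of the displacement along \<open>v\<close>. The mean
    value theorem for \<open>g\<close> gives \<open>s\<close>; applied to the derivative
    \<open>k\<close> in direction \<open>w\<close>, it gives \<open>t\<close>.\<close>
  define g where "g = (\<lambda>s. f ((x + h *\<^sub>R w) + s *\<^sub>R v) - f (x + s *\<^sub>R v))"
  define g' where "g' = (\<lambda>s. frechet_derivative f (at ((x + h *\<^sub>R w) + s *\<^sub>R v)) v -
      frechet_derivative f (at (x + s *\<^sub>R v)) v)"
  have fd: "f differentiable (at y)" if "y \<in> S" for y
    using smooth_on_imp_differentiable[OF S that] .
  have "\<exists>s. 0 < s \<and> s < h \<and> g h - g 0 = (h - 0) * g' s"
  proof (rule MVT2[OF h])
    fix s assume s: "0 \<le> s" "s \<le> h"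
    have "x + h *\<^sub>R w + s *\<^sub>R v \<in> S" "x + s *\<^sub>R v \<in> S"
      using sub[OF s, of h] sub[OF s, of 0] h by (auto simp: ac_simps)
    then show "(g has_real_derivative g' s) (at s)"
      unfolding g_def g'_def
      by (intro DERIV_diff has_real_derivative_along_line fd)
  qed
  then obtain s where s: "0 < s" "s < h" "g h - g 0 = h * g' s" by auto
  define k where "k = (\<lambda>y. frechet_derivative f (at y) v)"
  have kd: "k differentiable (at y)" if "y \<in> S" for y
    unfolding k_def
    using smooth_on_imp_differentiable[OF smooth_on_frechet_derivative[OF S] that] .
  have "\<exists>t. 0 < t \<and> t < h \<and> k ((x + s *\<^sub>R v) + h *\<^sub>R w) - k ((x + s *\<^sub>R v) + 0 *\<^sub>R w) =
      (h - 0) * frechet_derivative k (at ((x + s *\<^sub>R v) + t *\<^sub>R w)) w"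
  proof (rule MVT2[OF h])
    fix t assume t: "0 \<le> t" "t \<le> h"
    show "((\<lambda>t. k (x + s *\<^sub>R v + t *\<^sub>R w)) has_real_derivative
        frechet_derivative k (at (x + s *\<^sub>R v + t *\<^sub>R w)) w) (at t)"
      using sub[of s t] s t by (intro has_real_derivative_along_line kd) auto
  qed
  then obtain t where t: "0 < t" "t < h" "g' s = h * frechet_derivative k (at ((x + s *\<^sub>R v) + t *\<^sub>R w)) w"
    by (auto simp: g'_def k_def ac_simps)
  show thesis
    using that[OF s(1,2) t(1,2)] s(3) unfolding t(3) g_def k_def by (simp add: algebra_simps)
qed

text \<open>One double difference equals \<open>h * h * a\<close> at one point near \<open>x\<close>
  and \<open>h * h * b\<close> at another, and \<open>a\<close>, \<open>b\<close> are continuous.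
  This symmetry is behind the Cauchy-Riemann equations for second derivatives, the commutators of
  the frame, and the fact that dx/y is not exact.\<close>

lemma mixed_derivatives_commute:
  fixes f :: "'a::real_normed_vector \<Rightarrow> real"
  assumes "open S" "smooth_on S f" "x \<in> S"
  shows "frechet_derivative (\<lambda>y. frechet_derivative f (at y) v) (at x) w =
    frechet_derivative (\<lambda>y. frechet_derivative f (at y) w) (at x) v"
proof -
  define a where "a = (\<lambda>x. frechet_derivative (\<lambda>y. frechet_derivative f (at y) v) (at x) w)"
  define b where "b = (\<lambda>x. frechet_derivative (\<lambda>y. frechet_derivative f (at y) w) (at x) v)"
  have cont: "continuous_on S a" "continuous_on S b"
    unfolding a_def b_def using assms(2)
    by (intro smooth_on_imp_continuous_on smooth_on_frechet_derivative; assumption)+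
  have "\<bar>a x - b x\<bar> \<le> e" if "e > 0" for e
  proof -
    have "isCont a x" "isCont b x"
      using cont assms(1,3) continuous_on_eq_continuous_at by blast+
    then obtain d1 d2 where d: "d1 > 0" "\<And>y. dist y x < d1 \<Longrightarrow> dist (a y) (a x) < e / 2"
      "d2 > 0" "\<And>y. dist y x < d2 \<Longrightarrow> dist (b y) (b x) < e / 2"
      using \<open>e > 0\<close> unfolding continuous_at_eps_delta by (metis half_gt_zero)
    obtain d3 where d3: "d3 > 0" "ball x d3 \<subseteq> S" using assms(1,3) openE by blast
    define d where "d = min d1 (min d2 d3)"
    \<comment> \<open>With this \<open>h\<close> the parallelogram spanned by
      \<open>h *\<^sub>R v\<close> and \<open>h *\<^sub>R w\<close> stays within
      \<open>d / 2\<close> of \<open>x\<close>; the summand 1 keeps the denominator positive when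
      both vectors vanish.\<close>
    define h where "h = d / (2 * (norm v + norm w + 1))"
    have "d > 0" using d d3 by (auto simp: d_def)
    have "norm v + norm w + 1 > 0" by (simp add: add_nonneg_pos)
    then have h: "h > 0" "h * (norm v + norm w + 1) = d / 2"
      using \<open>d > 0\<close> by (auto simp: h_def divide_simps)
    have near: "dist (x + s *\<^sub>R v + t *\<^sub>R w) x < d" if "0 \<le> s" "s \<le> h" "0 \<le> t" "t \<le> h" for s t
    proof -
      have "dist (x + s *\<^sub>R v + t *\<^sub>R w) x = norm (s *\<^sub>R v + t *\<^sub>R w)"
        by (simp add: dist_norm)
      also have "\<dots> \<le> norm (s *\<^sub>R v) + norm (t *\<^sub>R w)" by (rule norm_triangle_ineq)
      also have "\<dots> \<le> h * norm v + h * norm w"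
        using that by (auto intro!: add_mono mult_right_mono)
      also have "\<dots> \<le> h * (norm v + norm w + 1)"
        using h(1) by (simp add: algebra_simps)
      also have "\<dots> < d" using h \<open>d > 0\<close> by simp
      finally show ?thesis .
    qed
    have inS: "x + s *\<^sub>R v + t *\<^sub>R w \<in> S" if "0 \<le> s" "s \<le> h" "0 \<le> t" "t \<le> h" for s t
      using near[OF that] d3(2) by (auto simp: d_def dist_commute)
    have inS': "x + t *\<^sub>R w + s *\<^sub>R v \<in> S" if "0 \<le> t" "t \<le> h" "0 \<le> s" "s \<le> h" for s t
      using inS[of s t] that by (simp add: ac_simps)
    obtain s t where st: "0 < s" "s < h" "0 < t" "t < h"
      "f (x + h *\<^sub>R v + h *\<^sub>R w) - f (x + h *\<^sub>R v) - f (x + h *\<^sub>R w) + f x =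
        h * h * a (x + s *\<^sub>R v + t *\<^sub>R w)"
      using double_difference[OF assms(2) h(1) inS] unfolding a_def by blast
    obtain t' s' where st': "0 < t'" "t' < h" "0 < s'" "s' < h"
      "f (x + h *\<^sub>R w + h *\<^sub>R v) - f (x + h *\<^sub>R w) - f (x + h *\<^sub>R v) + f x =
        h * h * b (x + t' *\<^sub>R w + s' *\<^sub>R v)"
      using double_difference[OF assms(2) h(1) inS'] unfolding b_def by blast
    have "h * h * a (x + s *\<^sub>R v + t *\<^sub>R w) = h * h * b (x + t' *\<^sub>R w + s' *\<^sub>R v)"
      unfolding st(5)[symmetric] st'(5)[symmetric] by (simp add: ac_simps)
    then have eq: "a (x + s *\<^sub>R v + t *\<^sub>R w) = b (x + s' *\<^sub>R v + t' *\<^sub>R w)"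
      using h(1) by (simp add: ac_simps)
    have "dist (a (x + s *\<^sub>R v + t *\<^sub>R w)) (a x) < e / 2"
      using near[of s t] st by (intro d) (auto simp: d_def)
    moreover have "dist (b (x + s' *\<^sub>R v + t' *\<^sub>R w)) (b x) < e / 2"
      using near[of s' t'] st' by (intro d) (auto simp: d_def)
    ultimately show ?thesis unfolding eq dist_real_def by linarith
  qed
  then have "\<bar>a x - b x\<bar> \<le> 0" using field_le_epsilon[of "\<bar>a x - b x\<bar>" 0] by auto
  then show ?thesis by (simp add: a_def b_def)
qed


section \<open>The group of Riemannian isometries\<close>

text \<open>Smoothness of \<open>inv_into S f\<close> is checked on an explicit left inverse
  \<open>f'\<close>; as \<open>f\<close> is onto \<open>S\<close>, the two agree there.\<close>

lemma riemannian_isometryI: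
  assumes "open S" "bij_betw f S S" "smooth_on S f" "smooth_on S f'"
    and "\<And>p. p \<in> S \<Longrightarrow> f' (f p) = p"
    and "\<And>p v. p \<in> S \<Longrightarrow> g (f p) (frechet_derivative f (at p) v) = g p v"
  shows "riemannian_isometry S g f"
proof -
  have "f' q = inv_into S f q" if "q \<in> S" for q
    using assms(5) bij_betw_inv_into_right[OF assms(2) that]
      bij_betw_imp_surj_on[OF assms(2)] that by (metis inv_into_into)
  then show ?thesis
    using assms smooth_on_cong[OF \<open>open S\<close> _ assms(4), of "inv_into S f"]
    by (simp add: riemannian_isometry_def)
qed

lemma riemannian_isometryD:
  assumes "riemannian_isometry S g f"
  shows "bij_betw f S S" "smooth_on S f" "smooth_on S (inv_into S f)" "f ` S \<subseteq> S"
    and "p \<in> S \<Longrightarrow> f p \<in> S"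
    and "p \<in> S \<Longrightarrow> g (f p) (frechet_derivative f (at p) v) = g p v"
  using assms bij_betwE[of f S S] unfolding riemannian_isometry_def by blast+

text \<open>For passing between a map and its restriction to \<open>S\<close>: products and inverses
  in \<open>BijGroup S\<close> are restricted functions.\<close>

lemma riemannian_isometry_cong:
  assumes "open S" "\<And>p. p \<in> S \<Longrightarrow> f p = h p" "riemannian_isometry S g f"
  shows "riemannian_isometry S g h"
proof (rule riemannian_isometryI[where f' = "inv_into S f"])
  have f: "bij_betw f S S" "smooth_on S f" "smooth_on S (inv_into S f)"
    "\<And>p v. p \<in> S \<Longrightarrow> g (f p) (frechet_derivative f (at p) v) = g p v"
    using riemannian_isometryD[OF assms(3)] by blast+
  show "bij_betw h S S" using f(1) assms(2) bij_betw_cong by metis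
  show "smooth_on S h" using smooth_on_cong[OF assms(1,2) f(2)] .
  show "smooth_on S (inv_into S f)" by fact
  show "inv_into S f (h p) = p" if "p \<in> S" for p
    using bij_betw_inv_into_left[OF f(1) that] assms(2)[OF that] by simp
  show "g (h p) (frechet_derivative h (at p) v) = g p v" if p: "p \<in> S" for p v
    using f(4)[OF p] assms(2)[OF p]
      differentiable_eq_on_open(2)[OF assms(1) p assms(2) smooth_on_imp_differentiable[OF f(2) p]]
    by simp
qed fact

lemma frechet_derivative_compose_smooth:
  assumes "smooth_on S f" "smooth_on T g" "p \<in> S" "f p \<in> T"
  shows "frechet_derivative (\<lambda>x. g (f x)) (at p) v =
    frechet_derivative g (at (f p)) (frechet_derivative f (at p) v)"
  using frechet_derivative_eq[OF has_derivative_compose[OF smooth_on_has_derivative[OF assms(1,3)]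
      smooth_on_has_derivative[OF assms(2,4)]]] by simp

lemma frechet_derivative_left_inverse:
  assumes "open S" "smooth_on S f" "smooth_on T f'" "f ` S \<subseteq> T" "\<And>p. p \<in> S \<Longrightarrow> f' (f p) = p" "p \<in> S"
  shows "frechet_derivative f' (at (f p)) (frechet_derivative f (at p) v) = v"
proof -
  have "frechet_derivative f' (at (f p)) (frechet_derivative f (at p) v) =
      frechet_derivative (\<lambda>x. f' (f x)) (at p) v"
    using frechet_derivative_compose_smooth[OF assms(2,3,6)] assms(4,6) by auto
  also have "frechet_derivative (\<lambda>x. f' (f x)) (at p) = frechet_derivative (\<lambda>x. x) (at p)"
    using assms(5,6) by (intro differentiable_eq_on_open(2)[OF assms(1)]) auto
  finally show ?thesis by simp
qed

lemma riemannian_isometry_compose: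
  fixes S :: "'a::euclidean_space set"
  assumes "open S" "riemannian_isometry S g f" "riemannian_isometry S g h"
  shows "riemannian_isometry S g (\<lambda>x. h (f x))"
proof (rule riemannian_isometryI[where f' = "\<lambda>x. inv_into S f (inv_into S h x)"])
  have f: "bij_betw f S S" "smooth_on S f" "smooth_on S (inv_into S f)"
    "\<And>p v. p \<in> S \<Longrightarrow> g (f p) (frechet_derivative f (at p) v) = g p v"
    using riemannian_isometryD[OF assms(2)] by blast+
  have h: "bij_betw h S S" "smooth_on S h" "smooth_on S (inv_into S h)"
    "\<And>p v. p \<in> S \<Longrightarrow> g (h p) (frechet_derivative h (at p) v) = g p v"
    using riemannian_isometryD[OF assms(3)] by blast+
  have S: "f ` S \<subseteq> S" "inv_into S h ` S \<subseteq> S"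
    by (rule equalityD1[OF bij_betw_imp_surj_on[OF f(1)]],
        rule equalityD1[OF bij_betw_imp_surj_on[OF bij_betw_inv_into[OF h(1)]]])
  show "bij_betw (\<lambda>x. h (f x)) S S"
    using bij_betw_trans[OF f(1) h(1)] by (simp add: comp_def)
  show "smooth_on S (\<lambda>x. h (f x))" "smooth_on S (\<lambda>x. inv_into S f (inv_into S h x))"
    by (rule smooth_on_compose[OF assms(1,1) S(1) f(2) h(2)],
        rule smooth_on_compose[OF assms(1,1) S(2) h(3) f(3)])
  show "inv_into S f (inv_into S h (h (f p))) = p" if "p \<in> S" for p
    using that S(1) by (simp add: bij_betw_inv_into_left[OF f(1)] bij_betw_inv_into_left[OF h(1)] image_subset_iff)
  show "g (h (f p)) (frechet_derivative (\<lambda>x. h (f x)) (at p) v) = g p v" if p: "p \<in> S" for p v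
  proof -
    have "f p \<in> S" using S p by auto
    then show ?thesis
      using frechet_derivative_compose_smooth[OF f(2) h(2) p] f(4)[OF p] h(4) by simp
  qed
qed fact

lemma riemannian_isometry_inverse:
  assumes "open S" "riemannian_isometry S g f"
  shows "riemannian_isometry S g (inv_into S f)"
proof (rule riemannian_isometryI[where f' = f])
  have f: "bij_betw f S S" "smooth_on S f" "smooth_on S (inv_into S f)"
    "\<And>p v. p \<in> S \<Longrightarrow> g (f p) (frechet_derivative f (at p) v) = g p v"
    using riemannian_isometryD[OF assms(2)] by blast+
  have S: "inv_into S f ` S \<subseteq> S"
    using bij_betw_imp_surj_on[OF bij_betw_inv_into[OF f(1)]] by (rule equalityD1)
  show "bij_betw (inv_into S f) S S" using bij_betw_inv_into[OF f(1)] .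
  show "smooth_on S (inv_into S f)" "smooth_on S f" by fact+
  show inv: "f (inv_into S f p) = p" if "p \<in> S" for p
    using bij_betw_inv_into_right[OF f(1) that] .
  show "g (inv_into S f p) (frechet_derivative (inv_into S f) (at p) v) = g p v" if p: "p \<in> S" for p v
  proof -
    have "inv_into S f p \<in> S" using S p by auto
    from f(4)[OF this, of "frechet_derivative (inv_into S f) (at p) v"]
    show ?thesis
      using frechet_derivative_left_inverse[OF assms(1) f(3,2) S inv p] inv[OF p] by simp
  qed
qed fact

lemma riemannian_isometry_ident:
  assumes "open S"
  shows "riemannian_isometry S g (\<lambda>x. x)"
  using assms by (intro riemannian_isometryI[where f' = "\<lambda>x. x"] smooth_on_id)
    (auto simp: bij_betw_def)

lemma subgroup_riemannian_isometries:
  fixes S :: "'a::euclidean_space set"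
  assumes "open S"
  shows "subgroup {f \<in> Bij S. riemannian_isometry S g f} (BijGroup S)"
proof (rule group.subgroupI[OF group_BijGroup])
  show "{f \<in> Bij S. riemannian_isometry S g f} \<subseteq> carrier (BijGroup S)"
    by (auto simp: BijGroup_def)
  have "riemannian_isometry S g (\<lambda>x\<in>S. x)"
    using riemannian_isometry_cong[OF assms _ riemannian_isometry_ident[OF assms]] by simp
  then show "{f \<in> Bij S. riemannian_isometry S g f} \<noteq> {}" using id_Bij by blast
next
  fix f assume f: "f \<in> {f \<in> Bij S. riemannian_isometry S g f}"
  then have "riemannian_isometry S g (restrict (inv_into S f) S)"
    by - (rule riemannian_isometry_cong[OF assms _ riemannian_isometry_inverse[OF assms, of g f]],
        simp_all)
  then show "inv\<^bsub>BijGroup S\<^esub> f \<in> {f \<in> Bij S. riemannian_isometry S g f}"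
    using f restrict_inv_into_Bij[of f S] by (simp add: inv_BijGroup)
next
  fix f h assume "f \<in> {f \<in> Bij S. riemannian_isometry S g f}"
    "h \<in> {f \<in> Bij S. riemannian_isometry S g f}"
  moreover from this have "riemannian_isometry S g (compose S f h)"
    by - (rule riemannian_isometry_cong[OF assms _ riemannian_isometry_compose[OF assms, of g h f]],
        simp_all add: compose_def)
  ultimately show "f \<otimes>\<^bsub>BijGroup S\<^esub> h \<in> {f \<in> Bij S. riemannian_isometry S g f}"
    by (simp add: BijGroup_def compose_Bij)
qed

lemma carrier_psl_isometry_group:
  "carrier psl_isometry_group = {F \<in> Bij psl_space. riemannian_isometry psl_space psl_metric F}"
  by (simp add: psl_isometry_group_def)

section \<open>Vertical translations and lifts\<close>

lemma mem_psl_space: "(x, y, z) \<in> psl_space \<longleftrightarrow> y > 0"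
  by (simp add: psl_space_eq)

lemma psl_spaceE:
  assumes "P \<in> psl_space"
  obtains x y z where "P = (x, y, z)" "y > 0"
  using assms by (cases P) (auto simp: mem_psl_space)

lemma mem_hyp_plane: "(x, y) \<in> hyp_plane \<longleftrightarrow> y > 0"
  by (simp add: hyp_plane_def)

lemma hyp_plane_eq: "hyp_plane = UNIV \<times> {0<..}"
  by (auto simp: hyp_plane_def)

lemma open_hyp_plane: "open hyp_plane"
  unfolding hyp_plane_eq by (intro open_Times) auto

lemma connected_hyp_plane: "connected hyp_plane"
  unfolding hyp_plane_eq by (intro convex_connected convex_Times) auto

lemma convex_psl_space: "convex psl_space"
  unfolding psl_space_eq by (intro convex_Times) auto

lemma hyp_metric_eq: "hyp_metric (x, y) (a, b) = (a\<^sup>2 + b\<^sup>2) / y\<^sup>2"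
  by (simp add: hyp_metric_def lam_def power_divide)

lemma vertical_translation_apply:
  "P \<in> psl_space \<Longrightarrow> vertical_translation a P = (fst P, fst (snd P), snd (snd P) + a)"
  by (auto simp: vertical_translation_def case_prod_unfold)

lemma vertical_translation_in_psl_space:
  "P \<in> psl_space \<Longrightarrow> vertical_translation a P \<in> psl_space"
  by (auto simp: vertical_translation_apply psl_space_eq)

lemma smooth_on_vertical_translation: "smooth_on psl_space (vertical_translation a)"
proof (rule smooth_on_cong[OF open_psl_space])
  show "smooth_on psl_space (\<lambda>P. (fst P, fst (snd P), snd (snd P) + a))"
    by (intro smooth_intros open_psl_space)
qed (simp add: vertical_translation_apply)

lemma vertical_translation_cancel:
  "P \<in> psl_space \<Longrightarrow> vertical_translation (- a) (vertical_translation a P) = P"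
  "P \<in> psl_space \<Longrightarrow> vertical_translation a (vertical_translation (- a) P) = P"
  by (cases P; simp add: vertical_translation_def mem_psl_space)+

lemma bij_betw_vertical_translation: "bij_betw (vertical_translation a) psl_space psl_space"
  by (rule bij_betwI[where g = "vertical_translation (- a)"])
    (simp_all add: Pi_I vertical_translation_cancel vertical_translation_in_psl_space)

lemma vertical_translations_subset: "vertical_translations \<subseteq> carrier psl_isometry_group"
proof
  fix F assume "F \<in> vertical_translations"
  then obtain a where F: "F = vertical_translation a" by (auto simp: vertical_translations_def)
  have "riemannian_isometry psl_space psl_metric F" unfolding F
  proof (rule riemannian_isometryI[where f' = "vertical_translation (- a)"])
    fix P V assume P: "P \<in> psl_space"
    have "((\<lambda>P. (fst P, fst (snd P), snd (snd P) + a)) has_derivative (\<lambda>V. V)) (at P)"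
      by (auto intro!: derivative_eq_intros)
    then have "(vertical_translation a has_derivative (\<lambda>V. V)) (at P)"
      by (rule has_derivative_transform_within_open[OF _ open_psl_space P])
        (simp add: vertical_translation_apply)
    then have "frechet_derivative (vertical_translation a) (at P) V = V"
      by (simp add: frechet_derivative_eq)
    then show "psl_metric (vertical_translation a P)
        (frechet_derivative (vertical_translation a) (at P) V) = psl_metric P V"
      using P by (simp add: vertical_translation_apply psl_metric_def case_prod_unfold)
  qed (simp_all add: open_psl_space bij_betw_vertical_translation smooth_on_vertical_translation
      vertical_translation_cancel)
  moreover have "F \<in> Bij psl_space"
    using bij_betw_vertical_translation by (simp add: F Bij_def vertical_translation_def)
  ultimately show "F \<in> carrier psl_isometry_group" by (simp add: carrier_psl_isometry_group)
qed

lemma tangent_map_in_unit_tangent_bundle: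
  assumes "hyp_isometry f" "q \<in> unit_tangent_bundle"
  shows "tangent_map f q \<in> unit_tangent_bundle"
proof -
  obtain p v where q: "q = (p, v)" "p \<in> hyp_plane" "hyp_metric p v = 1"
    using assms(2) by (auto simp: unit_tangent_bundle_def)
  have "f p \<in> hyp_plane" "hyp_metric (f p) (frechet_derivative f (at p) v) = 1"
    using riemannian_isometryD[OF assms(1)[unfolded hyp_isometry_def]] q by simp_all
  then show ?thesis by (simp add: q(1) tangent_map_def unit_tangent_bundle_def)
qed

lemma psl_proj_in_unit_tangent_bundle: "P \<in> psl_space \<Longrightarrow> psl_proj P \<in> unit_tangent_bundle"
  using psl_proj_image by blast

text \<open>Smoothness of \<open>f\<close> gives continuity of the derivative for each fixed vector.
  Joint continuity in point and vector comes from expanding the vector in the standard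
  basis.\<close>

lemma continuous_on_tangent_map:
  assumes "smooth_on hyp_plane f"
  shows "continuous_on (hyp_plane \<times> UNIV) (tangent_map f)"
proof -
  have D: "frechet_derivative f (at p) v =
      fst v *\<^sub>R frechet_derivative f (at p) (1, 0) + snd v *\<^sub>R frechet_derivative f (at p) (0, 1)"
    if "p \<in> hyp_plane" for p v
    using frechet_derivative_Basis[OF smooth_on_imp_differentiable[OF assms that], of v]
    by (simp add: Basis_prod_def sum.union_disjoint inner_prod_def)
  have c: "continuous_on (hyp_plane \<times> UNIV) (\<lambda>q. h (fst q))" if "smooth_on hyp_plane h"
    for h :: "real \<times> real \<Rightarrow> real \<times> real"
    by (rule continuous_on_compose2[OF smooth_on_imp_continuous_on[OF that]])
      (auto intro: continuous_intros)
  have "continuous_on (hyp_plane \<times> UNIV) (\<lambda>q. (f (fst q),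
      fst (snd q) *\<^sub>R frechet_derivative f (at (fst q)) (1, 0) +
      snd (snd q) *\<^sub>R frechet_derivative f (at (fst q)) (0, 1)))"
    using assms by (intro continuous_intros c[of f]
        c[of "\<lambda>p. frechet_derivative f (at p) (1, 0)"]
        c[of "\<lambda>p. frechet_derivative f (at p) (0, 1)"] smooth_on_frechet_derivative)
  then show ?thesis
  proof (rule continuous_on_eq)
    fix q :: "(real \<times> real) \<times> (real \<times> real)"
    assume "q \<in> hyp_plane \<times> UNIV"
    then show "(f (fst q), fst (snd q) *\<^sub>R frechet_derivative f (at (fst q)) (1, 0) +
        snd (snd q) *\<^sub>R frechet_derivative f (at (fst q)) (0, 1)) = tangent_map f q"
      using D[of "fst q" "snd q"] by (auto simp: tangent_map_def case_prod_unfold)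
  qed
qed

text \<open>The lifting criterion applies because \<open>psl_space\<close> is simply connected and
  locally path connected; the final \<open>restrict\<close> provides extensionality.\<close>

lemma lift_of_exists:
  assumes "hyp_isometry f"
  obtains F where "lift_of f F"
proof -
  have f: "smooth_on hyp_plane f" using assms by (simp add: hyp_isometry_def riemannian_isometry_def)
  have sub: "psl_proj ` psl_space \<subseteq> hyp_plane \<times> UNIV"
    unfolding psl_proj_image unit_tangent_bundle_def by auto
  have "continuous_on psl_space (\<lambda>P. tangent_map f (psl_proj P))"
    using continuous_on_compose2[OF continuous_on_tangent_map[OF f] continuous_on_psl_proj sub] .
  moreover have "(\<lambda>P. tangent_map f (psl_proj P)) \<in> psl_space \<rightarrow> unit_tangent_bundle"
    using tangent_map_in_unit_tangent_bundle[OF assms] psl_proj_in_unit_tangent_bundle by auto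
  moreover have "locally path_connected psl_space"
    using open_psl_space open_imp_locally_path_connected by blast
  ultimately obtain G where G: "continuous_on psl_space G" "G \<in> psl_space \<rightarrow> psl_space"
    "\<And>P. P \<in> psl_space \<Longrightarrow> psl_proj (G P) = tangent_map f (psl_proj P)"
    using covering_space_lift[OF psl_proj_covering_space simply_connected_psl_space] by metis
  have "lift_of f (restrict G psl_space)"
    using G by (auto simp: lift_of_def cong: continuous_on_cong)
  then show thesis using that by blast
qed

text \<open>Uniqueness of lifts: \<open>G\<close> and the translation by \<open>a\<close> both lift
  \<open>psl_proj\<close> and agree at \<open>(0, 1, 0)\<close>. The number \<open>a\<close> is the
  angle component of the image of that point; it has cosine 1 and sine 0, so the translation is a
  deck transformation.\<close>

lemma lift_of_identity:
  assumes "continuous_on psl_space G" "G \<in> psl_space \<rightarrow> psl_space"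
    and "\<And>P. P \<in> psl_space \<Longrightarrow> psl_proj (G P) = psl_proj P"
  obtains a where "\<And>P. P \<in> psl_space \<Longrightarrow> G P = vertical_translation a P"
proof -
  let ?P0 = "(0, 1, 0) :: real \<times> real \<times> real"
  have P0: "?P0 \<in> psl_space" by (simp add: mem_psl_space)
  obtain x y a where G0: "G ?P0 = (x, y, a)" by (metis surj_pair)
  have xy: "x = 0" "y = 1" "cos a = 1" "sin a = 0"
    using assms(3)[OF P0] by (auto simp: G0 psl_proj_eq)
  have "G P = vertical_translation a P" if P: "P \<in> psl_space" for P
  proof (rule covering_space_lift_unique[OF psl_proj_covering_space,
        where f = psl_proj and T = psl_space and a = ?P0 and ?g1.0 = G
          and ?g2.0 = "vertical_translation a" and x = P])
    show "G ?P0 = vertical_translation a ?P0"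
      by (simp add: G0 xy vertical_translation_apply P0)
    show "continuous_on psl_space (vertical_translation a)"
      using smooth_on_vertical_translation by (rule smooth_on_imp_continuous_on)
    show "\<And>Q. Q \<in> psl_space \<Longrightarrow> psl_proj Q = psl_proj (vertical_translation a Q)"
      by (auto simp: vertical_translation_apply psl_proj_eq cos_add sin_add xy)
    show "connected psl_space" using convex_psl_space by (rule convex_connected)
    show "\<And>Q. Q \<in> psl_space \<Longrightarrow> psl_proj Q = psl_proj (G Q)" by (simp add: assms(3))
    show "psl_proj \<in> psl_space \<rightarrow> unit_tangent_bundle"
      using psl_proj_in_unit_tangent_bundle by blast
    show "vertical_translation a \<in> psl_space \<rightarrow> psl_space"
      using vertical_translation_in_psl_space by blast
  qed (fact assms P P0 continuous_on_psl_proj)+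
  then show thesis using that by blast
qed

lemma hyp_isometry_inverse: "hyp_isometry f \<Longrightarrow> hyp_isometry (inv_into hyp_plane f)"
  unfolding hyp_isometry_def by (rule riemannian_isometry_inverse[OF open_hyp_plane])

text \<open>The composite of the two lifts covers the identity, which determines it only up to a
  deck transformation; hence the translation.\<close>

lemma lift_of_left_inverse:
  assumes f: "hyp_isometry f" and f': "hyp_isometry f'"
    and inv: "\<And>p. p \<in> hyp_plane \<Longrightarrow> f' (f p) = p"
    and F: "lift_of f F" and G: "lift_of f' G"
  obtains a where "\<And>P. P \<in> psl_space \<Longrightarrow> G (F P) = vertical_translation a P"
proof -
  note sm = riemannian_isometryD(2)[OF f[unfolded hyp_isometry_def]]
    riemannian_isometryD(2)[OF f'[unfolded hyp_isometry_def]]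
  note im = riemannian_isometryD(4)[OF f[unfolded hyp_isometry_def]]
  have F': "F \<in> psl_space \<rightarrow> psl_space" and G': "G \<in> psl_space \<rightarrow> psl_space"
    using F G unfolding lift_of_def by blast+
  have 1: "continuous_on psl_space (\<lambda>P. G (F P))"
    using continuous_on_compose2[of psl_space G psl_space F] F G F'
    unfolding lift_of_def image_subset_iff_funcset by blast
  have 2: "(\<lambda>P. G (F P)) \<in> psl_space \<rightarrow> psl_space" using F' G' by blast
  have 3: "psl_proj (G (F P)) = psl_proj P" if P: "P \<in> psl_space" for P
  proof -
    have "F P \<in> psl_space" using F' P by blast
    then have "psl_proj (G (F P)) = tangent_map f' (tangent_map f (psl_proj P))"
      using F G P by (simp add: lift_of_def)
    also have "\<dots> = psl_proj P"
    proof -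
      obtain p v where pv: "psl_proj P = (p, v)" by (metis surj_pair)
      then have "p \<in> hyp_plane"
        using psl_proj_in_unit_tangent_bundle[OF P] by (simp add: unit_tangent_bundle_def)
      from frechet_derivative_left_inverse[OF open_hyp_plane sm im inv this, of v] inv[OF this]
      show ?thesis
        by (simp add: pv tangent_map_def)
    qed
    finally show ?thesis .
  qed
  show thesis using lift_of_identity[OF 1 2 3] that by blast
qed


section \<open>Lifts of isometries are isometries\<close>

lemma angle_has_derivative:
  fixes w :: "'a::real_normed_vector \<Rightarrow> real"
  assumes "open S" "continuous_on S w" "p \<in> S"
    and "\<And>q. q \<in> S \<Longrightarrow> cos (w q) = C q" "\<And>q. q \<in> S \<Longrightarrow> sin (w q) = D q"
    and C: "(C has_derivative C') (at p)" and D: "(D has_derivative D') (at p)"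
  shows "(w has_derivative (\<lambda>v. C p * D' v - D p * C' v)) (at p)"
proof -
  \<comment> \<open>Near \<open>p\<close> the angle varies by less than pi/2, so arcsin recovers
    \<open>w q - w p\<close> from its sine, which is \<open>D q * C p - C q * D p\<close>. At
    \<open>q = p\<close> this is 0, where arcsin has derivative 1.\<close>
  have "isCont w p" using assms(1-3) continuous_on_eq_continuous_at by blast
  then obtain d where d: "d > 0" "\<And>q. dist q p < d \<Longrightarrow> dist (w q) (w p) < pi / 2"
    unfolding continuous_at_eps_delta by (metis pi_half_gt_zero)
  have "((\<lambda>q. w p + arcsin (D q * C p - C q * D p)) has_derivative
      (\<lambda>v. C p * D' v - D p * C' v)) (at p)"
  proof -
    have "((\<lambda>q. D q * C p - C q * D p) has_derivative (\<lambda>v. D' v * C p - C' v * D p)) (at p)"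
      using C D by (auto intro!: derivative_eq_intros)
    moreover have "(arcsin has_derivative (\<lambda>v. v)) (at (D p * C p - C p * D p))"
      using DERIV_arcsin[of 0] by (simp add: has_field_derivative_def mult.commute lambda_one)
    ultimately have "((\<lambda>q. arcsin (D q * C p - C q * D p)) has_derivative
        (\<lambda>v. D' v * C p - C' v * D p)) (at p)"
      by (rule has_derivative_compose)
    then have "((\<lambda>q. w p + arcsin (D q * C p - C q * D p)) has_derivative
        (\<lambda>v. 0 + (D' v * C p - C' v * D p))) (at p)"
      by (intro has_derivative_add has_derivative_const)
    then show ?thesis by (simp add: mult.commute)
  qed
  moreover have "w p + arcsin (D q * C p - C q * D p) = w q" if "q \<in> S \<inter> ball p d" for q
  proof -
    have "\<bar>w q - w p\<bar> < pi / 2"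
      using d(2)[of q] that by (simp add: dist_real_def dist_commute)
    then have "arcsin (sin (w q - w p)) = w q - w p"
      by (intro arcsin_sin) linarith+
    moreover have "sin (w q - w p) = D q * C p - C q * D p"
      using that assms(3) by (simp add: sin_diff assms(4,5))
    ultimately show ?thesis by simp
  qed
  moreover have "open (S \<inter> ball p d)" "p \<in> S \<inter> ball p d"
    using assms(1,3) d(1) by auto
  ultimately show ?thesis
    using has_derivative_transform_within_open by blast
qed

text \<open>The derivative of \<open>w\<close> is an expression in \<open>C\<close>,
  \<open>D\<close> and their derivatives in which \<open>w\<close> itself does not occur, so
  continuity of \<open>w\<close> is enough to start from.\<close>

lemma smooth_on_angle:
  fixes w :: "'a::real_normed_vector \<Rightarrow> real"
  assumes "open S" "continuous_on S w" "smooth_on S C" "smooth_on S D"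
    and "\<And>q. q \<in> S \<Longrightarrow> cos (w q) = C q" "\<And>q. q \<in> S \<Longrightarrow> sin (w q) = D q"
  shows "smooth_on S w"
proof (rule smooth_onI_derivative[OF assms(1)])
  show "(w has_derivative (\<lambda>v. C p * frechet_derivative D (at p) v -
      D p * frechet_derivative C (at p) v)) (at p)" if "p \<in> S" for p
    using assms that by (intro angle_has_derivative[where S = S] smooth_on_has_derivative) auto
  show "smooth_on S (\<lambda>p. C p * frechet_derivative D (at p) v -
      D p * frechet_derivative C (at p) v)" for v
    using assms by (intro smooth_intros)
qed

lemma frechet_derivative_plane:
  fixes f :: "real \<times> real \<Rightarrow> 'c::real_normed_vector"
  assumes "f differentiable (at p)"
  shows "frechet_derivative f (at p) (\<alpha>, \<beta>) =
    \<alpha> *\<^sub>R frechet_derivative f (at p) (1, 0) + \<beta> *\<^sub>R frechet_derivative f (at p) (0, 1)"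
proof -
  note lin = linear_frechet_derivative[OF assms]
  have "(\<alpha>, \<beta>) = \<alpha> *\<^sub>R (1, 0) + \<beta> *\<^sub>R (0, 1::real)" by simp
  then show ?thesis using linear_add[OF lin] linear_scale[OF lin] by metis
qed

text \<open>The differential is at each point a multiple of an orthogonal matrix, so its second
  column is the first one turned by a right angle, up to the sign \<open>\<epsilon>\<close> of the
  Jacobian determinant. This sign is continuous on a connected set and hence the same
  everywhere.\<close>

lemma hyp_isometry_conformal:
  assumes f: "hyp_isometry f"
  obtains \<epsilon> :: real where "\<epsilon> * \<epsilon> = 1"
    "\<And>p. p \<in> hyp_plane \<Longrightarrow> frechet_derivative f (at p) (0, 1) =
      (- \<epsilon> * snd (frechet_derivative f (at p) (1, 0)), \<epsilon> * fst (frechet_derivative f (at p) (1, 0)))"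
proof -
  note iso = riemannian_isometryD[OF f[unfolded hyp_isometry_def]]
  define a where "a p = fst (frechet_derivative f (at p) (1, 0))" for p
  define b where "b p = snd (frechet_derivative f (at p) (1, 0))" for p
  define c where "c p = fst (frechet_derivative f (at p) (0, 1))" for p
  define d where "d p = snd (frechet_derivative f (at p) (0, 1))" for p
  define k where "k p = (snd (f p) / snd p)\<^sup>2" for p
  \<comment> \<open>The Jacobian determinant divided by its absolute value, which turns out to be
    \<open>k p\<close>, the square of the Euclidean scaling factor.\<close>
  define \<epsilon> where "\<epsilon> p = (a p * d p - b p * c p) / k p" for p
  have *: "k p > 0" "(a p)\<^sup>2 + (b p)\<^sup>2 = k p" "(c p)\<^sup>2 + (d p)\<^sup>2 = k p" "a p * c p + b p * d p = 0"
    if "p \<in> hyp_plane" for p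
  proof -
    obtain x y where p: "p = (x, y)" by (metis surj_pair)
    obtain u v where fp: "f p = (u, v)" by (metis surj_pair)
    have y: "y > 0" using that by (simp add: p mem_hyp_plane)
    have v: "v > 0" using iso(5)[OF that] by (simp add: fp mem_hyp_plane)
    have "snd p = y" "snd (f p) = v" by (simp add: p, simp add: fp)
    then have k: "k p = v\<^sup>2 / y\<^sup>2" by (simp add: k_def power_divide)
    have "hyp_metric (f p) (\<alpha> * a p + \<beta> * c p, \<alpha> * b p + \<beta> * d p) = hyp_metric p (\<alpha>, \<beta>)" for \<alpha> \<beta>
    proof -
      have "frechet_derivative f (at p) (\<alpha>, \<beta>) = (\<alpha> * a p + \<beta> * c p, \<alpha> * b p + \<beta> * d p)"
        using frechet_derivative_plane[OF smooth_on_imp_differentiable[OF iso(2) that], of \<alpha> \<beta>]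
        by (simp add: a_def b_def c_def d_def prod_eq_iff)
      then show ?thesis using iso(6)[OF that, of "(\<alpha>, \<beta>)"] by simp
    qed
    then have eq: "((\<alpha> * a p + \<beta> * c p)\<^sup>2 + (\<alpha> * b p + \<beta> * d p)\<^sup>2) / v\<^sup>2 = (\<alpha>\<^sup>2 + \<beta>\<^sup>2) / y\<^sup>2" for \<alpha> \<beta>
      unfolding fp p[THEN arg_cong, of hyp_metric] hyp_metric_eq .
    have **: "(\<alpha> * a p + \<beta> * c p)\<^sup>2 + (\<alpha> * b p + \<beta> * d p)\<^sup>2 = (\<alpha>\<^sup>2 + \<beta>\<^sup>2) * k p" for \<alpha> \<beta>
    proof -
      have "(\<alpha> * a p + \<beta> * c p)\<^sup>2 + (\<alpha> * b p + \<beta> * d p)\<^sup>2 =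
          ((\<alpha> * a p + \<beta> * c p)\<^sup>2 + (\<alpha> * b p + \<beta> * d p)\<^sup>2) / v\<^sup>2 * v\<^sup>2"
        using v by simp
      also have "\<dots> = (\<alpha>\<^sup>2 + \<beta>\<^sup>2) * k p" unfolding eq k by simp
      finally show ?thesis .
    qed
    \<comment> \<open>The values of the quadratic form at (1, 0), (0, 1) and (1, 1) give the lengths
      of the two columns and, by polarization, their inner product.\<close>
    show "(a p)\<^sup>2 + (b p)\<^sup>2 = k p" "(c p)\<^sup>2 + (d p)\<^sup>2 = k p"
      using **[of 1 0] **[of 0 1] by auto
    then show "a p * c p + b p * d p = 0"
      using **[of 1 1] by (simp add: power2_eq_square algebra_simps)
    show "k p > 0" using y v by (simp add: k)
  qed
  have eps: "\<epsilon> p * \<epsilon> p = 1" "c p = - \<epsilon> p * b p" "d p = \<epsilon> p * a p" if "p \<in> hyp_plane" for p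
  proof -
    note k = *[OF that]
    have "(a p * d p - b p * c p)\<^sup>2 = k p * k p"
    proof -
      \<comment> \<open>Lagrange's identity.\<close>
      have "(a p * d p - b p * c p)\<^sup>2 =
          ((a p)\<^sup>2 + (b p)\<^sup>2) * ((c p)\<^sup>2 + (d p)\<^sup>2) - (a p * c p + b p * d p)\<^sup>2"
        by (simp add: power2_eq_square algebra_simps)
      then show ?thesis by (simp add: k)
    qed
    then show "\<epsilon> p * \<epsilon> p = 1"
      using k(1) by (simp add: \<epsilon>_def power2_eq_square)
    have "(a p * d p - b p * c p) * b p = - k p * c p" "(a p * d p - b p * c p) * a p = k p * d p"
    proof -
      have "a p * c p = - (b p * d p)" using k(4) by simp
      then have "(a p * d p - b p * c p) * b p = - ((a p)\<^sup>2 + (b p)\<^sup>2) * c p"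
        "(a p * d p - b p * c p) * a p = ((a p)\<^sup>2 + (b p)\<^sup>2) * d p"
        by algebra+
      then show "(a p * d p - b p * c p) * b p = - k p * c p"
        "(a p * d p - b p * c p) * a p = k p * d p"
        unfolding k(2) .
    qed
    then show "c p = - \<epsilon> p * b p" "d p = \<epsilon> p * a p"
      using k(1) by (simp_all add: \<epsilon>_def field_simps)
  qed
  have "continuous_on hyp_plane \<epsilon>"
  proof -
    have "smooth_on hyp_plane \<epsilon>"
      unfolding \<epsilon>_def a_def b_def c_def d_def k_def power2_eq_square
    proof (intro smooth_intros open_hyp_plane iso(2))
      show nz: "snd p \<noteq> 0" if "p \<in> hyp_plane" for p
        using that by (cases p) (simp add: mem_hyp_plane)
      show "snd p \<noteq> 0" if "p \<in> hyp_plane" for p using nz[OF that] .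
      show "snd (f p) / snd p * (snd (f p) / snd p) \<noteq> 0" if "p \<in> hyp_plane" for p
        using *(1)[OF that] by (simp add: k_def)
    qed
    then show ?thesis by (rule smooth_on_imp_continuous_on)
  qed
  moreover have "\<epsilon> ` hyp_plane \<subseteq> {1, -1}"
    using square_eq_1_iff[THEN iffD1, OF eps(1)] by auto
  then have "finite (\<epsilon> ` hyp_plane)" using finite_subset by blast
  ultimately have "\<epsilon> constant_on hyp_plane"
    by (intro continuous_finite_range_constant connected_hyp_plane)
  then obtain e where e: "\<And>p. p \<in> hyp_plane \<Longrightarrow> \<epsilon> p = e"
    unfolding constant_on_def by blast
  have "(0, 1) \<in> hyp_plane" by (simp add: mem_hyp_plane)
  from eps(1)[OF this] e[OF this] have 1: "e * e = 1" by simp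
  have 2: "frechet_derivative f (at p) (0, 1) =
      (- e * snd (frechet_derivative f (at p) (1, 0)), e * fst (frechet_derivative f (at p) (1, 0)))"
    if "p \<in> hyp_plane" for p
    using eps(2,3)[OF that] unfolding e[OF that] a_def b_def c_def d_def by (intro prod_eqI) simp_all
  show thesis by (rule that[OF 1 2])
qed

text \<open>The left-hand side is \<open>F\<^sup>*(dx/y + dz)\<close> for a lift \<open>F\<close> of \<open>f = (u, v)\<close>, where
  \<open>a = u\<^sub>x\<close>, \<open>b = v\<^sub>x\<close> and \<open>(C, D)\<close> are the cosine and sine of the angle component of \<open>F\<close>; the
  assumptions on \<open>a\<^sub>x\<close>, \<dots>, \<open>b\<^sub>y\<close> are the Cauchy-Riemann equations and the derivative of
  \<open>(a\<^sup>2 + b\<^sup>2) y\<^sup>2 = v\<^sup>2\<close>.\<close>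

lemma contact_form_pullback:
  fixes a b v y \<epsilon> :: real
  assumes e: "\<epsilon> * \<epsilon> = 1" and y: "y > 0" and v: "v > 0" and k: "k = y / v"
    and n: "(a * a + b * b) * (y * y) = v * v" and cs: "c * c + s * s = 1"
    and N: "N = a * c - \<epsilon> * b * s" and M: "M = b * c + \<epsilon> * a * s"
    and N': "N' = a' * c - a * s * \<gamma> - \<epsilon> * (b' * s + b * c * \<gamma>)"
    and M': "M' = b' * c - b * s * \<gamma> + \<epsilon> * (a' * s + a * c * \<gamma>)"
    and CR: "a' = \<alpha> * ax - \<beta> * (\<epsilon> * bx)" "b' = \<alpha> * bx + \<beta> * (\<epsilon> * ax)"
    and x: "(a * ax + b * bx) * (y * y) = v * b"
    and yy: "(b * ax - a * bx) * \<epsilon> * (y * y) + (a * a + b * b) * y = v * (\<epsilon> * a)"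
  shows "(a * \<alpha> - \<epsilon> * b * \<beta>) / v + (k * N * (k' * M + k * M') - k * M * (k' * N + k * N')) =
    \<epsilon> * (\<alpha> / y + \<gamma>)"
proof -
  \<comment> \<open>As complex numbers, \<open>N + i M = (a + i b) (c + i \<epsilon> s)\<close>: the
    angle of \<open>(N, M)\<close> is that of \<open>(a, b)\<close> plus \<epsilon> times the fiber
    coordinate. The two terms are the contributions of these angles.\<close>
  have "N * M' - M * N' = (c * c + s * s) * (\<epsilon> * (a * a + b * b) * \<gamma> + (a * b' - b * a'))"
    unfolding N M N' M' using e by algebra
  then have 1: "N * M' - M * N' = \<epsilon> * (a * a + b * b) * \<gamma> + (a * b' - b * a')"
    by (simp add: cs)
  have 2: "(a * bx - b * ax) * (y * y) = \<epsilon> * (a * a + b * b) * y - v * a"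
    using yy e by algebra
  have "(a * b' - b * a') * (y * y) =
      \<alpha> * ((a * bx - b * ax) * (y * y)) + \<beta> * \<epsilon> * ((a * ax + b * bx) * (y * y))"
    unfolding CR by (simp add: algebra_simps)
  also have "\<dots> = \<alpha> * (\<epsilon> * (a * a + b * b) * y - v * a) + \<beta> * \<epsilon> * (v * b)"
    unfolding 2 x ..
  finally have 3: "(N * M' - M * N') * (y * y) * y = \<epsilon> * \<gamma> * (v * v) * y
      + \<alpha> * (\<epsilon> * (v * v) - v * a * y) + \<beta> * \<epsilon> * (v * b) * y"
    unfolding 1 using n by algebra
  \<comment> \<open>The terms with \<open>k'\<close> cancel, since rescaling \<open>(N, M)\<close>
    does not change its angle; there remains \<open>k * k\<close> times
    \<open>N * M' - M * N'\<close>.\<close>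
  have "(a * \<alpha> - \<epsilon> * b * \<beta>) / v + (k * N * (k' * M + k * M') - k * M * (k' * N + k * N')) =
      ((a * \<alpha> - \<epsilon> * b * \<beta>) * v * y + (N * M' - M * N') * (y * y) * y) / (v * v * y)"
    unfolding k using y v by (simp add: divide_simps) (simp add: algebra_simps)
  also have "\<dots> = (\<epsilon> * \<gamma> * (v * v) * y + \<alpha> * (\<epsilon> * (v * v))) / (v * v * y)"
    unfolding 3 by (simp add: algebra_simps)
  also have "\<dots> = \<epsilon> * (\<alpha> / y + \<gamma>)"
    using y v by (simp add: divide_simps) (simp add: algebra_simps)
  finally show ?thesis .
qed


lemma lift_of_smooth_isometric:
  assumes f: "hyp_isometry f" and F: "lift_of f F"
  shows "smooth_on psl_space F"
    and "P \<in> psl_space \<Longrightarrow> psl_metric (F P) (frechet_derivative F (at P) V) = psl_metric P V"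
proof -
  note iso = riemannian_isometryD[OF f[unfolded hyp_isometry_def]]
  obtain \<epsilon> :: real where e: "\<epsilon> * \<epsilon> = 1" and conf:
    "\<And>p. p \<in> hyp_plane \<Longrightarrow> frechet_derivative f (at p) (0, 1) =
      (- \<epsilon> * snd (frechet_derivative f (at p) (1, 0)), \<epsilon> * fst (frechet_derivative f (at p) (1, 0)))"
    using hyp_isometry_conformal[OF f] by blast
  define u where "u q = fst (f q)" for q
  define v where "v q = snd (f q)" for q
  define a where "a q = frechet_derivative u (at q) (1, 0)" for q
  define b where "b q = frechet_derivative v (at q) (1, 0)" for q
  define \<pi> where "\<pi> P = (fst P, fst (snd P))" for P :: "real \<times> real \<times> real"
  define w where "w P = snd (snd (F P))" for P
  \<comment> \<open>\<open>(N, M)\<close> is the image of \<open>(cos z, sin z)\<close> under the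
    differential of \<open>f\<close>, and \<open>k\<close> is the quotient of the Euclidean lengths
    of unit vectors at the point and at its image. So \<open>k * N\<close> and \<open>k * M\<close>
    are the cosine and sine of the angle of the image vector.\<close>
  define k where "k P = fst (snd P) / v (\<pi> P)" for P
  define N where "N P = a (\<pi> P) * cos (snd (snd P)) - \<epsilon> * b (\<pi> P) * sin (snd (snd P))" for P
  define M where "M P = b (\<pi> P) * cos (snd (snd P)) + \<epsilon> * a (\<pi> P) * sin (snd (snd P))" for P
  have su: "smooth_on hyp_plane u" and sv: "smooth_on hyp_plane v"
    unfolding u_def v_def by (intro smooth_intros open_hyp_plane iso(2))+
  have sa: "smooth_on hyp_plane a" and sb: "smooth_on hyp_plane b"
    unfolding a_def b_def by (intro smooth_intros su sv)+
  have \<pi>: "\<pi> P \<in> hyp_plane" if "P \<in> psl_space" for P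
    using that by (cases P) (simp add: \<pi>_def mem_psl_space mem_hyp_plane)
  have \<pi>_smooth: "smooth_on psl_space (\<lambda>P. h (\<pi> P))" if "smooth_on hyp_plane h"
    for h :: "real \<times> real \<Rightarrow> real"
  proof (rule smooth_on_compose[OF open_psl_space open_hyp_plane _ _ that])
    show "smooth_on psl_space \<pi>" unfolding \<pi>_def by (intro smooth_intros open_psl_space)
  qed (use \<pi> in blast)
  have v_pos: "v q > 0" if "q \<in> hyp_plane" for q
    using iso(5)[OF that] by (cases "f q") (simp add: v_def mem_hyp_plane)
  have Df: "frechet_derivative f (at q) h = (frechet_derivative u (at q) h, frechet_derivative v (at q) h)"
    if "q \<in> hyp_plane" for q h
    using frechet_derivative_eq[OF has_derivative_fst[OF smooth_on_has_derivative[OF iso(2) that]]]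
      frechet_derivative_eq[OF has_derivative_snd[OF smooth_on_has_derivative[OF iso(2) that]]]
    by (simp add: u_def[abs_def] v_def[abs_def] prod_eq_iff)
  have Du: "frechet_derivative u (at q) (0, 1) = - \<epsilon> * b q"
    and Dv: "frechet_derivative v (at q) (0, 1) = \<epsilon> * a q" if "q \<in> hyp_plane" for q
    using conf[OF that] unfolding Df[OF that] a_def b_def by simp_all
  have norm: "(a q * a q + b q * b q) * (snd q * snd q) = v q * v q" if q: "q \<in> hyp_plane" for q
  proof -
    obtain x y where xy: "q = (x, y)" by (metis surj_pair)
    have y: "y > 0" using q by (simp add: xy mem_hyp_plane)
    have "f q = (u q, v q)" by (simp add: u_def v_def)
    then have "hyp_metric (u q, v q) (a q, b q) = hyp_metric q (1, 0)"
      using iso(6)[OF q, of "(1, 0)"] unfolding Df[OF q] a_def b_def by simp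
    then show ?thesis
      using y v_pos[OF q] unfolding xy hyp_metric_eq by (simp add: power2_eq_square field_simps)
  qed
  have proj: "F P \<in> psl_space" "psl_proj (F P) = tangent_map f (psl_proj P)" if "P \<in> psl_space" for P
    using F that unfolding lift_of_def by blast+
  have FP: "F P = (u (\<pi> P), v (\<pi> P), w P)" and cw: "cos (w P) = k P * N P"
    and sw: "sin (w P) = k P * M P" if P: "P \<in> psl_space" for P
  proof -
    obtain x y z where xyz: "P = (x, y, z)" by (metis prod_cases3)
    have q: "(x, y) \<in> hyp_plane" using \<pi>[OF P] by (simp add: xyz \<pi>_def)
    obtain u' v' where uv: "F P = (u', v', w P)" unfolding w_def by (metis prod.collapse)
    have "frechet_derivative f (at (x, y)) (y * cos z, y * sin z) =
        (y * cos z * a (x, y) - y * sin z * \<epsilon> * b (x, y), y * cos z * b (x, y) + y * sin z * \<epsilon> * a (x, y))"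
      using frechet_derivative_plane[OF smooth_on_imp_differentiable[OF iso(2) q], of "y * cos z" "y * sin z"]
      by (simp add: Df[OF q] Du[OF q] Dv[OF q] a_def[symmetric] b_def[symmetric])
    then have "tangent_map f (psl_proj P) =
        (f (x, y), (y * cos z * a (x, y) - y * sin z * \<epsilon> * b (x, y),
           y * cos z * b (x, y) + y * sin z * \<epsilon> * a (x, y)))"
      by (simp add: xyz psl_proj_eq tangent_map_def)
    moreover have "psl_proj (F P) = ((u', v'), (v' * cos (w P), v' * sin (w P)))"
      by (simp add: uv psl_proj_eq)
    ultimately have *: "((u', v'), (v' * cos (w P), v' * sin (w P))) =
        (f (x, y), (y * cos z * a (x, y) - y * sin z * \<epsilon> * b (x, y),
           y * cos z * b (x, y) + y * sin z * \<epsilon> * a (x, y)))"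
      using proj(2)[OF P] by simp
    then have uv': "u' = u (x, y)" "v' = v (x, y)" by (auto simp: u_def v_def prod_eq_iff)
    have \<pi>P: "\<pi> P = (x, y)" by (simp add: xyz \<pi>_def)
    show "F P = (u (\<pi> P), v (\<pi> P), w P)" unfolding \<pi>P using uv uv' by simp
    have v': "v' > 0" using v_pos[OF q] uv' by simp
    have "snd (snd P) = z" "fst (snd P) = y" by (simp_all add: xyz)
    then have kNM: "k P * N P = (y * cos z * a (x, y) - y * sin z * \<epsilon> * b (x, y)) / v'"
      "k P * M P = (y * cos z * b (x, y) + y * sin z * \<epsilon> * a (x, y)) / v'"
      unfolding k_def N_def M_def \<pi>P uv'(2)[symmetric] by (simp_all add: field_simps)
    have "v' * cos (w P) = y * cos z * a (x, y) - y * sin z * \<epsilon> * b (x, y)"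
      "v' * sin (w P) = y * cos z * b (x, y) + y * sin z * \<epsilon> * a (x, y)" using * by simp_all
    then show "cos (w P) = k P * N P" "sin (w P) = k P * M P"
      unfolding kNM using v' by (metis less_irrefl nonzero_mult_div_cancel_left)+
  qed
  have smk: "smooth_on psl_space k" unfolding k_def
    using v_pos \<pi> by (intro smooth_intros \<pi>_smooth sv open_psl_space) (auto simp: less_imp_neq[symmetric])
  have smN: "smooth_on psl_space N" unfolding N_def
    by (intro smooth_intros \<pi>_smooth sa sb open_psl_space)
  have smM: "smooth_on psl_space M" unfolding M_def
    by (intro smooth_intros \<pi>_smooth sa sb open_psl_space)
  have contw: "continuous_on psl_space w"
    using F unfolding w_def lift_of_def by (intro continuous_on_snd) blast
  have smC: "smooth_on psl_space (\<lambda>P. k P * N P)" "smooth_on psl_space (\<lambda>P. k P * M P)"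
    by (intro smooth_on_mult open_psl_space smk smN smM)+
  have smw: "smooth_on psl_space w"
    by (rule smooth_on_angle[OF open_psl_space contw smC cw sw])
  show "smooth_on psl_space F"
  proof (rule smooth_on_cong[OF open_psl_space])
    show "smooth_on psl_space (\<lambda>P. (u (\<pi> P), v (\<pi> P), w P))"
      by (intro smooth_on_Pair open_psl_space \<pi>_smooth su sv smw)
  qed (simp add: FP)
  show "psl_metric (F P) (frechet_derivative F (at P) V) = psl_metric P V" if P: "P \<in> psl_space"
  proof -
    obtain x y z where xyz: "P = (x, y, z)" by (metis prod_cases3)
    obtain \<alpha> \<beta> \<gamma> where V: "V = (\<alpha>, \<beta>, \<gamma>)" by (metis prod_cases3)
    have \<pi>P: "\<pi> P = (x, y)" by (simp add: xyz \<pi>_def)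
    have q: "(x, y) \<in> hyp_plane" using \<pi>[OF P] by (simp add: \<pi>P)
    then have y: "y > 0" by (simp add: mem_hyp_plane)
    let ?D = "\<lambda>h. frechet_derivative h (at (x, y))"
    define ax ay bx by' where "ax = ?D a (1, 0)" and "ay = ?D a (0, 1)" and "bx = ?D b (1, 0)"
      and "by' = ?D b (0, 1)"
    have split: "?D h (s, t) = s * ?D h (1, 0) + t * ?D h (0, 1)" if "smooth_on hyp_plane h"
      for h :: "real \<times> real \<Rightarrow> real" and s t
      using frechet_derivative_plane[OF smooth_on_imp_differentiable[OF that q], of s t] by simp
    have hd: "(h has_derivative ?D h) (at (x, y))" if "smooth_on hyp_plane h"
      for h :: "real \<times> real \<Rightarrow> real"
      using smooth_on_has_derivative[OF that q] .
    \<comment> \<open>From \<open>u_y = - \<epsilon> v_x\<close>, exchanging the order of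
      differentiation in \<open>a_y = u_xy\<close>; likewise below for \<open>by'\<close>. These are
      Cauchy-Riemann equations for \<open>a\<close> and \<open>b\<close>.\<close>
    have ay: "ay = - (\<epsilon> * bx)"
    proof -
      have "ay = frechet_derivative (\<lambda>q. frechet_derivative u (at q) (0, 1)) (at (x, y)) (1, 0)"
        unfolding ay_def a_def by (rule mixed_derivatives_commute[OF open_hyp_plane su q])
      also have "\<dots> = frechet_derivative (\<lambda>q. - \<epsilon> * b q) (at (x, y)) (1, 0)"
      proof -
        have "(\<lambda>q. - \<epsilon> * b q) differentiable (at (x, y))"
          by (rule smooth_on_imp_differentiable[OF _ q]) (intro smooth_intros sb open_hyp_plane)
        then have "frechet_derivative (\<lambda>q. frechet_derivative u (at q) (0, 1)) (at (x, y)) =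
            frechet_derivative (\<lambda>q. - \<epsilon> * b q) (at (x, y))"
          by (rule differentiable_eq_on_open(2)[OF open_hyp_plane q, rotated]) (simp add: Du)
        then show ?thesis by (rule fun_cong)
      qed
      also have "\<dots> = - \<epsilon> * ?D b (1, 0)"
        using frechet_derivative_eq[OF has_derivative_mult_right[OF hd[OF sb], of "- \<epsilon>"]] by simp
      finally show ?thesis by (simp add: bx_def)
    qed
    have by': "by' = \<epsilon> * ax"
    proof -
      have "by' = frechet_derivative (\<lambda>q. frechet_derivative v (at q) (0, 1)) (at (x, y)) (1, 0)"
        unfolding by'_def b_def by (rule mixed_derivatives_commute[OF open_hyp_plane sv q])
      also have "\<dots> = frechet_derivative (\<lambda>q. \<epsilon> * a q) (at (x, y)) (1, 0)"
      proof -
        have "(\<lambda>q. \<epsilon> * a q) differentiable (at (x, y))"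
          by (rule smooth_on_imp_differentiable[OF _ q]) (intro smooth_intros sa open_hyp_plane)
        then have "frechet_derivative (\<lambda>q. frechet_derivative v (at q) (0, 1)) (at (x, y)) =
            frechet_derivative (\<lambda>q. \<epsilon> * a q) (at (x, y))"
          by (rule differentiable_eq_on_open(2)[OF open_hyp_plane q, rotated]) (simp add: Dv)
        then show ?thesis by (rule fun_cong)
      qed
      also have "\<dots> = \<epsilon> * ?D a (1, 0)"
        using frechet_derivative_eq[OF has_derivative_mult_right[OF hd[OF sa], of "\<epsilon>"]] by simp
      finally show ?thesis by (simp add: ax_def)
    qed
    \<comment> \<open>The identity \<open>norm\<close> differentiated in direction \<open>h\<close>.
      The two coordinate directions yield \<open>x1\<close> and \<open>y1\<close>, the last two
      assumptions of \<open>contact_form_pullback\<close>.\<close>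
    have dnorm: "2 * (a (x, y) * ?D a h + b (x, y) * ?D b h) * (y * y) +
        (a (x, y) * a (x, y) + b (x, y) * b (x, y)) * (2 * y * snd h) = 2 * v (x, y) * ?D v h" for h
    proof -
      let ?L = "\<lambda>h. (a (x, y) * a (x, y) + b (x, y) * b (x, y)) * (snd (x, y) * snd h + snd h * snd (x, y)) +
        (a (x, y) * ?D a h + ?D a h * a (x, y) + (b (x, y) * ?D b h + ?D b h * b (x, y))) *
        (snd (x, y) * snd (x, y))"
      have "((\<lambda>q. (a q * a q + b q * b q) * (snd q * snd q)) has_derivative ?L) (at (x, y))"
        by (intro has_derivative_mult has_derivative_add has_derivative_snd has_derivative_ident hd sa sb)
      then have "((\<lambda>q. v q * v q) has_derivative ?L) (at (x, y))"
        by (rule has_derivative_transform_within_open[OF _ open_hyp_plane q norm])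
      moreover have "((\<lambda>q. v q * v q) has_derivative (\<lambda>h. v (x, y) * ?D v h + ?D v h * v (x, y))) (at (x, y))"
        by (intro has_derivative_mult hd sv)
      ultimately have "?L = (\<lambda>h. v (x, y) * ?D v h + ?D v h * v (x, y))"
        by (rule has_derivative_unique)
      from fun_cong[OF this, of h] show ?thesis by (simp add: algebra_simps)
    qed
    have x1: "(a (x, y) * ax + b (x, y) * bx) * (y * y) = v (x, y) * b (x, y)"
      using dnorm[of "(1, 0)"] unfolding ax_def bx_def b_def[of "(x, y)"] snd_conv mult_zero_right
      by (simp only: algebra_simps)
    have y1: "(b (x, y) * ax - a (x, y) * bx) * \<epsilon> * (y * y) +
        (a (x, y) * a (x, y) + b (x, y) * b (x, y)) * y = v (x, y) * (\<epsilon> * a (x, y))"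
      using dnorm[of "(0, 1)"] unfolding Dv[OF q] ay_def[symmetric] by'_def[symmetric] ay by' snd_conv mult_1_right
      by algebra
    have D\<pi>: "(\<pi> has_derivative \<pi>) (at P)"
      unfolding \<pi>_def by (auto intro!: derivative_eq_intros)
    have h\<pi>: "((\<lambda>P. h (\<pi> P)) has_derivative (\<lambda>V. ?D h (\<pi> V))) (at P)" if "smooth_on hyp_plane h"
      for h :: "real \<times> real \<Rightarrow> real"
      using has_derivative_compose[OF D\<pi>, of h "?D h"] hd[OF that] by (simp add: \<pi>P)
    define N' where "N' V = ?D a (\<pi> V) * cos z - a (x, y) * sin z * snd (snd V)
      - \<epsilon> * (?D b (\<pi> V) * sin z + b (x, y) * cos z * snd (snd V))" for V
    define M' where "M' V = ?D b (\<pi> V) * cos z - b (x, y) * sin z * snd (snd V)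
      + \<epsilon> * (?D a (\<pi> V) * sin z + a (x, y) * cos z * snd (snd V))" for V
    define k' where "k' = frechet_derivative k (at P)"
    have hN: "(N has_derivative N') (at P)"
      unfolding N_def N'_def
      by (auto intro!: derivative_eq_intros h\<pi>[OF sa] h\<pi>[OF sb] simp: \<pi>P) (simp_all add: xyz fun_eq_iff algebra_simps)
    have hM: "(M has_derivative M') (at P)"
      unfolding M_def M'_def
      by (auto intro!: derivative_eq_intros h\<pi>[OF sa] h\<pi>[OF sb] simp: \<pi>P) (simp_all add: xyz fun_eq_iff algebra_simps)
    have hk: "(k has_derivative k') (at P)"
      unfolding k'_def by (rule smooth_on_has_derivative[OF smk P])
    have "((\<lambda>P. k P * N P) has_derivative (\<lambda>V. k P * N' V + k' V * N P)) (at P)"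
      "((\<lambda>P. k P * M P) has_derivative (\<lambda>V. k P * M' V + k' V * M P)) (at P)"
      by (rule has_derivative_mult[OF hk hN], rule has_derivative_mult[OF hk hM])
    from angle_has_derivative[OF open_psl_space contw P cw sw this]
    have Dw: "(w has_derivative (\<lambda>V. k P * N P * (k P * M' V + k' V * M P) -
        k P * M P * (k P * N' V + k' V * N P))) (at P)" .
    define W where "W = k P * N P * (k P * M' V + k' V * M P) - k P * M P * (k P * N' V + k' V * N P)"
    have "((\<lambda>P. (u (\<pi> P), v (\<pi> P), w P)) has_derivative
        (\<lambda>V. (?D u (\<pi> V), ?D v (\<pi> V), k P * N P * (k P * M' V + k' V * M P) -
        k P * M P * (k P * N' V + k' V * N P)))) (at P)"
      by (intro has_derivative_Pair h\<pi> su sv Dw)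
    then have "(F has_derivative
        (\<lambda>V. (?D u (\<pi> V), ?D v (\<pi> V), k P * N P * (k P * M' V + k' V * M P) -
        k P * M P * (k P * N' V + k' V * N P)))) (at P)"
      by (rule has_derivative_transform_within_open[OF _ open_psl_space P]) (simp add: FP)
    then have DF: "frechet_derivative F (at P) V = (?D u (\<alpha>, \<beta>), ?D v (\<alpha>, \<beta>), W)"
      by (simp add: frechet_derivative_eq V W_def \<pi>_def)
    have kP: "k P = y / v (x, y)" unfolding k_def \<pi>P by (simp add: xyz)
    have Du': "?D u (\<alpha>, \<beta>) = a (x, y) * \<alpha> - \<epsilon> * b (x, y) * \<beta>"
      by (simp add: split[OF su, of \<alpha> \<beta>] Du[OF q] a_def)
    have a': "?D a (\<alpha>, \<beta>) = \<alpha> * ax - \<beta> * (\<epsilon> * bx)" and b': "?D b (\<alpha>, \<beta>) = \<alpha> * bx + \<beta> * (\<epsilon> * ax)"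
      using split[OF sa, of \<alpha> \<beta>] split[OF sb, of \<alpha> \<beta>]
      unfolding ax_def[symmetric] bx_def[symmetric] ay_def[symmetric] by'_def[symmetric] ay by'
      by simp_all
    have NP: "N P = a (x, y) * cos z - \<epsilon> * b (x, y) * sin z"
      and MP: "M P = b (x, y) * cos z + \<epsilon> * a (x, y) * sin z"
      unfolding N_def M_def \<pi>P by (simp_all add: xyz)
    have N'V: "N' V = ?D a (\<alpha>, \<beta>) * cos z - a (x, y) * sin z * \<gamma>
        - \<epsilon> * (?D b (\<alpha>, \<beta>) * sin z + b (x, y) * cos z * \<gamma>)"
      and M'V: "M' V = ?D b (\<alpha>, \<beta>) * cos z - b (x, y) * sin z * \<gamma>
        + \<epsilon> * (?D a (\<alpha>, \<beta>) * sin z + a (x, y) * cos z * \<gamma>)"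
      by (simp_all add: N'_def M'_def V \<pi>_def)
    have "cos z * cos z + sin z * sin z = 1"
      using sin_cos_squared_add2[of z] by (simp add: power2_eq_square add.commute)
    from contact_form_pullback[OF e y v_pos[OF q] kP _ this NP MP N'V M'V a' b' x1 y1, of "k' V"] norm[OF q]
    have "?D u (\<alpha>, \<beta>) / v (x, y) + W = \<epsilon> * (\<alpha> / y + \<gamma>)"
      unfolding Du' W_def by (simp add: add.commute)
    \<comment> \<open>Squaring removes the sign \<epsilon>, so orientation-reversing isometries are
      covered as well. The rest of the metric is that of the base, which \<open>f\<close>
      preserves.\<close>
    then have sq: "(?D u (\<alpha>, \<beta>) / v (x, y) + W)\<^sup>2 = (\<alpha> / y + \<gamma>)\<^sup>2"
      using e by (simp add: power_mult_distrib power2_eq_square[of \<epsilon>])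
    have "hyp_metric (f (x, y)) (frechet_derivative f (at (x, y)) (\<alpha>, \<beta>)) = hyp_metric (x, y) (\<alpha>, \<beta>)"
      by (rule iso(6)[OF q])
    then have "hyp_metric (u (x, y), v (x, y)) (?D u (\<alpha>, \<beta>), ?D v (\<alpha>, \<beta>)) = hyp_metric (x, y) (\<alpha>, \<beta>)"
      unfolding Df[OF q] by (simp add: u_def v_def)
    then have "psl_metric (u (x, y), v (x, y), w P) (?D u (\<alpha>, \<beta>), ?D v (\<alpha>, \<beta>), W) =
        psl_metric (x, y, z) (\<alpha>, \<beta>, \<gamma>)"
      using sq unfolding psl_metric_eq[OF y] psl_metric_eq[OF v_pos[OF q]] hyp_metric_eq by simp
    then show ?thesis
      unfolding DF FP[OF P] \<pi>P unfolding xyz V .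
  qed
qed

lemma isometry_lifts_subset: "isometry_lifts \<subseteq> carrier psl_isometry_group"
proof
  fix F assume "F \<in> isometry_lifts"
  then obtain f where f: "hyp_isometry f" and F: "lift_of f F"
    unfolding isometry_lifts_def by blast
  define f' where "f' = inv_into hyp_plane f"
  have f': "hyp_isometry f'" unfolding f'_def by (rule hyp_isometry_inverse[OF f])
  obtain G where G: "lift_of f' G" using lift_of_exists[OF f'] .
  have bij: "bij_betw f hyp_plane hyp_plane"
    using riemannian_isometryD(1)[OF f[unfolded hyp_isometry_def]] .
  obtain a where a: "\<And>P. P \<in> psl_space \<Longrightarrow> G (F P) = vertical_translation a P"
    using lift_of_left_inverse[OF f f' _ F G] bij_betw_inv_into_left[OF bij] unfolding f'_def by metis
  obtain c where c: "\<And>P. P \<in> psl_space \<Longrightarrow> F (G P) = vertical_translation c P"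
    using lift_of_left_inverse[OF f' f _ G F] bij_betw_inv_into_right[OF bij] unfolding f'_def by metis
  have F': "F P \<in> psl_space" and G': "G P \<in> psl_space" if "P \<in> psl_space" for P
    using F G that unfolding lift_of_def by blast+
  \<comment> \<open>\<open>G\<close> inverts \<open>F\<close> from the left only up to the
    translation by \<open>a\<close>; correcting it gives the smooth left inverse for
    \<open>riemannian_isometryI\<close>. The other composite, with \<open>c\<close>, gives
    surjectivity.\<close>
  have inv: "vertical_translation (- a) (G (F P)) = P" if "P \<in> psl_space" for P
    using a[OF that] vertical_translation_cancel(1)[OF that] by simp
  have bijF: "bij_betw F psl_space psl_space"
  proof (rule bij_betw_imageI)
    show "inj_on F psl_space" using inv by (metis inj_onI)
    show "F ` psl_space = psl_space"
    proof (intro equalityI subsetI)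
      fix P assume P: "P \<in> psl_space"
      then have "F (G (vertical_translation (- c) P)) = P"
        using c vertical_translation_in_psl_space vertical_translation_cancel(2) by simp
      then show "P \<in> F ` psl_space"
        using G'[OF vertical_translation_in_psl_space[OF P]] by (metis imageI)
    qed (use F' in blast)
  qed
  have "riemannian_isometry psl_space psl_metric F"
  proof (rule riemannian_isometryI[OF open_psl_space bijF _ _ inv])
    show "smooth_on psl_space F" by (rule lift_of_smooth_isometric(1)[OF f F])
    show "smooth_on psl_space (\<lambda>P. vertical_translation (- a) (G P))"
      by (rule smooth_on_compose[OF open_psl_space open_psl_space _
            lift_of_smooth_isometric(1)[OF f' G] smooth_on_vertical_translation]) (use G' in blast)
    show "psl_metric (F P) (frechet_derivative F (at P) V) = psl_metric P V" if "P \<in> psl_space" for P V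
      by (rule lift_of_smooth_isometric(2)[OF f F that])
  qed
  then show "F \<in> carrier psl_isometry_group"
    using F bijF by (simp add: carrier_psl_isometry_group Bij_def lift_of_def)
qed


section \<open>Bochner's formula\<close>

text \<open>The orthonormal frame \<open>y \<partial>\<^sub>x - \<partial>\<^sub>z\<close>, \<open>y \<partial>\<^sub>y\<close>, \<open>\<partial>\<^sub>z\<close>. It is left-invariant for the
  structure of the product of the affine group with the reals; hence the constant coefficients below.\<close>

definition E1 :: "(real \<times> real \<times> real \<Rightarrow> real) \<Rightarrow> real \<times> real \<times> real \<Rightarrow> real" where
  "E1 u = (\<lambda>P. fst (snd P) * frechet_derivative u (at P) (1, 0, 0) - frechet_derivative u (at P) (0, 0, 1))"

definition E2 :: "(real \<times> real \<times> real \<Rightarrow> real) \<Rightarrow> real \<times> real \<times> real \<Rightarrow> real" where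
  "E2 u = (\<lambda>P. fst (snd P) * frechet_derivative u (at P) (0, 1, 0))"

definition E3 :: "(real \<times> real \<times> real \<Rightarrow> real) \<Rightarrow> real \<times> real \<times> real \<Rightarrow> real" where
  "E3 u = (\<lambda>P. frechet_derivative u (at P) (0, 0, 1))"

lemmas E_defs = E1_def E2_def E3_def

lemma smooth_on_E:
  assumes "smooth_on psl_space u"
  shows "smooth_on psl_space (E1 u)" "smooth_on psl_space (E2 u)" "smooth_on psl_space (E3 u)"
  unfolding E_defs by (intro smooth_intros open_psl_space assms)+

text \<open>Identities that hold on the open set \<open>psl_space\<close> may be differentiated; in
  this way the commutation relations are applied inside third derivatives.\<close>

lemma E_cong:
  assumes "smooth_on psl_space u" "\<And>Q. Q \<in> psl_space \<Longrightarrow> v Q = u Q" "P \<in> psl_space"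
  shows "E1 v P = E1 u P" "E2 v P = E2 u P" "E3 v P = E3 u P"
proof -
  have "frechet_derivative v (at P) = frechet_derivative u (at P)"
    using assms smooth_on_imp_differentiable
    by (intro differentiable_eq_on_open(2)[OF open_psl_space]) auto
  then show "E1 v P = E1 u P" "E2 v P = E2 u P" "E3 v P = E3 u P"
    by (simp_all add: E_defs)
qed

lemma E_add:
  assumes "smooth_on psl_space u" "smooth_on psl_space v" "P \<in> psl_space"
  shows "E1 (\<lambda>Q. u Q + v Q) P = E1 u P + E1 v P"
    "E2 (\<lambda>Q. u Q + v Q) P = E2 u P + E2 v P" "E3 (\<lambda>Q. u Q + v Q) P = E3 u P + E3 v P"
  using frechet_derivative_eq[OF has_derivative_add[OF smooth_on_has_derivative[OF assms(1,3)]
      smooth_on_has_derivative[OF assms(2,3)]]]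
  by (simp_all add: E_defs algebra_simps)

lemma E_diff:
  assumes "smooth_on psl_space u" "smooth_on psl_space v" "P \<in> psl_space"
  shows "E1 (\<lambda>Q. u Q - v Q) P = E1 u P - E1 v P"
    "E2 (\<lambda>Q. u Q - v Q) P = E2 u P - E2 v P" "E3 (\<lambda>Q. u Q - v Q) P = E3 u P - E3 v P"
  using frechet_derivative_eq[OF has_derivative_diff[OF smooth_on_has_derivative[OF assms(1,3)]
      smooth_on_has_derivative[OF assms(2,3)]]]
  by (simp_all add: E_defs algebra_simps)

lemma E_mult:
  assumes "smooth_on psl_space u" "smooth_on psl_space v" "P \<in> psl_space"
  shows "E1 (\<lambda>Q. u Q * v Q) P = u P * E1 v P + E1 u P * v P"
    "E2 (\<lambda>Q. u Q * v Q) P = u P * E2 v P + E2 u P * v P"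
    "E3 (\<lambda>Q. u Q * v Q) P = u P * E3 v P + E3 u P * v P"
  using frechet_derivative_eq[OF has_derivative_mult[OF smooth_on_has_derivative[OF assms(1,3)]
      smooth_on_has_derivative[OF assms(2,3)]]]
  by (simp_all add: E_defs algebra_simps)

lemma E_scale:
  assumes "smooth_on psl_space u" "P \<in> psl_space"
  shows "E1 (\<lambda>Q. c * u Q) P = c * E1 u P" "E2 (\<lambda>Q. c * u Q) P = c * E2 u P"
    "E3 (\<lambda>Q. c * u Q) P = c * E3 u P"
  using frechet_derivative_eq[OF has_derivative_mult_right[OF smooth_on_has_derivative[OF assms], of c]]
  by (simp_all add: E_defs algebra_simps)

lemma E_sum_mult:
  assumes a: "smooth_on psl_space a" "smooth_on psl_space a'" and b: "smooth_on psl_space b" "smooth_on psl_space b'"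
    and c: "smooth_on psl_space c" "smooth_on psl_space c'" and P: "P \<in> psl_space"
  shows "E1 (\<lambda>Q. a Q * a' Q + b Q * b' Q + c Q * c' Q) P = a P * E1 a' P + E1 a P * a' P +
      (b P * E1 b' P + E1 b P * b' P) + (c P * E1 c' P + E1 c P * c' P)"
    "E2 (\<lambda>Q. a Q * a' Q + b Q * b' Q + c Q * c' Q) P = a P * E2 a' P + E2 a P * a' P +
      (b P * E2 b' P + E2 b P * b' P) + (c P * E2 c' P + E2 c P * c' P)"
    "E3 (\<lambda>Q. a Q * a' Q + b Q * b' Q + c Q * c' Q) P = a P * E3 a' P + E3 a P * a' P +
      (b P * E3 b' P + E3 b P * b' P) + (c P * E3 c' P + E3 c P * c' P)"
proof -
  note m = smooth_on_mult[OF open_psl_space a] smooth_on_mult[OF open_psl_space b]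
    smooth_on_mult[OF open_psl_space c]
  note sm = smooth_on_add[OF open_psl_space m(1,2)]
  show "E1 (\<lambda>Q. a Q * a' Q + b Q * b' Q + c Q * c' Q) P = a P * E1 a' P + E1 a P * a' P +
      (b P * E1 b' P + E1 b P * b' P) + (c P * E1 c' P + E1 c P * c' P)"
    "E2 (\<lambda>Q. a Q * a' Q + b Q * b' Q + c Q * c' Q) P = a P * E2 a' P + E2 a P * a' P +
      (b P * E2 b' P + E2 b P * b' P) + (c P * E2 c' P + E2 c P * c' P)"
    "E3 (\<lambda>Q. a Q * a' Q + b Q * b' Q + c Q * c' Q) P = a P * E3 a' P + E3 a P * a' P +
      (b P * E3 b' P + E3 b P * b' P) + (c P * E3 c' P + E3 c P * c' P)"
    unfolding E_add[OF sm m(3) P] E_add[OF m(1,2) P] E_mult[OF a P] E_mult[OF b P] E_mult[OF c P]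
    by (rule refl)+
qed

text \<open>The only nonconstant coefficient of the frame is \<open>y\<close>, and only
  \<open>E2\<close> differentiates it. The commutator of \<open>E1\<close> and \<open>E2\<close> is
  therefore \<open>- y \<partial>\<^sub>x\<close>, which is \<open>- E1 - E3\<close>; the other
  commutators vanish.\<close>

lemma E_commute:
  assumes u: "smooth_on psl_space u" and P: "P \<in> psl_space"
  shows "E1 (E2 u) P = E2 (E1 u) P - E1 u P - E3 u P" "E1 (E3 u) P = E3 (E1 u) P"
    "E2 (E3 u) P = E3 (E2 u) P"
proof -
  define D where "D v = (\<lambda>Q. frechet_derivative u (at Q) v)" for v
  define D2 where "D2 v w = frechet_derivative (D v) (at P) w" for v w
  have hd: "(D v has_derivative D2 v) (at P)" for v
    using smooth_on_has_derivative[OF smooth_on_frechet_derivative[OF u] P, of v]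
    by (simp add: D_def D2_def[abs_def])
  have hy: "((\<lambda>Q. fst (snd Q)) has_derivative (\<lambda>V. fst (snd V))) (at P)"
    for P :: "real \<times> real \<times> real"
    by (auto intro!: derivative_eq_intros)
  have sym: "D2 v w = D2 w v" for v w
    unfolding D2_def D_def by (rule mixed_derivatives_commute[OF open_psl_space u P])
  have E: "E1 u = (\<lambda>Q. fst (snd Q) * D (1, 0, 0) Q - D (0, 0, 1) Q)"
    "E2 u = (\<lambda>Q. fst (snd Q) * D (0, 1, 0) Q)" "E3 u = D (0, 0, 1)"
    by (simp_all add: E_defs D_def)
  have F1: "frechet_derivative (E1 u) (at P) =
      (\<lambda>V. fst (snd P) * D2 (1, 0, 0) V + fst (snd V) * D (1, 0, 0) P - D2 (0, 0, 1) V)"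
    unfolding E by (intro frechet_derivative_eq has_derivative_diff has_derivative_mult hy hd)
  have F2: "frechet_derivative (E2 u) (at P) =
      (\<lambda>V. fst (snd P) * D2 (0, 1, 0) V + fst (snd V) * D (0, 1, 0) P)"
    unfolding E by (intro frechet_derivative_eq has_derivative_mult hy hd)
  have F3: "frechet_derivative (E3 u) (at P) = D2 (0, 0, 1)"
    unfolding E by (intro frechet_derivative_eq hd)
  have L: "E1 h P = fst (snd P) * frechet_derivative h (at P) (1, 0, 0) - frechet_derivative h (at P) (0, 0, 1)"
    "E2 h P = fst (snd P) * frechet_derivative h (at P) (0, 1, 0)"
    "E3 h P = frechet_derivative h (at P) (0, 0, 1)" for h
    by (simp_all add: E_defs)
  show "E1 (E2 u) P = E2 (E1 u) P - E1 u P - E3 u P"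
    unfolding L(1)[of "E2 u"] L(2)[of "E1 u"] F1 F2 unfolding E
    using sym[of "(1, 0, 0)" "(0, 1, 0)"] sym[of "(0, 0, 1)" "(0, 1, 0)"] by (simp add: algebra_simps)
  show "E1 (E3 u) P = E3 (E1 u) P"
    unfolding L(1)[of "E3 u"] L(3)[of "E1 u"] F1 F3
    using sym[of "(1, 0, 0)" "(0, 0, 1)"] by (simp add: algebra_simps)
  show "E2 (E3 u) P = E3 (E2 u) P"
    unfolding L(2)[of "E3 u"] L(3)[of "E2 u"] F2 F3
    using sym[of "(0, 1, 0)" "(0, 0, 1)"] by (simp add: algebra_simps)
qed

definition grad_prod where
  "grad_prod u v = (\<lambda>P. E1 u P * E1 v P + E2 u P * E2 v P + E3 u P * E3 v P)"

text \<open>The first-order term arises because the covariant derivative of \<open>E1\<close> along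
  itself is \<open>E2\<close>, while those of \<open>E2\<close> and \<open>E3\<close> along
  themselves vanish.\<close>

definition laplacian where
  "laplacian u = (\<lambda>P. E1 (E1 u) P + E2 (E2 u) P + E3 (E3 u) P - E2 u P)"

text \<open>The Hessian \<open>E\<^sub>i E\<^sub>j u - (\<nabla>\<^bsub>E\<^sub>i\<^esub> E\<^sub>j) u\<close> in this frame, with the Levi-Civita connection computed from
  \<open>[E1, E2] = - E1 - E3\<close> by Koszul's formula.\<close>

definition hessian :: "(real \<times> real \<times> real \<Rightarrow> real) \<Rightarrow> real \<times> real \<times> real \<Rightarrow> real^3^3" where
  "hessian u P = vector [
     vector [E1 (E1 u) P - E2 u P, E2 (E1 u) P - E3 u P / 2, E1 (E3 u) P - E2 u P / 2],
     vector [E2 (E1 u) P - E3 u P / 2, E2 (E2 u) P, E2 (E3 u) P + E1 u P / 2],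
     vector [E1 (E3 u) P - E2 u P / 2, E2 (E3 u) P + E1 u P / 2, E3 (E3 u) P]]"

lemma smooth_on_grad_prod:
  "smooth_on psl_space u \<Longrightarrow> smooth_on psl_space v \<Longrightarrow> smooth_on psl_space (grad_prod u v)"
  unfolding grad_prod_def by (intro smooth_intros open_psl_space smooth_on_E)

lemma smooth_on_laplacian: "smooth_on psl_space u \<Longrightarrow> smooth_on psl_space (laplacian u)"
  unfolding laplacian_def by (intro smooth_intros open_psl_space smooth_on_E)

lemma E_grad_prod:
  assumes u: "smooth_on psl_space u" and v: "smooth_on psl_space v" and P: "P \<in> psl_space"
  shows "E1 (grad_prod u v) P = E1 u P * E1 (E1 v) P + E1 (E1 u) P * E1 v P +
      (E2 u P * E1 (E2 v) P + E1 (E2 u) P * E2 v P) + (E3 u P * E1 (E3 v) P + E1 (E3 u) P * E3 v P)"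
    "E2 (grad_prod u v) P = E1 u P * E2 (E1 v) P + E2 (E1 u) P * E1 v P +
      (E2 u P * E2 (E2 v) P + E2 (E2 u) P * E2 v P) + (E3 u P * E2 (E3 v) P + E2 (E3 u) P * E3 v P)"
    "E3 (grad_prod u v) P = E1 u P * E3 (E1 v) P + E3 (E1 u) P * E1 v P +
      (E2 u P * E3 (E2 v) P + E3 (E2 u) P * E2 v P) + (E3 u P * E3 (E3 v) P + E3 (E3 u) P * E3 v P)"
  unfolding grad_prod_def
  by (rule E_sum_mult[OF smooth_on_E(1)[OF u] smooth_on_E(1)[OF v] smooth_on_E(2)[OF u]
        smooth_on_E(2)[OF v] smooth_on_E(3)[OF u] smooth_on_E(3)[OF v] P])+

text \<open>Taking components in an orthonormal frame turns the metric into the Euclidean inner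
  product, so that matrix algebra in \<open>real^3\<close> applies.\<close>

definition gradient :: "(real \<times> real \<times> real \<Rightarrow> real) \<Rightarrow> real \<times> real \<times> real \<Rightarrow> real^3" where
  "gradient u P = vector [E1 u P, E2 u P, E3 u P]"

lemma grad_prod_eq: "grad_prod u v P = gradient u P \<bullet> gradient v P"
  by (simp add: grad_prod_def gradient_def inner_vec_def sum_3)

text \<open>The right-hand side is invariant under isometries, because \<^const>\<open>grad_prod\<close> is.\<close>

lemma hessian_eq:
  assumes u: "smooth_on psl_space u" and v: "smooth_on psl_space v" and w: "smooth_on psl_space w"
    and P: "P \<in> psl_space"
  shows "2 * (gradient v P \<bullet> (hessian u P *v gradient w P)) =
    grad_prod v (grad_prod u w) P + grad_prod w (grad_prod u v) P - grad_prod u (grad_prod v w) P"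
proof -
  note C = E_commute[OF u P] E_commute[OF v P] E_commute[OF w P]
  have L: "2 * (gradient v P \<bullet> (hessian u P *v gradient w P)) =
    2 * (E1 v P * ((E1 (E1 u) P - E2 u P) * E1 w P + (E2 (E1 u) P - E3 u P / 2) * E2 w P +
        (E1 (E3 u) P - E2 u P / 2) * E3 w P) +
     E2 v P * ((E2 (E1 u) P - E3 u P / 2) * E1 w P + E2 (E2 u) P * E2 w P +
        (E2 (E3 u) P + E1 u P / 2) * E3 w P) +
     E3 v P * ((E1 (E3 u) P - E2 u P / 2) * E1 w P + (E2 (E3 u) P + E1 u P / 2) * E2 w P +
        E3 (E3 u) P * E3 w P))"
    by (simp add: gradient_def hessian_def inner_vec_def sum_3 matrix_vector_mult_def)
  show ?thesis
    unfolding L grad_prod_def[of v "grad_prod u w"] grad_prod_def[of w "grad_prod u v"]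
      grad_prod_def[of u "grad_prod v w"] E_grad_prod[OF u w P] E_grad_prod[OF u v P]
      E_grad_prod[OF v w P] C
    by (simp add: algebra_simps)
qed

lemma laplacian_eq_trace: "laplacian u P = trace (hessian u P)"
  by (simp add: laplacian_def hessian_def trace_def sum_3)

text \<open>The right-hand side is the Ricci curvature of the gradient of \<open>u\<close>.\<close>

lemma bochner:
  assumes u: "smooth_on psl_space u" and P: "P \<in> psl_space"
  shows "laplacian (grad_prod u u) P / 2 - grad_prod u (laplacian u) P
      - trace (hessian u P ** transpose (hessian u P)) =
    - 3 / 2 * grad_prod u u P + 2 * (E3 u P)\<^sup>2"
proof -
  note u' = smooth_on_E[OF u]
  note u1 = smooth_on_E[OF u'(1)] and u2 = smooth_on_E[OF u'(2)] and u3 = smooth_on_E[OF u'(3)]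
  have comm: "\<And>Q. Q \<in> psl_space \<Longrightarrow> E2 (E1 u) Q = E1 (E2 u) Q + E1 u Q + E3 u Q"
    "\<And>Q. Q \<in> psl_space \<Longrightarrow> E1 (E2 u) Q = E2 (E1 u) Q - E1 u Q - E3 u Q"
    "\<And>Q. Q \<in> psl_space \<Longrightarrow> E1 (E3 u) Q = E3 (E1 u) Q"
    "\<And>Q. Q \<in> psl_space \<Longrightarrow> E2 (E3 u) Q = E3 (E2 u) Q"
    using E_commute[OF u] by simp_all
  have S: "smooth_on psl_space (\<lambda>Q. E2 (E1 u) Q - E1 u Q)"
    "smooth_on psl_space (\<lambda>Q. E2 (E1 u) Q - E1 u Q - E3 u Q)"
    "smooth_on psl_space (\<lambda>Q. E1 (E2 u) Q + E1 u Q)"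
    "smooth_on psl_space (\<lambda>Q. E1 (E2 u) Q + E1 u Q + E3 u Q)"
    by (intro smooth_intros open_psl_space u' u1 u2)+
  \<comment> \<open>The third derivatives in the gradient of the Laplacian are brought into the
    order \<open>E_i (E_i (E_j u))\<close> in which they occur in the Laplacian of
    \<open>grad_prod u u\<close>. They then cancel, leaving the lower-order terms produced by the
    commutators.\<close>
  have "E2 (E1 (E2 u)) P = E2 (E2 (E1 u)) P - E2 (E1 u) P - E2 (E3 u) P"
    using E_cong(2)[OF S(2) comm(2) P] E_diff(2)[OF S(1) u'(3) P] E_diff(2)[OF u1(2) u'(1) P] by simp
  then have T122: "E1 (E2 (E2 u)) P = E2 (E2 (E1 u)) P - E2 (E1 u) P - E2 (E3 u) P - E1 (E2 u) P - E3 (E2 u) P"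
    using E_commute(1)[OF u'(2) P] by simp
  have "E1 (E2 (E1 u)) P = E1 (E1 (E2 u)) P + E1 (E1 u) P + E1 (E3 u) P"
    using E_cong(1)[OF S(4) comm(1) P] E_add(1)[OF S(3) u'(3) P] E_add(1)[OF u2(1) u'(1) P] by simp
  then have T211: "E2 (E1 (E1 u)) P = E1 (E1 (E2 u)) P + E1 (E1 u) P + E1 (E3 u) P + E1 (E1 u) P + E3 (E1 u) P"
    using E_commute(1)[OF u'(1) P] by simp
  have T133: "E1 (E3 (E3 u)) P = E3 (E3 (E1 u)) P"
    using E_commute(2)[OF u'(3) P] E_cong(3)[OF u1(3) comm(3) P] by simp
  have T233: "E2 (E3 (E3 u)) P = E3 (E3 (E2 u)) P"
    using E_commute(3)[OF u'(3) P] E_cong(3)[OF u2(3) comm(4) P] by simp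
  have T311: "E3 (E1 (E1 u)) P = E1 (E1 (E3 u)) P"
    using E_commute(2)[OF u'(1) P] E_cong(1)[OF u1(3) comm(3) P] by simp
  have T322: "E3 (E2 (E2 u)) P = E2 (E2 (E3 u)) P"
    using E_commute(3)[OF u'(2) P] E_cong(2)[OF u2(3) comm(4) P] by simp
  note T = T122 T211 T133 T233 T311 T322
  note A = smooth_on_add[OF open_psl_space u1(1) u2(2)]
  note B = smooth_on_add[OF open_psl_space A u3(3)]
  have L: "E1 (laplacian u) P = E1 (E1 (E1 u)) P + E1 (E2 (E2 u)) P + E1 (E3 (E3 u)) P - E1 (E2 u) P"
    "E2 (laplacian u) P = E2 (E1 (E1 u)) P + E2 (E2 (E2 u)) P + E2 (E3 (E3 u)) P - E2 (E2 u) P"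
    "E3 (laplacian u) P = E3 (E1 (E1 u)) P + E3 (E2 (E2 u)) P + E3 (E3 (E3 u)) P - E3 (E2 u) P"
    unfolding laplacian_def E_diff[OF B u'(2) P] E_add[OF A u3(3) P] E_add[OF u1(1) u2(2) P]
    by (rule refl)+
  have half: "laplacian (grad_prod u u) P = 2 * (
     (E1 (E1 u) P)\<^sup>2 + E1 u P * E1 (E1 (E1 u)) P + (E1 (E2 u) P)\<^sup>2 + E2 u P * E1 (E1 (E2 u)) P +
     (E1 (E3 u) P)\<^sup>2 + E3 u P * E1 (E1 (E3 u)) P +
     (E2 (E1 u) P)\<^sup>2 + E1 u P * E2 (E2 (E1 u)) P + (E2 (E2 u) P)\<^sup>2 + E2 u P * E2 (E2 (E2 u)) P +
     (E2 (E3 u) P)\<^sup>2 + E3 u P * E2 (E2 (E3 u)) P +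
     (E3 (E1 u) P)\<^sup>2 + E1 u P * E3 (E3 (E1 u)) P + (E3 (E2 u) P)\<^sup>2 + E2 u P * E3 (E3 (E2 u)) P +
     (E3 (E3 u) P)\<^sup>2 + E3 u P * E3 (E3 (E3 u)) P
     - (E1 u P * E2 (E1 u) P + E2 u P * E2 (E2 u) P + E3 u P * E2 (E3 u) P))"
  proof -
    have G1: "E1 (E1 (grad_prod u u)) P = 2 * ((E1 (E1 u) P)\<^sup>2 + E1 u P * E1 (E1 (E1 u)) P +
       (E1 (E2 u) P)\<^sup>2 + E2 u P * E1 (E1 (E2 u)) P + (E1 (E3 u) P)\<^sup>2 + E3 u P * E1 (E1 (E3 u)) P)"
    proof -
      let ?g = "\<lambda>Q. E1 u Q * E1 (E1 u) Q + E2 u Q * E1 (E2 u) Q + E3 u Q * E1 (E3 u) Q"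
      have g: "smooth_on psl_space ?g" by (intro smooth_intros open_psl_space u' u1 u2 u3)
      have "smooth_on psl_space (\<lambda>Q. 2 * ?g Q)"
        by (rule smooth_on_mult[OF open_psl_space smooth_on_const[OF open_psl_space] g])
      then have "E1 (E1 (grad_prod u u)) P = E1 (\<lambda>Q. 2 * ?g Q) P"
        by (rule E_cong(1)[OF _ _ P]) (simp add: E_grad_prod(1)[OF u u])
      also have "\<dots> = 2 * E1 ?g P" by (rule E_scale(1)[OF g P])
      finally show ?thesis
        unfolding E_sum_mult(1)[OF u'(1) u1(1) u'(2) u2(1) u'(3) u3(1) P]
        by (simp add: power2_eq_square)
    qed
    have G2: "E2 (E2 (grad_prod u u)) P = 2 * ((E2 (E1 u) P)\<^sup>2 + E1 u P * E2 (E2 (E1 u)) P +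
       (E2 (E2 u) P)\<^sup>2 + E2 u P * E2 (E2 (E2 u)) P + (E2 (E3 u) P)\<^sup>2 + E3 u P * E2 (E2 (E3 u)) P)"
    proof -
      let ?g = "\<lambda>Q. E1 u Q * E2 (E1 u) Q + E2 u Q * E2 (E2 u) Q + E3 u Q * E2 (E3 u) Q"
      have g: "smooth_on psl_space ?g" by (intro smooth_intros open_psl_space u' u1 u2 u3)
      have "smooth_on psl_space (\<lambda>Q. 2 * ?g Q)"
        by (rule smooth_on_mult[OF open_psl_space smooth_on_const[OF open_psl_space] g])
      then have "E2 (E2 (grad_prod u u)) P = E2 (\<lambda>Q. 2 * ?g Q) P"
        by (rule E_cong(2)[OF _ _ P]) (simp add: E_grad_prod(2)[OF u u])
      also have "\<dots> = 2 * E2 ?g P" by (rule E_scale(2)[OF g P])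
      finally show ?thesis
        unfolding E_sum_mult(2)[OF u'(1) u1(2) u'(2) u2(2) u'(3) u3(2) P]
        by (simp add: power2_eq_square)
    qed
    have G3: "E3 (E3 (grad_prod u u)) P = 2 * ((E3 (E1 u) P)\<^sup>2 + E1 u P * E3 (E3 (E1 u)) P +
       (E3 (E2 u) P)\<^sup>2 + E2 u P * E3 (E3 (E2 u)) P + (E3 (E3 u) P)\<^sup>2 + E3 u P * E3 (E3 (E3 u)) P)"
    proof -
      let ?g = "\<lambda>Q. E1 u Q * E3 (E1 u) Q + E2 u Q * E3 (E2 u) Q + E3 u Q * E3 (E3 u) Q"
      have g: "smooth_on psl_space ?g" by (intro smooth_intros open_psl_space u' u1 u2 u3)
      have "smooth_on psl_space (\<lambda>Q. 2 * ?g Q)"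
        by (rule smooth_on_mult[OF open_psl_space smooth_on_const[OF open_psl_space] g])
      then have "E3 (E3 (grad_prod u u)) P = E3 (\<lambda>Q. 2 * ?g Q) P"
        by (rule E_cong(3)[OF _ _ P]) (simp add: E_grad_prod(3)[OF u u])
      also have "\<dots> = 2 * E3 ?g P" by (rule E_scale(3)[OF g P])
      finally show ?thesis
        unfolding E_sum_mult(3)[OF u'(1) u1(3) u'(2) u2(3) u'(3) u3(3) P]
        by (simp add: power2_eq_square)
    qed
    show ?thesis
      unfolding laplacian_def G1 G2 G3 E_grad_prod(2)[OF u u P] by (simp add: algebra_simps)
  qed
  have tr: "trace (hessian u P ** transpose (hessian u P)) =
      (E1 (E1 u) P - E2 u P)\<^sup>2 + (E2 (E2 u) P)\<^sup>2 + (E3 (E3 u) P)\<^sup>2 +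
      2 * ((E2 (E1 u) P - E3 u P / 2)\<^sup>2 + (E1 (E3 u) P - E2 u P / 2)\<^sup>2 + (E2 (E3 u) P + E1 u P / 2)\<^sup>2)"
    by (simp add: trace_def hessian_def matrix_matrix_mult_def transpose_def sum_3 power2_eq_square)
  show ?thesis
    unfolding half tr grad_prod_def[of u "laplacian u"] L T unfolding grad_prod_def comm(2-4)[OF P]
    by (simp add: power2_eq_square field_simps)
qed


section \<open>Isometries preserve the fibers\<close>

text \<open>The vector with components \<open>c\<close> in the frame; \<open>- c $ 1\<close> stems
  from the summand \<open>- \<partial>\<^sub>z\<close> of \<open>E1\<close>.\<close>

definition frame_vec :: "real \<times> real \<times> real \<Rightarrow> real^3 \<Rightarrow> real \<times> real \<times> real" where
  "frame_vec P c = (fst (snd P) * c $ 1, fst (snd P) * c $ 2, c $ 3 - c $ 1)"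

text \<open>The inverse of \<open>frame_vec P\<close>; the third component is the form dx/y +
  dz.\<close>

definition frame_coord :: "real \<times> real \<times> real \<Rightarrow> real \<times> real \<times> real \<Rightarrow> real^3" where
  "frame_coord P V = vector [fst V / fst (snd P), fst (snd V) / fst (snd P),
     fst V / fst (snd P) + snd (snd V)]"

lemma linear_frame_vec: "linear (frame_vec P)"
  by (rule linearI) (auto simp: frame_vec_def algebra_simps)

lemma linear_frame_coord: "linear (frame_coord P)"
  by (rule linearI) (auto simp: frame_coord_def vec_eq_iff forall_3 add_divide_distrib algebra_simps)

lemma frame_vec_coord: "P \<in> psl_space \<Longrightarrow> frame_vec P (frame_coord P V) = V"
  by (cases P, cases V) (auto simp: frame_vec_def frame_coord_def mem_psl_space)

lemma psl_metric_frame_vec: "P \<in> psl_space \<Longrightarrow> psl_metric P (frame_vec P c) = c \<bullet> c"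
  by (cases P) (auto simp: frame_vec_def mem_psl_space psl_metric_eq inner_vec_def sum_3
      power2_eq_square field_simps)

lemma frechet_derivative_frame_vec:
  assumes "u differentiable (at P)"
  shows "frechet_derivative u (at P) (frame_vec P c) = gradient u P \<bullet> c"
proof -
  note lin = linear_frechet_derivative[OF assms]
  have "frame_vec P c = (fst (snd P) * c $ 1) *\<^sub>R (1, 0, 0) + (fst (snd P) * c $ 2) *\<^sub>R (0, 1, 0)
      + (c $ 3 - c $ 1) *\<^sub>R (0, 0, 1)"
    by (simp add: frame_vec_def)
  then have "frechet_derivative u (at P) (frame_vec P c) =
      (fst (snd P) * c $ 1) *\<^sub>R frechet_derivative u (at P) (1, 0, 0) +
      (fst (snd P) * c $ 2) *\<^sub>R frechet_derivative u (at P) (0, 1, 0) +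
      (c $ 3 - c $ 1) *\<^sub>R frechet_derivative u (at P) (0, 0, 1)"
    by (simp only: linear_add[OF lin] linear_scale[OF lin])
  then show ?thesis
    by (simp add: gradient_def E_defs inner_vec_def sum_3 algebra_simps)
qed

text \<open>\<open>A\<close> is the differential of \<open>F\<close> in the orthonormal frames at
  \<open>P\<close> and \<open>F P\<close>; gradients pull back by its transpose. One
  \<open>A\<close> serves all functions \<open>u\<close>, as is essential in
  \<open>hessian_isometry\<close>, where three functions are compared at once.\<close>

lemma gradient_isometry:
  assumes F: "riemannian_isometry psl_space psl_metric F" and P: "P \<in> psl_space"
  obtains A :: "real^3^3" where "orthogonal_matrix A"
    "\<And>u. smooth_on psl_space u \<Longrightarrow> gradient (\<lambda>Q. u (F Q)) P = transpose A *v gradient u (F P)"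
proof -
  note iso = riemannian_isometryD[OF F]
  have FP: "F P \<in> psl_space" using iso(5)[OF P] .
  define L where "L c = frame_coord (F P) (frechet_derivative F (at P) (frame_vec P c))" for c
  have L: "linear L" unfolding L_def
    by (rule linear_compose[OF linear_compose[OF linear_frame_vec
        linear_frechet_derivative[OF smooth_on_imp_differentiable[OF iso(2) P]]] linear_frame_coord,
        unfolded comp_def])
  have fL: "frame_vec (F P) (L c) = frechet_derivative F (at P) (frame_vec P c)" for c
    unfolding L_def by (rule frame_vec_coord[OF FP])
  have "L c \<bullet> L c = c \<bullet> c" for c
    using iso(6)[OF P, of "frame_vec P c"] unfolding fL[symmetric] psl_metric_frame_vec[OF FP]
      psl_metric_frame_vec[OF P] .
  then have "orthogonal_transformation L"
    using L unfolding orthogonal_transformation norm_eq_sqrt_inner by presburger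
  then have orth: "orthogonal_matrix (matrix L)"
    by (simp add: orthogonal_transformation_matrix)
  have "gradient (\<lambda>Q. u (F Q)) P = transpose (matrix L) *v gradient u (F P)"
    if u: "smooth_on psl_space u" for u
  proof -
    have uF: "smooth_on psl_space (\<lambda>Q. u (F Q))"
      by (rule smooth_on_compose[OF open_psl_space open_psl_space iso(4,2) u])
    have "gradient (\<lambda>Q. u (F Q)) P \<bullet> c = (transpose (matrix L) *v gradient u (F P)) \<bullet> c" for c
    proof -
      have "gradient (\<lambda>Q. u (F Q)) P \<bullet> c = frechet_derivative (\<lambda>Q. u (F Q)) (at P) (frame_vec P c)"
        by (rule frechet_derivative_frame_vec[OF smooth_on_imp_differentiable[OF uF P], symmetric])
      also have "\<dots> = frechet_derivative u (at (F P)) (frame_vec (F P) (L c))"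
        unfolding fL by (rule frechet_derivative_compose_smooth[OF iso(2) u P FP])
      also have "\<dots> = gradient u (F P) \<bullet> L c"
        by (rule frechet_derivative_frame_vec[OF smooth_on_imp_differentiable[OF u FP]])
      also have "L c = matrix L *v c" by (simp add: matrix_vector_mul(2)[OF L, THEN fun_cong])
      also have "gradient u (F P) \<bullet> (matrix L *v c) = (transpose (matrix L) *v gradient u (F P)) \<bullet> c"
        by (simp add: dot_lmul_matrix transpose_matrix_vector)
      finally show ?thesis .
    qed
    then show ?thesis using vector_eq_rdot by blast
  qed
  then show thesis using that[OF orth] by blast
qed

lemma grad_prod_isometry:
  assumes F: "riemannian_isometry psl_space psl_metric F" and P: "P \<in> psl_space"
    and u: "smooth_on psl_space u" and v: "smooth_on psl_space v"
  shows "grad_prod (\<lambda>Q. u (F Q)) (\<lambda>Q. v (F Q)) P = grad_prod u v (F P)"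
proof -
  obtain A :: "real^3^3" where A: "orthogonal_matrix A"
    "\<And>u. smooth_on psl_space u \<Longrightarrow> gradient (\<lambda>Q. u (F Q)) P = transpose A *v gradient u (F P)"
    using gradient_isometry[OF F P] by blast
  have "orthogonal_transformation ((*v) (transpose A))"
    using A(1) by (simp add: orthogonal_transformation_matrix orthogonal_matrix_transpose)
  then show ?thesis
    by (simp add: grad_prod_eq A(2)[OF u] A(2)[OF v] orthogonal_transformation_def)
qed

text \<open>It makes gradients sufficient as test vectors: a matrix is determined by the bilinear
  form it defines on them.\<close>

lemma gradient_surj:
  assumes "P \<in> psl_space"
  obtains v where "smooth_on psl_space v" "gradient v P = g"
proof -
  \<comment> \<open>The frame coordinates at the fixed point \<open>P\<close> are linear in
    \<open>V\<close>. Applied to points instead of tangent vectors, they form a linear function with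
    the required gradient at \<open>P\<close>.\<close>
  define L where "L V = frame_coord P V \<bullet> g" for V
  have "linear L" unfolding L_def
    by (rule linearI) (simp_all only: linear_add[OF linear_frame_coord] linear_scale[OF linear_frame_coord]
        inner_add_left inner_scaleR_left real_scaleR_def)
  then have bl: "bounded_linear L" by (simp add: linear_conv_bounded_linear)
  have "smooth_on psl_space L" by (rule smooth_on_linear[OF open_psl_space bl])
  moreover have "gradient L P = g"
  proof -
    have "frechet_derivative L (at P) = L"
      by (rule frechet_derivative_eq[OF bounded_linear_imp_has_derivative[OF bl]])
    moreover obtain x y z where "P = (x, y, z)" "y > 0" using psl_spaceE[OF assms] .
    ultimately show ?thesis
      by (simp add: gradient_def E_defs L_def frame_coord_def inner_vec_def sum_3 vec_eq_iff forall_3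
          distrib_left)
  qed
  ultimately show thesis using that by blast
qed

lemma grad_prod_cong:
  assumes "smooth_on psl_space v" "\<And>Q. Q \<in> psl_space \<Longrightarrow> v' Q = v Q" "P \<in> psl_space"
  shows "grad_prod u v' P = grad_prod u v P"
  by (simp add: grad_prod_def E_cong[OF assms])

lemma laplacian_cong:
  assumes v: "smooth_on psl_space v" and eq: "\<And>Q. Q \<in> psl_space \<Longrightarrow> v' Q = v Q" and P: "P \<in> psl_space"
  shows "laplacian v' P = laplacian v P"
  using E_cong(1)[OF smooth_on_E(1)[OF v] E_cong(1)[OF v eq] P]
    E_cong(2)[OF smooth_on_E(2)[OF v] E_cong(2)[OF v eq] P]
    E_cong(3)[OF smooth_on_E(3)[OF v] E_cong(3)[OF v eq] P] E_cong(2)[OF v eq P]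
  by (simp add: laplacian_def)

text \<open>By \<open>hessian_eq\<close> the Hessian, evaluated on gradients, consists of iterated
  gradient products, which \<open>F\<close> preserves; \<open>gradient_surj\<close> turns this into
  an equality of matrices.\<close>

lemma hessian_isometry:
  assumes F: "riemannian_isometry psl_space psl_metric F" and P: "P \<in> psl_space"
    and u: "smooth_on psl_space u"
  obtains A :: "real^3^3" where "orthogonal_matrix A"
    "hessian u (F P) = A ** hessian (\<lambda>Q. u (F Q)) P ** transpose A"
proof -
  note iso = riemannian_isometryD[OF F]
  have FP: "F P \<in> psl_space" using iso(5)[OF P] .
  have comp: "smooth_on psl_space (\<lambda>Q. h (F Q))" if "smooth_on psl_space h" for h :: "_ \<Rightarrow> real"
    by (rule smooth_on_compose[OF open_psl_space open_psl_space iso(4,2) that])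
  obtain A :: "real^3^3" where A: "orthogonal_matrix A"
    "\<And>u. smooth_on psl_space u \<Longrightarrow> gradient (\<lambda>Q. u (F Q)) P = transpose A *v gradient u (F P)"
    using gradient_isometry[OF F P] by blast
  let ?H = "hessian (\<lambda>Q. u (F Q)) P"
  \<comment> \<open>The inner product is itself differentiated, so its invariance is used on all of
    \<open>psl_space\<close>; the invariance of the outer product is then used at
    \<open>P\<close>.\<close>
  have gp: "grad_prod (\<lambda>Q. h1 (F Q)) (grad_prod (\<lambda>Q. h2 (F Q)) (\<lambda>Q. h3 (F Q))) P =
      grad_prod h1 (grad_prod h2 h3) (F P)"
    if h: "smooth_on psl_space h1" "smooth_on psl_space h2" "smooth_on psl_space h3" for h1 h2 h3
  proof -
    note h23 = smooth_on_grad_prod[OF h(2,3)]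
    have "grad_prod (\<lambda>Q. h1 (F Q)) (grad_prod (\<lambda>Q. h2 (F Q)) (\<lambda>Q. h3 (F Q))) P =
        grad_prod (\<lambda>Q. h1 (F Q)) (\<lambda>Q. grad_prod h2 h3 (F Q)) P"
      by (rule grad_prod_cong[OF comp[OF h23] grad_prod_isometry[OF F _ h(2,3)] P])
    also have "\<dots> = grad_prod h1 (grad_prod h2 h3) (F P)"
      by (rule grad_prod_isometry[OF F P h(1) h23])
    finally show ?thesis .
  qed
  have "g \<bullet> (hessian u (F P) *v g') = g \<bullet> ((A ** ?H ** transpose A) *v g')" for g g'
  proof -
    obtain v where v: "smooth_on psl_space v" "gradient v (F P) = g" using gradient_surj[OF FP] .
    obtain w where w: "smooth_on psl_space w" "gradient w (F P) = g'" using gradient_surj[OF FP] .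
    have "2 * (gradient (\<lambda>Q. v (F Q)) P \<bullet> (?H *v gradient (\<lambda>Q. w (F Q)) P)) =
        2 * (gradient v (F P) \<bullet> (hessian u (F P) *v gradient w (F P)))"
      unfolding hessian_eq[OF comp[OF u] comp[OF v(1)] comp[OF w(1)] P] hessian_eq[OF u v(1) w(1) FP]
        gp[OF v(1) u w(1)] gp[OF w(1) u v(1)] gp[OF u v(1) w(1)] ..
    then have "(transpose A *v g) \<bullet> (?H *v (transpose A *v g')) = g \<bullet> (hessian u (F P) *v g')"
      unfolding A(2)[OF v(1)] A(2)[OF w(1)] v(2) w(2) by simp
    moreover have "(transpose A *v g) \<bullet> (?H *v (transpose A *v g')) =
        g \<bullet> (A *v (?H *v (transpose A *v g')))"
      by (simp add: transpose_matrix_vector dot_lmul_matrix)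
    ultimately show ?thesis by (simp only: matrix_vector_mul_assoc matrix_mul_assoc)
  qed
  then have "hessian u (F P) *v g' = (A ** ?H ** transpose A) *v g'" for g'
    using vector_eq_ldot by blast
  then have "hessian u (F P) = A ** ?H ** transpose A" by (simp add: matrix_eq)
  then show thesis using that[OF A(1)] by blast
qed

text \<open>Conjugation by an orthogonal matrix changes neither the trace nor the Frobenius
  norm.\<close>

lemma hessian_invariants:
  assumes F: "riemannian_isometry psl_space psl_metric F" and P: "P \<in> psl_space"
    and u: "smooth_on psl_space u"
  shows "laplacian (\<lambda>Q. u (F Q)) P = laplacian u (F P)"
    and "trace (hessian (\<lambda>Q. u (F Q)) P ** transpose (hessian (\<lambda>Q. u (F Q)) P)) =
      trace (hessian u (F P) ** transpose (hessian u (F P)))"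
proof -
  let ?H = "hessian (\<lambda>Q. u (F Q)) P"
  obtain A :: "real^3^3" where A: "orthogonal_matrix A" "hessian u (F P) = A ** ?H ** transpose A"
    using hessian_isometry[OF F P u] .
  have I: "transpose A ** A = mat 1" using A(1) by (simp add: orthogonal_matrix)
  have conj: "trace (A ** M ** transpose A) = trace M" for M :: "real^3^3"
  proof -
    have "trace (A ** M ** transpose A) = trace (transpose A ** (A ** M))" by (rule trace_mul_sym)
    also have "\<dots> = trace M" by (simp add: matrix_mul_assoc I)
    finally show ?thesis .
  qed
  show "laplacian (\<lambda>Q. u (F Q)) P = laplacian u (F P)"
    unfolding laplacian_eq_trace A(2) conj ..
  have "hessian u (F P) ** transpose (hessian u (F P)) =
      A ** (?H ** (transpose A ** A) ** transpose ?H) ** transpose A"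
    unfolding A(2) by (simp add: matrix_transpose_mul matrix_mul_assoc)
  then show "trace (?H ** transpose ?H) = trace (hessian u (F P) ** transpose (hessian u (F P)))"
    unfolding I by (simp add: conj)
qed

text \<open>Compare \<open>bochner\<close> for \<open>u\<close> at \<open>F P\<close> with
  \<open>bochner\<close> for the composite of \<open>u\<close> and \<open>F\<close> at
  \<open>P\<close>: all other terms agree. The coefficient 2 of the remaining one is the gap between
  the Ricci eigenvalues 1/2 and -3/2, so one can divide by it.\<close>

lemma isometry_vertical_derivative:
  assumes F: "riemannian_isometry psl_space psl_metric F" and P: "P \<in> psl_space"
    and u: "smooth_on psl_space u"
  shows "(E3 (\<lambda>Q. u (F Q)) P)\<^sup>2 = (E3 u (F P))\<^sup>2"
proof -
  note iso = riemannian_isometryD[OF F]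
  have FP: "F P \<in> psl_space" using iso(5)[OF P] .
  have comp: "smooth_on psl_space (\<lambda>Q. h (F Q))" if "smooth_on psl_space h" for h :: "_ \<Rightarrow> real"
    by (rule smooth_on_compose[OF open_psl_space open_psl_space iso(4,2) that])
  let ?uF = "\<lambda>Q. u (F Q)"
  have "laplacian (grad_prod ?uF ?uF) P = laplacian (\<lambda>Q. grad_prod u u (F Q)) P"
    by (rule laplacian_cong[OF comp[OF smooth_on_grad_prod[OF u u]] grad_prod_isometry[OF F _ u u] P])
  also have "\<dots> = laplacian (grad_prod u u) (F P)"
    by (rule hessian_invariants(1)[OF F P smooth_on_grad_prod[OF u u]])
  finally have 1: "laplacian (grad_prod ?uF ?uF) P = laplacian (grad_prod u u) (F P)" .
  have "grad_prod ?uF (laplacian ?uF) P = grad_prod ?uF (\<lambda>Q. laplacian u (F Q)) P"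
    by (rule grad_prod_cong[OF comp[OF smooth_on_laplacian[OF u]] hessian_invariants(1)[OF F _ u] P])
  also have "\<dots> = grad_prod u (laplacian u) (F P)"
    by (rule grad_prod_isometry[OF F P u smooth_on_laplacian[OF u]])
  finally have 2: "grad_prod ?uF (laplacian ?uF) P = grad_prod u (laplacian u) (F P)" .
  show ?thesis
    using bochner[OF comp[OF u] P] bochner[OF u FP] hessian_invariants(2)[OF F P u]
      grad_prod_isometry[OF F P u u] 1 2 by simp
qed

lemma isometry_fiber_direction:
  assumes F: "riemannian_isometry psl_space psl_metric F" and P: "P \<in> psl_space"
  obtains \<sigma> where "frechet_derivative F (at P) (0, 0, 1) = (0, 0, \<sigma>)" "\<sigma> * \<sigma> = 1"
proof -
  note iso = riemannian_isometryD[OF F]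
  \<comment> \<open>The test functions are linear: the coordinates \<open>x\<close> and
    \<open>y\<close> have vertical derivative 0, and \<open>z\<close> has vertical derivative
    1.\<close>
  have L: "(L (frechet_derivative F (at P) (0, 0, 1)))\<^sup>2 = (L (0, 0, 1))\<^sup>2" if "bounded_linear L"
    for L :: "real \<times> real \<times> real \<Rightarrow> real"
  proof -
    have "E3 (\<lambda>Q. L (F Q)) P = L (frechet_derivative F (at P) (0, 0, 1))"
      unfolding E3_def
      using frechet_derivative_eq[OF bounded_linear.has_derivative[OF that smooth_on_has_derivative[OF iso(2) P]]]
      by simp
    moreover have "E3 L Q = L (0, 0, 1)" for Q
      unfolding E3_def using frechet_derivative_eq[OF bounded_linear_imp_has_derivative[OF that]] by simp
    ultimately show ?thesis
      using isometry_vertical_derivative[OF F P smooth_on_linear[OF open_psl_space that]] by simp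
  qed
  obtain a b c where abc: "frechet_derivative F (at P) (0, 0, 1) = (a, b, c)" by (metis prod_cases3)
  have "a = 0" using L[OF bounded_linear_fst] by (simp add: abc)
  moreover have "b = 0"
    using L[OF bounded_linear_compose[OF bounded_linear_fst bounded_linear_snd]] by (simp add: abc)
  moreover have "c * c = 1"
    using L[OF bounded_linear_compose[OF bounded_linear_snd bounded_linear_snd]]
    by (simp add: abc power2_eq_square)
  ultimately show thesis using that abc by simp
qed


section \<open>The isometry induced on the hyperbolic plane\<close>

lemma isometry_base_const:
  assumes F: "riemannian_isometry psl_space psl_metric F" and y: "y > 0"
  shows "fst (F (x, y, z)) = fst (F (x, y, z'))" "fst (snd (F (x, y, z))) = fst (snd (F (x, y, z')))"
proof -
  note iso = riemannian_isometryD[OF F]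
  have *: "L (F (x, y, z)) = L (F (x, y, z'))"
    if L: "bounded_linear L" "\<And>s. L (0, 0, s) = 0" for L :: "real \<times> real \<times> real \<Rightarrow> real"
  proof -
    have "((\<lambda>t. L (F ((x, y, 0) + t *\<^sub>R (0, 0, 1)))) has_real_derivative 0) (at s)" for s
    proof -
      have P: "(x, y, 0) + s *\<^sub>R (0, 0, 1) \<in> psl_space" using y by (simp add: mem_psl_space)
      have hd: "((\<lambda>Q. L (F Q)) has_derivative (\<lambda>V. L (frechet_derivative F (at ((x, y, 0) + s *\<^sub>R (0, 0, 1))) V)))
          (at ((x, y, 0) + s *\<^sub>R (0, 0, 1)))"
        by (rule bounded_linear.has_derivative[OF L(1) smooth_on_has_derivative[OF iso(2) P]])
      obtain \<sigma> where "frechet_derivative F (at ((x, y, 0) + s *\<^sub>R (0, 0, 1))) (0, 0, 1) = (0, 0, \<sigma>)"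
        using isometry_fiber_direction[OF F P] .
      then have "frechet_derivative (\<lambda>Q. L (F Q)) (at ((x, y, 0) + s *\<^sub>R (0, 0, 1))) (0, 0, 1) = 0"
        using frechet_derivative_eq[OF hd] L(2) by simp
      then show ?thesis
        using has_real_derivative_along_line[OF differentiableI[OF hd]] by simp
    qed
    then have "L (F ((x, y, 0) + z *\<^sub>R (0, 0, 1))) = L (F ((x, y, 0) + z' *\<^sub>R (0, 0, 1)))"
      by (intro DERIV_isconst_all) blast
    then show ?thesis by simp
  qed
  show "fst (F (x, y, z)) = fst (F (x, y, z'))" by (rule *[OF bounded_linear_fst]) simp
  show "fst (snd (F (x, y, z))) = fst (snd (F (x, y, z')))"
    by (rule *[OF bounded_linear_compose[OF bounded_linear_fst bounded_linear_snd]]) simp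
qed

text \<open>For an isometry \<open>F\<close> all points of a fiber give the same value, by
  \<open>isometry_base_const\<close>; \<open>z = 0\<close> picks a representative.\<close>

definition base_map ::
  "(real \<times> real \<times> real \<Rightarrow> real \<times> real \<times> real) \<Rightarrow> real \<times> real \<Rightarrow> real \<times> real" where
  "base_map F p = (fst (F (fst p, snd p, 0)), fst (snd (F (fst p, snd p, 0))))"

lemma base_map_eq:
  assumes "riemannian_isometry psl_space psl_metric F" "P \<in> psl_space"
  shows "base_map F (fst P, fst (snd P)) = (fst (F P), fst (snd (F P)))"
proof -
  obtain x y z where "P = (x, y, z)" "y > 0" using psl_spaceE[OF assms(2)] .
  then show ?thesis
    using isometry_base_const[OF assms(1), of y x 0 z] by (simp add: base_map_def)
qed

lemma base_map_mem:
  assumes "riemannian_isometry psl_space psl_metric F" "p \<in> hyp_plane"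
  shows "base_map F p \<in> hyp_plane"
proof -
  have "(fst p, snd p, 0) \<in> psl_space" using assms(2) by (cases p) (simp add: mem_psl_space mem_hyp_plane)
  then have "F (fst p, snd p, 0) \<in> psl_space" by (rule riemannian_isometryD(5)[OF assms(1)])
  then show ?thesis
    by (cases "F (fst p, snd p, 0)") (simp add: base_map_def mem_psl_space mem_hyp_plane)
qed

lemma smooth_on_base_map:
  assumes "riemannian_isometry psl_space psl_metric F"
  shows "smooth_on hyp_plane (base_map F)"
proof -
  have "smooth_on hyp_plane (\<lambda>p. F (fst p, snd p, 0))"
  proof (rule smooth_on_compose[OF open_hyp_plane open_psl_space _ _ riemannian_isometryD(2)[OF assms]])
    show "smooth_on hyp_plane (\<lambda>p. (fst p, snd p, 0::real))"
      by (intro smooth_intros open_hyp_plane)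
  qed (auto simp: mem_psl_space mem_hyp_plane)
  then show ?thesis
    unfolding base_map_def[abs_def] by (intro smooth_on_Pair smooth_on_fst smooth_on_snd open_hyp_plane)
qed

lemma base_map_inverse:
  assumes F: "riemannian_isometry psl_space psl_metric F" and G: "riemannian_isometry psl_space psl_metric G"
    and inv: "\<And>P. P \<in> psl_space \<Longrightarrow> G (F P) = P" and p: "p \<in> hyp_plane"
  shows "base_map G (base_map F p) = p"
proof -
  let ?P = "(fst p, snd p, 0)"
  have P: "?P \<in> psl_space" using p by (cases p) (simp add: mem_psl_space mem_hyp_plane)
  have "base_map G (base_map F p) = base_map G (fst (F ?P), fst (snd (F ?P)))"
    by (simp add: base_map_def[of F])
  also have "\<dots> = (fst (G (F ?P)), fst (snd (G (F ?P))))"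
    by (rule base_map_eq[OF G riemannian_isometryD(5)[OF F P]])
  finally show ?thesis by (simp add: inv[OF P])
qed

text \<open>The projection to the base is a Riemannian submersion: the length of a vector is the
  least length of the vectors above it, attained by the horizontal one. The differential of
  \<open>F\<close> maps the vectors above \<open>(a, b)\<close> to vectors above
  \<open>(\<alpha>, \<beta>)\<close>, so comparing minima gives both inequalities.\<close>

lemma hyp_isometry_base_map:
  assumes F: "riemannian_isometry psl_space psl_metric F"
  shows "hyp_isometry (base_map F)"
  unfolding hyp_isometry_def
proof (rule riemannian_isometryI[OF open_hyp_plane, where f' = "base_map (inv_into psl_space F)"])
  note iso = riemannian_isometryD[OF F]
  have G: "riemannian_isometry psl_space psl_metric (inv_into psl_space F)"
    by (rule riemannian_isometry_inverse[OF open_psl_space F])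
  have inv1: "base_map (inv_into psl_space F) (base_map F p) = p" if "p \<in> hyp_plane" for p
    by (rule base_map_inverse[OF F G bij_betw_inv_into_left[OF iso(1)] that])
  have inv2: "base_map F (base_map (inv_into psl_space F) p) = p" if "p \<in> hyp_plane" for p
    by (rule base_map_inverse[OF G F bij_betw_inv_into_right[OF iso(1)] that])
  show "bij_betw (base_map F) hyp_plane hyp_plane"
    by (rule bij_betwI[where g = "base_map (inv_into psl_space F)"])
      (simp_all add: Pi_I base_map_mem[OF F] base_map_mem[OF G] inv1 inv2)
  show "smooth_on hyp_plane (base_map F)" "smooth_on hyp_plane (base_map (inv_into psl_space F))"
    by (rule smooth_on_base_map[OF F], rule smooth_on_base_map[OF G])
  show "base_map (inv_into psl_space F) (base_map F p) = p" if "p \<in> hyp_plane" for p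
    by (rule inv1[OF that])
  show "hyp_metric (base_map F p) (frechet_derivative (base_map F) (at p) v) = hyp_metric p v"
    if p: "p \<in> hyp_plane" for p v
  proof -
    obtain x y where xy: "p = (x, y)" by (metis surj_pair)
    obtain a b where ab: "v = (a, b)" by (metis surj_pair)
    have y: "y > 0" using p by (simp add: xy mem_hyp_plane)
    let ?P = "(x, y, 0)"
    have P: "?P \<in> psl_space" using y by (simp add: mem_psl_space)
    let ?D = "frechet_derivative F (at ?P)"
    obtain \<alpha> \<beta> \<delta> where D: "?D (a, b, 0) = (\<alpha>, \<beta>, \<delta>)" by (metis prod_cases3)
    obtain \<sigma> where \<sigma>: "?D (0, 0, 1) = (0, 0, \<sigma>)" "\<sigma> * \<sigma> = 1"
      using isometry_fiber_direction[OF F P] .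
    obtain u v' w where FP: "F ?P = (u, v', w)" by (metis prod_cases3)
    have v': "v' > 0" using iso(5)[OF P] by (simp add: FP mem_psl_space)
    note lin = linear_frechet_derivative[OF smooth_on_imp_differentiable[OF iso(2) P]]
    have Dc: "?D (a, b, c) = (\<alpha>, \<beta>, \<delta> + \<sigma> * c)" for c
    proof -
      have "(a, b, c) = (a, b, 0) + c *\<^sub>R (0, 0, 1)" by simp
      then have "?D (a, b, c) = ?D (a, b, 0) + c *\<^sub>R ?D (0, 0, 1)"
        by (simp only: linear_add[OF lin] linear_scale[OF lin])
      then show ?thesis by (simp add: D \<sigma>(1))
    qed
    have m: "(\<alpha>\<^sup>2 + \<beta>\<^sup>2) / v'\<^sup>2 + (\<alpha> / v' + (\<delta> + \<sigma> * c))\<^sup>2 = (a\<^sup>2 + b\<^sup>2) / y\<^sup>2 + (a / y + c)\<^sup>2" for c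
      using iso(6)[OF P, of "(a, b, c)"] unfolding Dc FP psl_metric_eq[OF v'] psl_metric_eq[OF y] .
    \<comment> \<open>This value of \<open>c\<close> makes the image horizontal, that is,
      annihilated by dx/y + dz; the value \<open>- (a / y)\<close> used afterwards makes the
      original vector horizontal.\<close>
    have "\<alpha> / v' + (\<delta> + \<sigma> * (- \<sigma> * (\<alpha> / v' + \<delta>))) = \<alpha> / v' + \<delta> - (\<sigma> * \<sigma>) * (\<alpha> / v' + \<delta>)"
      by (simp add: algebra_simps)
    then have "\<alpha> / v' + (\<delta> + \<sigma> * (- \<sigma> * (\<alpha> / v' + \<delta>))) = 0" by (simp add: \<sigma>(2))
    then have "(\<alpha>\<^sup>2 + \<beta>\<^sup>2) / v'\<^sup>2 \<ge> (a\<^sup>2 + b\<^sup>2) / y\<^sup>2"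
      using m[of "- \<sigma> * (\<alpha> / v' + \<delta>)"] by simp
    moreover have "(\<alpha>\<^sup>2 + \<beta>\<^sup>2) / v'\<^sup>2 \<le> (a\<^sup>2 + b\<^sup>2) / y\<^sup>2"
    proof -
      have "(a / y + - (a / y))\<^sup>2 = 0" by simp
      then show ?thesis
        using m[of "- (a / y)"] zero_le_power2[of "\<alpha> / v' + (\<delta> + \<sigma> * - (a / y))"] by linarith
    qed
    ultimately have eq: "(\<alpha>\<^sup>2 + \<beta>\<^sup>2) / v'\<^sup>2 = (a\<^sup>2 + b\<^sup>2) / y\<^sup>2" by (rule antisym[rotated])
    have "((\<lambda>q. (fst q, snd q, 0::real)) has_derivative (\<lambda>h. (fst h, snd h, 0))) (at (x, y))"
      by (auto intro!: derivative_eq_intros)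
    from has_derivative_compose[OF this, of F ?D] smooth_on_has_derivative[OF iso(2) P]
    have "((\<lambda>q. F (fst q, snd q, 0)) has_derivative (\<lambda>h. ?D (fst h, snd h, 0))) (at (x, y))" by simp
    then have "(base_map F has_derivative
        (\<lambda>h. (fst (?D (fst h, snd h, 0)), fst (snd (?D (fst h, snd h, 0)))))) (at (x, y))"
      unfolding base_map_def[abs_def]
      by (intro has_derivative_Pair has_derivative_fst has_derivative_snd)
    then have "frechet_derivative (base_map F) (at p) v = (\<alpha>, \<beta>)"
      by (simp add: frechet_derivative_eq xy ab D)
    moreover have "base_map F p = (u, v')" by (simp add: base_map_def xy FP)
    ultimately show ?thesis using eq by (simp add: xy ab hyp_metric_eq)
  qed
qed

text \<open>If the fiber orientation were reversed, \<open>H\<close> would pull \<open>dx/y + dz\<close> back to \<open>-dx/y - dz\<close>, so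
  \<open>2dx/y\<close> would be exact; but it is not closed.\<close>

lemma isometry_over_identity:
  assumes H: "riemannian_isometry psl_space psl_metric H"
    and base: "\<And>P. P \<in> psl_space \<Longrightarrow> fst (H P) = fst P"
      "\<And>P. P \<in> psl_space \<Longrightarrow> fst (snd (H P)) = fst (snd P)"
  obtains a where "\<And>P. P \<in> psl_space \<Longrightarrow> H P = vertical_translation a P"
proof -
  note iso = riemannian_isometryD[OF H]
  define w where "w = (\<lambda>P. snd (snd (H P)))"
  have w: "smooth_on psl_space w" unfolding w_def by (intro smooth_intros open_psl_space iso(2))
  have HP: "H P = (fst P, fst (snd P), w P)" if "P \<in> psl_space" for P
    using base[OF that] by (simp add: w_def prod_eq_iff)
  let ?D = "\<lambda>P. frechet_derivative w (at P)"
  have DH: "frechet_derivative H (at P) V = (fst V, fst (snd V), ?D P V)" if P: "P \<in> psl_space" for P V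
  proof -
    have "((\<lambda>P. (fst P, fst (snd P), w P)) has_derivative (\<lambda>V. (fst V, fst (snd V), ?D P V))) (at P)"
      by (intro has_derivative_Pair has_derivative_fst has_derivative_snd has_derivative_ident
          smooth_on_has_derivative[OF w P])
    then have "(H has_derivative (\<lambda>V. (fst V, fst (snd V), ?D P V))) (at P)"
      by (rule has_derivative_transform_within_open[OF _ open_psl_space P]) (simp add: HP)
    then show ?thesis by (simp add: frechet_derivative_eq)
  qed
  \<comment> \<open>\<open>H\<close> leaves the base components unchanged, so the base parts of the
    metric cancel and only the squares of the two one-forms remain.\<close>
  have sq: "(a / y + ?D (x, y, z) (a, b, c))\<^sup>2 = (a / y + c)\<^sup>2" if y: "y > 0" for x y z a b c
  proof -
    have P: "(x, y, z) \<in> psl_space" using y by (simp add: mem_psl_space)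
    show ?thesis
      using iso(6)[OF P, of "(a, b, c)"] unfolding DH[OF P] HP[OF P] by (simp add: psl_metric_eq[OF y])
  qed
  have split: "?D P (a, b, c) = a * ?D P (1, 0, 0) + b * ?D P (0, 1, 0) + c * ?D P (0, 0, 1)"
    if "P \<in> psl_space" for P a b c
  proof -
    note lin = linear_frechet_derivative[OF smooth_on_imp_differentiable[OF w that]]
    have "(a, b, c) = a *\<^sub>R (1, 0, 0) + b *\<^sub>R (0, 1, 0) + c *\<^sub>R (0, 0, 1::real)" by simp
    then have "?D P (a, b, c) = a *\<^sub>R ?D P (1, 0, 0) + b *\<^sub>R ?D P (0, 1, 0) + c *\<^sub>R ?D P (0, 0, 1)"
      by (simp only: linear_add[OF lin] linear_scale[OF lin])
    then show ?thesis by simp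
  qed
  have Dz: "?D P (0, 0, 1) * ?D P (0, 0, 1) = 1" and Dy: "?D P (0, 1, 0) = 0"
    if P: "P \<in> psl_space" for P
  proof -
    obtain x y z where "P = (x, y, z)" "y > 0" using psl_spaceE[OF P] .
    then show "?D P (0, 0, 1) * ?D P (0, 0, 1) = 1" "?D P (0, 1, 0) = 0"
      using sq[of y 0 x z 0 1] sq[of y 0 x z 1 0] by (simp_all add: power2_eq_square)
  qed
  have "(\<lambda>P. ?D P (0, 0, 1)) constant_on psl_space"
  proof (rule continuous_finite_range_constant)
    show "connected psl_space" using convex_psl_space by (rule convex_connected)
    show "continuous_on psl_space (\<lambda>P. ?D P (0, 0, 1))"
      by (rule smooth_on_imp_continuous_on[OF smooth_on_frechet_derivative[OF w]])
    have "(\<lambda>P. ?D P (0, 0, 1)) ` psl_space \<subseteq> {1, -1}"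
      using square_eq_1_iff[THEN iffD1, OF Dz] by blast
    then show "finite ((\<lambda>P. ?D P (0, 0, 1)) ` psl_space)" by (rule finite_subset) simp
  qed
  then obtain e where e: "\<And>P. P \<in> psl_space \<Longrightarrow> ?D P (0, 0, 1) = e"
    unfolding constant_on_def by blast
  have P0: "(0, 1, 0) \<in> psl_space" by (simp add: mem_psl_space)
  \<comment> \<open>The vector \<open>(1, 0, - (1 / y))\<close> is annihilated by dx/y + dz. Its
    square in \<open>sq\<close> vanishes, which determines the derivative without an ambiguity of
    sign.\<close>
  have Dx: "?D P (1, 0, 0) = (e - 1) / fst (snd P)" if mem: "P \<in> psl_space" for P
  proof -
    obtain x y z where P: "P = (x, y, z)" "y > 0" using psl_spaceE[OF mem] .
    have "?D P (1, 0, - (1 / y)) = ?D P (1, 0, 0) - e / y"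
      using split[OF mem, of 1 0 "- (1 / y)"] e[OF mem] by simp
    then have "(1 / y + (?D P (1, 0, 0) - e / y))\<^sup>2 = 0"
      using sq[OF P(2), of 1 x z 0 "- (1 / y)"] by (simp add: P(1))
    then show ?thesis by (simp add: P(1) diff_divide_distrib)
  qed
  have "e = 1"
  proof -
    have "frechet_derivative (\<lambda>Q. ?D Q (1, 0, 0)) (at (0, 1, 0)) (0, 1, 0) =
        frechet_derivative (\<lambda>Q. ?D Q (0, 1, 0)) (at (0, 1, 0)) (1, 0, 0)"
      by (rule mixed_derivatives_commute[OF open_psl_space w P0])
    also have "frechet_derivative (\<lambda>Q. ?D Q (0, 1, 0)) (at (0, 1, 0)) = (\<lambda>V. 0)"
      using differentiable_eq_on_open(2)[OF open_psl_space P0, of "\<lambda>_. 0" "\<lambda>Q. ?D Q (0, 1, 0)"] Dy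
      by simp
    finally have 1: "frechet_derivative (\<lambda>Q. ?D Q (1, 0, 0)) (at (0, 1, 0)) (0, 1, 0) = 0" .
    have "((\<lambda>Q::real \<times> real \<times> real. (e - 1) / fst (snd Q)) has_derivative (\<lambda>V. - ((e - 1) * fst (snd V)))) (at (0, 1, 0))"
      by (auto intro!: derivative_eq_intros)
    then have "((\<lambda>Q. ?D Q (1, 0, 0)) has_derivative (\<lambda>V. - ((e - 1) * fst (snd V)))) (at (0, 1, 0))"
      by (rule has_derivative_transform_within_open[OF _ open_psl_space P0]) (simp add: Dx)
    from frechet_derivative_eq[OF this] 1 show ?thesis by simp
  qed
  have "((\<lambda>P. w P - snd (snd P)) has_derivative (\<lambda>V. 0)) (at P within psl_space)"
    if P: "P \<in> psl_space" for P
  proof -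
    have "?D P V = snd (snd V)" for V
      using split[OF P, of "fst V" "fst (snd V)" "snd (snd V)"]
      by (simp add: Dx[OF P] Dy[OF P] e[OF P] \<open>e = 1\<close>)
    then have "?D P = (\<lambda>V. snd (snd V))" by (rule ext)
    with smooth_on_has_derivative[OF w P] have "(w has_derivative (\<lambda>V. snd (snd V))) (at P)"
      by simp
    then have "((\<lambda>P. w P - snd (snd P)) has_derivative (\<lambda>V. snd (snd V) - snd (snd V))) (at P)"
      by (intro has_derivative_diff has_derivative_snd has_derivative_ident)
    then show ?thesis by (simp add: has_derivative_at_withinI)
  qed
  from has_derivative_zero_constant[OF convex_psl_space this]
  obtain a where a: "\<forall>P\<in>psl_space. w P - snd (snd P) = a" by blast
  have "H P = vertical_translation a P" if P: "P \<in> psl_space" for P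
  proof -
    have "w P = snd (snd P) + a" using a P by (simp add: algebra_simps)
    then show ?thesis by (simp add: HP[OF P] vertical_translation_apply[OF P])
  qed
  then show thesis using that by blast
qed

section \<open>Generation by lifts and vertical translations\<close>

lemma psl_isometry_in_generate:
  assumes "F \<in> carrier psl_isometry_group"
  shows "F \<in> generate (BijGroup psl_space) (isometry_lifts \<union> vertical_translations)"
proof -
  let ?B = "BijGroup psl_space"
  have F: "F \<in> Bij psl_space" "riemannian_isometry psl_space psl_metric F"
    using assms by (auto simp: carrier_psl_isometry_group)
  note iso = riemannian_isometryD[OF F(2)]
  have \<phi>: "hyp_isometry (base_map F)" by (rule hyp_isometry_base_map[OF F(2)])
  define f where "f = inv_into hyp_plane (base_map F)"
  have f: "hyp_isometry f" unfolding f_def by (rule hyp_isometry_inverse[OF \<phi>])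
  obtain L where lift: "lift_of f L" using lift_of_exists[OF f] .
  then have Lgen: "L \<in> isometry_lifts" using f by (auto simp: isometry_lifts_def)
  then have L: "L \<in> Bij psl_space" "riemannian_isometry psl_space psl_metric L"
    using isometry_lifts_subset by (auto simp: carrier_psl_isometry_group)
  have baseL: "(fst (L P), fst (snd (L P))) = f (fst P, fst (snd P))" if "P \<in> psl_space" for P
  proof -
    have "psl_proj (L P) = tangent_map f (psl_proj P)" using lift that by (simp add: lift_of_def)
    then have "fst (psl_proj (L P)) = f (fst (psl_proj P))" by (simp add: tangent_map_def case_prod_unfold)
    moreover have "fst (psl_proj Q) = (fst Q, fst (snd Q))" for Q
      by (cases Q) (simp add: psl_proj_eq)
    ultimately show ?thesis by simp
  qed
  have LF: "riemannian_isometry psl_space psl_metric (\<lambda>P. L (F P))"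
    by (rule riemannian_isometry_compose[OF open_psl_space F(2) L(2)])
  have base: "(fst (L (F P)), fst (snd (L (F P)))) = (fst P, fst (snd P))" if P: "P \<in> psl_space" for P
  proof -
    have "(fst P, fst (snd P)) \<in> hyp_plane" using P by (cases P) (simp add: mem_psl_space mem_hyp_plane)
    then have "f (base_map F (fst P, fst (snd P))) = (fst P, fst (snd P))"
      unfolding f_def
      using bij_betw_inv_into_left[OF riemannian_isometryD(1)[OF \<phi>[unfolded hyp_isometry_def]]] by simp
    then show ?thesis
      using baseL[OF iso(5)[OF P]] base_map_eq[OF F(2) P] by simp
  qed
  obtain a where a: "\<And>P. P \<in> psl_space \<Longrightarrow> L (F P) = vertical_translation a P"
    using isometry_over_identity[OF LF] base by auto
  interpret B: group ?B by (rule group_BijGroup)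
  have car: "F \<in> carrier ?B" "L \<in> carrier ?B" using F L by (auto simp: BijGroup_def)
  \<comment> \<open>Equality in the group is equality of total functions; outside
    \<open>psl_space\<close> both sides are \<open>undefined\<close>.\<close>
  have "L \<otimes>\<^bsub>?B\<^esub> F = vertical_translation a"
  proof
    fix P
    show "(L \<otimes>\<^bsub>?B\<^esub> F) P = vertical_translation a P"
      using a F(1) L(1) by (cases "P \<in> psl_space")
        (simp_all add: BijGroup_def compose_def vertical_translation_def)
  qed
  \<comment> \<open>\<open>generate\<close> admits inverses of generators, so this is a word of two
    letters.\<close>
  then have "F = inv\<^bsub>?B\<^esub> L \<otimes>\<^bsub>?B\<^esub> vertical_translation a"
    using car B.inv_solve_left' by (metis B.inv_closed B.l_inv B.l_one B.m_assoc)
  moreover have "vertical_translation a \<in> vertical_translations"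
    by (simp add: vertical_translations_def)
  ultimately show ?thesis
    using Lgen by (simp add: generate.eng generate.inv generate.incl)
qed

theorem theorem2p9:
  shows "generate (BijGroup psl_space) (isometry_lifts \<union> vertical_translations)
    = carrier psl_isometry_group"
proof (intro equalityI subsetI psl_isometry_in_generate)
  have "subgroup (carrier psl_isometry_group) (BijGroup psl_space)"
    unfolding carrier_psl_isometry_group by (rule subgroup_riemannian_isometries[OF open_psl_space])
  then have "generate (BijGroup psl_space) (isometry_lifts \<union> vertical_translations)
      \<subseteq> carrier psl_isometry_group"
    using isometry_lifts_subset vertical_translations_subset
    by (intro group.generate_subgroup_incl[OF group_BijGroup]) auto
  then show "F \<in> carrier psl_isometry_group"
    if "F \<in> generate (BijGroup psl_space) (isometry_lifts \<union> vertical_translations)" for F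
    using that by blast
qed

end
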